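(* Let $n\ge2$ and let $S$ be a nondegenerate $n$-simplex in an $n$-dimensional real vector space $\mathbb V$, with chosen inpoints. Let $A^{n-1}(S)=K^{n-1}(S)+\mathfrak p_S\Lambda^n(S)$ and $A^n(S)=\Lambda^n(S)$ (constant $n$-forms). Take as degrees of freedom on $A^{n-1}(S)$ the values at the vertices of $S$ and the integrals of the pullbacks to the $(n-1)$-dimensional faces of $S$, and on $A^n(S)$ the integral over $S$. Then: (a) these degrees of freedom are unisolvent, and $\dim A^{n-1}(S)=(n+1)^2$, $\dim A^n(S)=1$; (b) the associated interpolators commute with the divergence operator: if $I^{n-1}$ (defined on continuous $(n-1)$-forms on $S$ with continuous exterior derivative) and $I^n$ (defined on continuous $n$-forms on $S$) send a form to the unique element of $A^{n-1}(S)$, resp. $A^n(S)$, with the same degrees of freedom, then $\mathrm dI^{n-1}u=I^n\mathrm du$; (c) this gives a minimal good element for continuous vector fields with discontinuous divergence, in the sense that these dimensions equal the lower bounds $(n+1)\dim\mathrm{Alt}^{n-1}(\mathbb V)+(n+1)$ for index $n-1$ and $1$ for index $n$.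
   Context: $\mathrm{Alt}^k(\mathbb V)$ is the space of alternating $k$-linear forms on $\mathbb V$; $\Lambda^k(S)$ is the space of constant $k$-forms on $S$. A simplex is identified with its vertex set, its faces with nonempty subsets. For each face $T$ of $S$ an inpoint $W_T$ in the relative interior of $T$ is chosen ($W_T=T$ if $T$ is a vertex). For $m\ge0$ and a face $T$, $\mathcal R_m(T)$ is the simplicial complex consisting of the simplices $[W_{T_k},\ldots,W_{T_0},V_0,\ldots,V_l]$ (and their faces), where $T'=[V_0,\ldots,V_l]$ is a face of $T$ of dimension $l\le m$ and $T'\subsetneq T_0\subsetneq\cdots\subsetneq T_k$ is a (possibly empty) chain of faces of $T$ of dimension at least $m+1$. $\mathrm C^0\mathrm P^1\Lambda^k(\mathcal R)$ is the space of $k$-forms which are continuous (all components) and have affine coefficients on each simplex of $\mathcal R$. For $k\ge1$, $K^k(S)=\{u\in\mathrm C^0\mathrm P^1\Lambda^k(\mathcal R_{k-1}(S)):\mathrm du=0\}$. $\mathfrak p_S$ is the Poincaré operator based at $W_S$: $(\mathfrak p_Su)_x(\xi_2,\ldots,\xi_k)=\int_0^1t^{k-1}u_{W_S+t(x-W_S)}(x-W_S,\xi_2,\ldots,\xi_k)\,\mathrm dt$. The value of a $k$-form at a vertex means the whole element of $\mathrm{Alt}^k(\mathbb V)$. Unisolvent means that an element is uniquely determined by its degrees of freedom and these can be prescribed arbitrarily. Through vector proxies, $(n-1)$-forms correspond to vector fields and $\mathrm d$ on $(n-1)$-forms to the divergence. The lower bounds in (c) reflect that a compatible system containing the constant forms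 must have the full space $\mathrm{Alt}^{n-1}(\mathbb V)$ at each vertex at index $n-1$ (restriction to faces keeping all components of $u$), at least one additional dimension for each $(n-1)$-face, and at index $n$ (restriction being the pullback) at least one dimension for $S$. *)

theory Defs
  imports "HOL-Analysis.Analysis" "HOL-Library.Function_Algebras"
begin

text \<open>
  Spaces of forms are sets of functions. Making functions into a real vector space (pointwise
  operations) lets the library's \<^term>\<open>subspace\<close> and \<^term>\<open>dim\<close> apply to them.
\<close>

instantiation "fun" :: (type, real_vector) real_vector
begin

definition scaleR_fun_def: "c *\<^sub>R f = (\<lambda>x. c *\<^sub>R f x)"

instance
  by standard (auto simp: scaleR_fun_def fun_eq_iff scaleR_add_right scaleR_add_left)

end


section \<open>Differential forms on a simplex\<close>

text \<open>
  A \<open>k\<close>-linear form is a function on lists of vectors that vanishes on lists of length other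
  than \<open>k\<close>, so that equality of functions is equality of forms. The ambient space is a type
  of class \<^class>\<open>euclidean_space\<close>; the inner product plays no role except in normalising
  \<^term>\<open>lborel\<close>, which occurs only in \<open>has_ext_deriv\<close>, where the normalisation cancels.
\<close>

type_synonym 'a form = "'a list \<Rightarrow> real"

definition Alt :: "nat \<Rightarrow> 'a::real_vector form set" where
  "Alt k = {f.
     (\<forall>vs. length vs \<noteq> k \<longrightarrow> f vs = 0) \<and>
     (\<forall>vs i. length vs = k \<longrightarrow> i < k \<longrightarrow> linear (\<lambda>x. f (vs[i := x]))) \<and>
     (\<forall>vs i j. length vs = k \<longrightarrow> i < j \<longrightarrow> j < k \<longrightarrow> vs ! i = vs ! j \<longrightarrow> f vs = 0)}"

text \<open>
  A simplex is represented by its vertex set \<open>S\<close>, with underlying point set \<open>convex hull S\<close>.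
  A form on \<open>S\<close> is a function on the whole ambient space that is set to \<open>0\<close> off
  \<open>convex hull S\<close>, again so that equality of functions is equality of forms on \<open>S\<close>.
\<close>

definition C0_forms :: "nat \<Rightarrow> 'a::euclidean_space set \<Rightarrow> ('a \<Rightarrow> 'a form) set" where
  "C0_forms k S = {u.
     (\<forall>x. u x \<in> Alt k) \<and>
     (\<forall>x. x \<notin> convex hull S \<longrightarrow> u x = 0) \<and>
     (\<forall>vs. continuous_on (convex hull S) (\<lambda>x. u x vs))}"

definition const_forms :: "nat \<Rightarrow> 'a::euclidean_space set \<Rightarrow> ('a \<Rightarrow> 'a form) set" where
  "const_forms k S = {(\<lambda>x. if x \<in> convex hull S then a else 0) | a. a \<in> Alt k}"


subsection \<open>Exterior derivative of continuous forms\<close>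

text \<open>Continuously differentiable functions \<open>\<phi>\<close>, with derivative \<open>\<phi>'\<close>, of compact support in \<open>U\<close>.\<close>

definition test_function ::
    "'a::euclidean_space set \<Rightarrow> ('a \<Rightarrow> real) \<Rightarrow> ('a \<Rightarrow> 'a \<Rightarrow> real) \<Rightarrow> bool" where
  "test_function U \<phi> \<phi>' \<longleftrightarrow>
     (\<forall>x. (\<phi> has_derivative \<phi>' x) (at x)) \<and>
     (\<forall>h. continuous_on UNIV (\<lambda>x. \<phi>' x h)) \<and>
     (\<exists>K\<subseteq>U. compact K \<and> (\<forall>x. x \<notin> K \<longrightarrow> \<phi> x = 0))"

text \<open>
  The forms at hand are merely continuous, so the exterior derivative is the weak
  (distributional) one: the formula
  \<open>(du)(\<xi>\<^sub>0,\<dots>,\<xi>\<^sub>k) = \<Sum>\<^sub>i (-1)^i \<partial>\<^bsub>\<xi>\<^sub>i\<^esub> u(\<xi>\<^sub>0,\<dots>,\<xi>\<^sub>k without \<xi>\<^sub>i)\<close>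
  is tested against functions supported in the interior of \<open>S\<close>. It is used only for \<open>u\<close> and \<open>w\<close>
  continuous on \<open>S\<close>; then the integrands are integrable, \<open>w\<close> is determined by \<open>u\<close>, and
  testing with C^1 functions is the same as testing with smooth ones.
\<close>

definition has_ext_deriv ::
    "nat \<Rightarrow> 'a::euclidean_space set \<Rightarrow> ('a \<Rightarrow> 'a form) \<Rightarrow> ('a \<Rightarrow> 'a form) \<Rightarrow> bool" where
  "has_ext_deriv k S u w \<longleftrightarrow>
     (\<forall>\<phi> \<phi>' \<xi>. test_function (interior (convex hull S)) \<phi> \<phi>' \<longrightarrow> length \<xi> = Suc k \<longrightarrow>
       (LINT x:interior (convex hull S)|lborel. w x \<xi> * \<phi> x) =
       - (\<Sum>i<Suc k. (- 1) ^ i *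
           (LINT x:interior (convex hull S)|lborel.
              u x (take i \<xi> @ drop (Suc i) \<xi>) * \<phi>' x (\<xi> ! i))))"


subsection \<open>Integral of the pullback to an oriented simplex\<close>

text \<open>
  For a list \<open>ps = [p\<^sub>0,\<dots>,p\<^sub>k]\<close>, this is the integral of the \<open>k\<close>-form \<open>u\<close> over the oriented
  simplex \<open>[p\<^sub>0,\<dots>,p\<^sub>k]\<close>: the pullback of \<open>u\<close> under \<open>t \<mapsto> p\<^sub>0 + \<Sum>\<^sub>i t\<^sub>i (p\<^sub>i - p\<^sub>0)\<close> is integrated over the
  standard \<open>k\<close>-simplex. Coordinates are indexed by \<open>i < k\<close>, with \<open>t i\<close> belonging to \<open>p\<^bsub>i+1\<^esub>\<close>.
\<close>

definition integral_simplex :: "'a::euclidean_space list \<Rightarrow> ('a \<Rightarrow> 'a form) \<Rightarrow> real" where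
  "integral_simplex ps u =
     (let k = length ps - 1 in
      (LINT t:{t. (\<forall>i<k. 0 \<le> t i) \<and> (\<Sum>i<k. t i) \<le> 1}|Pi\<^sub>M {..<k} (\<lambda>_. lborel).
         u (ps ! 0 + (\<Sum>i<k. t i *\<^sub>R (ps ! Suc i - ps ! 0)))
           (map (\<lambda>q. q - ps ! 0) (tl ps))))"


section \<open>Faces, inpoints and refinements\<close>

definition faces :: "'a set \<Rightarrow> 'a set set" where
  "faces T = {F. F \<subseteq> T \<and> F \<noteq> {}}"

text \<open>Note that \<open>rel_interior {v} = {v}\<close>, so the inpoint of a vertex is that vertex.\<close>

definition inpoints :: "'a::euclidean_space set \<Rightarrow> ('a set \<Rightarrow> 'a) \<Rightarrow> bool" where
  "inpoints S W \<longleftrightarrow> (\<forall>T\<in>faces S. W T \<in> rel_interior (convex hull T))"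

text \<open>An orientation of each face, given by an enumeration of its vertices.\<close>

definition orientations :: "'a set \<Rightarrow> ('a set \<Rightarrow> 'a list) \<Rightarrow> bool" where
  "orientations S ori \<longleftrightarrow> (\<forall>T\<in>faces S. distinct (ori T) \<and> set (ori T) = T)"

text \<open>
  The simplicial complex \<open>R\<^sub>m(T)\<close>, as a set of vertex sets. A face of dimension \<open>l\<close> has \<open>l + 1\<close>
  vertices, so dimension at most \<open>m\<close> is \<open>card \<le> m + 1\<close>, and at least \<open>m + 1\<close> is \<open>card \<ge> m + 2\<close>.
\<close>

definition refinement :: "nat \<Rightarrow> ('a set \<Rightarrow> 'a) \<Rightarrow> 'a set \<Rightarrow> 'a set set" where
  "refinement m W T = {\<sigma>. \<sigma> \<noteq> {} \<and>
     (\<exists>F C. F \<in> faces T \<and> card F \<le> m + 1 \<and>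
        C \<subseteq> {G \<in> faces T. card G \<ge> m + 2 \<and> F \<subset> G} \<and> chain\<^sub>\<subseteq> C \<and>
        \<sigma> \<subseteq> W ` C \<union> F)}"

definition C0P1_forms ::
    "nat \<Rightarrow> 'a::euclidean_space set \<Rightarrow> 'a set set \<Rightarrow> ('a \<Rightarrow> 'a form) set" where
  "C0P1_forms k S R = {u \<in> C0_forms k S.
     \<forall>\<sigma>\<in>R. \<forall>vs. \<exists>L c. linear L \<and> (\<forall>x\<in>convex hull \<sigma>. u x vs = c + L x)}"


section \<open>The finite element spaces and interpolators\<close>

definition K_space ::
    "nat \<Rightarrow> 'a::euclidean_space set \<Rightarrow> ('a set \<Rightarrow> 'a) \<Rightarrow> ('a \<Rightarrow> 'a form) set" where
  "K_space k S W = {u \<in> C0P1_forms k S (refinement (k - 1) W S). has_ext_deriv k S u 0}"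

definition poincare ::
    "nat \<Rightarrow> 'a::euclidean_space set \<Rightarrow> ('a set \<Rightarrow> 'a) \<Rightarrow> ('a \<Rightarrow> 'a form) \<Rightarrow> ('a \<Rightarrow> 'a form)" where
  "poincare k S W u =
     (\<lambda>x vs. if x \<in> convex hull S
             then integral {0..1}
                    (\<lambda>t. t ^ (k - 1) * u (W S + t *\<^sub>R (x - W S)) ((x - W S) # vs))
             else 0)"

text \<open>
  \<open>A_vec\<close> is the space of index \<open>n - 1\<close> (vector fields) and \<open>A_top\<close> the one of index \<open>n\<close>, on an
  \<open>n\<close>-simplex \<open>S\<close>.
\<close>

definition A_vec ::
    "nat \<Rightarrow> 'a::euclidean_space set \<Rightarrow> ('a set \<Rightarrow> 'a) \<Rightarrow> ('a \<Rightarrow> 'a form) set" where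
  "A_vec n S W = {a + b | a b. a \<in> K_space (n - 1) S W \<and> b \<in> poincare n S W ` const_forms n S}"

definition A_top :: "nat \<Rightarrow> 'a::euclidean_space set \<Rightarrow> ('a \<Rightarrow> 'a form) set" where
  "A_top n S = const_forms n S"

definition facets :: "nat \<Rightarrow> 'a set \<Rightarrow> 'a set set" where
  "facets n S = {T \<in> faces S. card T = n}"

text \<open>
  The degrees of freedom of \<open>u\<close> at index \<open>n - 1\<close> are \<open>c\<close> (vertex values) and \<open>r\<close> (facet integrals).
\<close>

definition has_dofs_vec ::
    "nat \<Rightarrow> 'a::euclidean_space set \<Rightarrow> ('a set \<Rightarrow> 'a list) \<Rightarrow> ('a \<Rightarrow> 'a form) \<Rightarrow>
     ('a \<Rightarrow> 'a form) \<Rightarrow> ('a set \<Rightarrow> real) \<Rightarrow> bool" where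
  "has_dofs_vec n S ori u c r \<longleftrightarrow>
     (\<forall>x\<in>S. u x = c x) \<and> (\<forall>T\<in>facets n S. integral_simplex (ori T) u = r T)"

definition I_vec ::
    "nat \<Rightarrow> 'a::euclidean_space set \<Rightarrow> ('a set \<Rightarrow> 'a) \<Rightarrow> ('a set \<Rightarrow> 'a list) \<Rightarrow>
     ('a \<Rightarrow> 'a form) \<Rightarrow> ('a \<Rightarrow> 'a form)" where
  "I_vec n S W ori u =
     (THE v. v \<in> A_vec n S W \<and> has_dofs_vec n S ori v u (\<lambda>T. integral_simplex (ori T) u))"

definition I_top ::
    "nat \<Rightarrow> 'a::euclidean_space set \<Rightarrow> ('a set \<Rightarrow> 'a list) \<Rightarrow>
     ('a \<Rightarrow> 'a form) \<Rightarrow> ('a \<Rightarrow> 'a form)" where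
  "I_top n S ori w =
     (THE v. v \<in> A_top n S \<and> integral_simplex (ori S) v = integral_simplex (ori S) w)"

end

theory Submission
  imports Defs
begin

text \<open>
  Contraction with a volume form identifies \<open>(n - 1)\<close>-forms with vector fields (\<open>proxy\<close>,
  \<open>contract\<close>). The exterior derivative becomes the divergence, and the pullback to the facet
  opposite the vertex \<open>v\<close> becomes, up to a non-zero factor, the component \<open>grad v\<close>, where \<open>grad v\<close>
  is the linear part of the barycentric coordinate of \<open>v\<close> (\<open>facet_form\<close>).
  
  The maximal simplices of the refinement are the cells \<open>[W S, W (S - {i}), F]\<close> with
  \<open>F = S - {i, j}\<close>. A continuous field that is affine on each cell is given by its values \<open>P k\<close> at
  the vertices, \<open>Q i\<close> at the facet inpoints and \<open>A\<close> at \<open>W S\<close>, and its divergence on the cell is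
  (\<open>cdiv_alt\<close>)
  \<open>grad i A / w i + grad j (Q i) / \<tau> i j + h i j\<close>,
  where \<open>w\<close> and \<open>\<tau>\<close> are barycentric coordinates of the inpoints and \<open>h\<close> depends only on \<open>P\<close> and on
  the numbers \<open>grad i (Q i)\<close>. The Poincare operator maps constant \<open>n\<close>-forms to multiples of the
  radial field \<open>x - W S\<close>, so \<open>A_vec\<close> consists of the fields for which all cell divergences
  are equal to one number \<open>d\<close> (\<open>A_vec_iff\<close>).
  
  The vertex values prescribe \<open>P\<close>, and the facet integrals then prescribe \<open>grad i (Q i)\<close>. With
  \<open>s i = d - grad i A / w i\<close> the equations for the cells read
  \<open>grad j (Q i) = \<tau> i j * (s i - h i j)\<close>. The components of a vector add up to zero and
  those of a point to one: summing over \<open>j\<close> determines \<open>s i\<close>, and summing \<open>grad i A\<close> over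
  \<open>i\<close> determines \<open>d\<close>. So the system has exactly one solution (\<open>solve_const_div\<close>,
  \<open>const_div_unique\<close>), which is unisolvence, and the degrees of freedom give the dimension.
  
  Two analytic facts connect this with the weak exterior derivative. Integration by parts for Lipschitz
  functions (\<open>integral_by_parts_lipschitz\<close>) shows that the weak divergence is computed cell by cell.
  Stokes' theorem for continuous forms (\<open>stokes\<close>), obtained from test functions that approximate
  the indicator function of \<open>S\<close>, shows that the integral over \<open>S\<close> of the exterior derivative is a
  function of the facet integrals. Hence \<open>u\<close> and its interpolant have exterior derivatives with the
  same integral, and the constant one among these is the interpolant of the other.
\<close>

section \<open>Dimension by coordinates\<close>

text \<open>
  Unisolvent coordinates have a dual basis, whose size is the dimension. The ambient
  space may be infinite-dimensional, as spaces of functions are.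
\<close>

lemma dim_eq_card_coordinates:
  fixes V :: "'v::real_vector set" and \<Psi> :: "'v \<Rightarrow> 'i \<Rightarrow> real"
  assumes fin: "finite I" and V: "subspace V"
    and add: "\<And>x y i. x \<in> V \<Longrightarrow> y \<in> V \<Longrightarrow> i \<in> I \<Longrightarrow> \<Psi> (x + y) i = \<Psi> x i + \<Psi> y i"
    and scale: "\<And>a x i. x \<in> V \<Longrightarrow> i \<in> I \<Longrightarrow> \<Psi> (a *\<^sub>R x) i = a * \<Psi> x i"
    and surj: "\<And>g. \<exists>x\<in>V. \<forall>i\<in>I. \<Psi> x i = g i"
    and inj: "\<And>x. x \<in> V \<Longrightarrow> (\<And>i. i \<in> I \<Longrightarrow> \<Psi> x i = 0) \<Longrightarrow> x = 0"
  shows "dim V = card I"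
proof -
  have "\<forall>i. \<exists>x\<in>V. \<forall>j\<in>I. \<Psi> x j = (if j = i then 1 else 0)"
    by (intro allI surj)
  then obtain e where eV: "\<And>i. e i \<in> V"
    and e: "\<And>i j. j \<in> I \<Longrightarrow> \<Psi> (e i) j = (if j = i then 1 else 0)"
    by metis
  have comb: "(\<Sum>i\<in>J. c i *\<^sub>R e i) \<in> V" if "J \<subseteq> I" for J c
    using that V eV by (intro subspace_sum subspace_scale) auto
  have coord: "\<Psi> (\<Sum>i\<in>J. c i *\<^sub>R e i) j = (\<Sum>i\<in>J. if j = i then c i else 0)"
    if J: "J \<subseteq> I" and j: "j \<in> I" for J c j
  proof -
    have "finite J" using J fin finite_subset by blast
    then show ?thesis using J
    proof (induction J)
      case empty
      have "\<Psi> (0 *\<^sub>R 0) j = 0 * \<Psi> 0 j" using scale[of 0 j 0] V j subspace_0 by blast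
      then show ?case by simp
    next
      case (insert i J)
      have "\<Psi> (\<Sum>i\<in>insert i J. c i *\<^sub>R e i) j = \<Psi> (c i *\<^sub>R e i + (\<Sum>i\<in>J. c i *\<^sub>R e i)) j"
        using insert by simp
      also have "\<dots> = c i * \<Psi> (e i) j + \<Psi> (\<Sum>i\<in>J. c i *\<^sub>R e i) j"
        using add[of "c i *\<^sub>R e i" "\<Sum>i\<in>J. c i *\<^sub>R e i" j] scale[of "e i" j "c i"] eV comb[of J c] j
          insert.prems V subspace_scale[OF V eV, of "c i" i] by auto
      finally show ?case using insert e[OF j] by simp
    qed
  qed
  have coord': "\<Psi> (\<Sum>i\<in>I. c i *\<^sub>R e i) j = c j" if "j \<in> I" for c j
    using coord[of I j c] that fin by simp
  have inj_e: "inj_on e I"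
    by (rule inj_onI) (metis e zero_neq_one)
  have indep: "independent (e ` I)"
  proof (rule independent_if_scalars_zero)
    show "finite (e ` I)" using fin by simp
  next
    fix u v assume u: "(\<Sum>v\<in>e ` I. u v *\<^sub>R v) = 0" and v: "v \<in> e ` I"
    then obtain j where j: "j \<in> I" "v = e j" by auto
    have *: "(\<Sum>i\<in>I. u (e i) *\<^sub>R e i) = 0" using u by (simp add: sum.reindex[OF inj_e])
    have "u (e j) = \<Psi> 0 j" using coord'[OF j(1), of "\<lambda>i. u (e i)"] * by simp
    also have "\<dots> = 0" using scale[of 0 j 0] V j subspace_0[OF V] by simp
    finally show "u v = 0" using j by simp
  qed
  have "V \<subseteq> span (e ` I)"
  proof
    fix x assume x: "x \<in> V"
    let ?y = "\<Sum>i\<in>I. \<Psi> x i *\<^sub>R e i"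
    have y: "?y \<in> V" using comb by blast
    have "x - ?y = 0"
    proof (rule inj)
      show "x - ?y \<in> V" using x y V by (rule_tac subspace_diff)
      fix i assume i: "i \<in> I"
      have "\<Psi> (x + (- 1) *\<^sub>R ?y) i = \<Psi> x i + (- 1) * \<Psi> ?y i"
        using add[OF x subspace_scale[OF V y, of "- 1"] i] scale[OF y i, of "- 1"] by metis
      then show "\<Psi> (x - ?y) i = 0" using coord'[OF i] by simp
    qed
    moreover have "?y \<in> span (e ` I)"
      by (intro span_sum span_scale span_base) auto
    ultimately show "x \<in> span (e ` I)" by simp
  qed
  then have "dim V = card (e ` I)"
    using dim_unique[of "e ` I" V] indep eV by auto
  then show ?thesis using inj_e by (simp add: card_image)
qed


section \<open>Alternating forms\<close>

abbreviation del :: "nat \<Rightarrow> 'b list \<Rightarrow> 'b list" where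
  "del i xs \<equiv> take i xs @ drop (Suc i) xs"

lemma Alt_length: "f \<in> Alt k \<Longrightarrow> length vs \<noteq> k \<Longrightarrow> f vs = 0"
  by (simp add: Alt_def)

lemma Alt_linear: "f \<in> Alt k \<Longrightarrow> length vs = k \<Longrightarrow> i < k \<Longrightarrow> linear (\<lambda>x. f (vs[i := x]))"
  by (simp add: Alt_def)

lemma Alt_repeat: "f \<in> Alt k \<Longrightarrow> i < j \<Longrightarrow> j < length vs \<Longrightarrow> vs ! i = vs ! j \<Longrightarrow> f vs = 0"
  by (cases "length vs = k") (auto simp: Alt_def)

lemma Alt_not_distinct: "f \<in> Alt k \<Longrightarrow> \<not> distinct vs \<Longrightarrow> f vs = 0"
  unfolding distinct_conv_nth by (metis Alt_repeat nat_neq_iff)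

lemma subspace_Alt: "subspace (Alt k)"
  unfolding subspace_def
proof (intro conjI ballI allI)
  show "0 \<in> Alt k" by (auto simp: Alt_def linear_iff)
  show "f + g \<in> Alt k" if "f \<in> Alt k" "g \<in> Alt k" for f g :: "'a form"
    using that by (auto simp: Alt_def linear_iff algebra_simps)
  show "c *\<^sub>R f \<in> Alt k" if "f \<in> Alt k" for f :: "'a form" and c
    using that by (auto simp: Alt_def linear_iff scaleR_fun_def algebra_simps)
qed

lemma Alt_linear_at:
  assumes f: "f \<in> Alt k" shows "linear (\<lambda>x. f (xs @ x # ys))"
proof (cases "length xs + Suc (length ys) = k")
  case True
  then show ?thesis using Alt_linear[OF f, of "xs @ undefined # ys" "length xs"] by simp
next
  case False
  then show ?thesis using f by (auto simp: Alt_length linear_iff)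
qed

text \<open>
  With \<open>a + b\<close> in both places the form vanishes; expanded, only the two mixed terms are left.
\<close>

lemma Alt_swap:
  assumes f: "f \<in> Alt k"
  shows "f (xs @ a # ys @ b # zs) = - f (xs @ b # ys @ a # zs)"
proof -
  have lin1: "linear (\<lambda>x. f (xs @ x # ys @ y # zs))" for y by (rule Alt_linear_at[OF f])
  have lin2: "linear (\<lambda>y. f (xs @ x # ys @ y # zs))" for x
    using Alt_linear_at[OF f, of "xs @ x # ys" zs] by simp
  have z: "f (xs @ x # ys @ x # zs) = 0" for x
    by (rule Alt_not_distinct[OF f]) auto
  have "0 = f (xs @ (a + b) # ys @ (a + b) # zs)" by (simp add: z)
  also have "\<dots> = f (xs @ a # ys @ b # zs) + f (xs @ b # ys @ a # zs)"
    using linear_add[OF lin1, of a b "a + b"] linear_add[OF lin2, of a a b]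
      linear_add[OF lin2, of b a b] z by simp
  finally show ?thesis by simp
qed

lemma Alt_move:
  assumes f: "f \<in> Alt k"
  shows "f (xs @ a # ys @ zs) = (- 1) ^ length ys * f (xs @ ys @ a # zs)"
proof (induction ys arbitrary: xs)
  case (Cons y ys)
  have "f (xs @ a # (y # ys) @ zs) = - f (xs @ y # a # ys @ zs)"
    using Alt_swap[OF f, of xs a "[]" y "ys @ zs"] by simp
  also have "\<dots> = (- 1) ^ length (y # ys) * f (xs @ (y # ys) @ a # zs)"
    using Cons[of "xs @ [y]"] by simp
  finally show ?case .
qed simp

text \<open>
  The prefix \<open>zs\<close> is for the induction: the head of \<open>xs\<close> is moved to the front of \<open>ys\<close>, which
  only changes the sign, and then joins the prefix.
\<close>

lemma Alt_same_set_0: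
  assumes f: "f \<in> Alt k" and "distinct xs" "distinct ys" "set xs = set ys"
    and "f (zs @ xs) = 0"
  shows "f (zs @ ys) = 0"
  using assms(2-)
proof (induction xs arbitrary: ys zs)
  case (Cons x xs)
  from Cons.prems(3) have "x \<in> set ys" by auto
  then obtain as bs where ys: "ys = as @ x # bs" by (meson split_list)
  have "set xs = set (as @ bs)"
    using Cons.prems(1-3) ys by auto
  then have "f ((zs @ [x]) @ as @ bs) = 0"
    using Cons.IH[of "as @ bs" "zs @ [x]"] Cons.prems ys by auto
  then show ?case using Alt_move[OF f, of zs x as bs] ys by simp
qed simp

text \<open>
  Among lists over the spanning set \<open>B\<close> only those without repetition matter, and their order
  only affects the sign. Multilinearity then frees the arguments from \<open>B\<close> one at a time.
\<close>

lemma Alt_eq_0I: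
  fixes f :: "'a::real_vector form"
  assumes f: "f \<in> Alt k" and B: "span B = UNIV"
    and zero: "\<And>C. C \<subseteq> B \<Longrightarrow> card C = k \<Longrightarrow> finite C \<Longrightarrow> \<exists>xs. distinct xs \<and> set xs = C \<and> f xs = 0"
  shows "f = 0"
proof -
  have basis: "f xs = 0" if xs: "set xs \<subseteq> B" "length xs = k" for xs
  proof (cases "distinct xs")
    case True
    then have card: "card (set xs) = k" using xs distinct_card by fastforce
    then obtain ys where ys: "distinct ys" "set ys = set xs" "f ys = 0"
      using zero[OF xs(1) card finite_set] by metis
    then show ?thesis using Alt_same_set_0[OF f ys(1) True ys(2), of "[]"] by simp
  qed (rule Alt_not_distinct[OF f])
  have "f xs = 0" if "length xs = k" "\<forall>i<k. j \<le> i \<longrightarrow> xs ! i \<in> B" "j \<le> k" for xs j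
    using that
  proof (induction j arbitrary: xs)
    case 0
    then show ?case by (intro basis) (auto simp: in_set_conv_nth)
  next
    case (Suc j)
    have "f (xs[j := x]) = 0" if "x \<in> B" for x
      using Suc.prems that by (intro Suc.IH) (auto simp: nth_list_update)
    then have "f (xs[j := x]) = 0" for x
      using linear_eq_0_on_span[OF Alt_linear[OF f, of xs j], of B x] Suc.prems B by simp
    from this[of "xs ! j"] show ?case by simp
  qed
  from this[of _ k] have "f xs = 0" if "length xs = k" for xs using that by auto
  then show ?thesis using Alt_length[OF f] by (auto simp: fun_eq_iff)
qed

lemma Alt_move_to_front:
  assumes f: "f \<in> Alt k" and i: "i < length xs"
  shows "f (xs ! i # del i xs) = (- 1) ^ i * f xs"
  using Alt_move[OF f, of "[]" "xs ! i" "take i xs" "drop (Suc i) xs"] i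
  by (simp add: id_take_nth_drop[OF i, symmetric])

text \<open>
  The exterior product of a linear functional and a form. When the functional is the derivative of a
  test function, it is the integrand of the weak exterior derivative.
\<close>

definition wedge :: "('a::real_vector \<Rightarrow> real) \<Rightarrow> 'a form \<Rightarrow> 'a form" where
  "wedge l f = (\<lambda>xs. \<Sum>i<length xs. (- 1) ^ i * (l (xs ! i) * f (del i xs)))"

lemma wedge_Cons:
  "wedge l f (x # xs) = l x * f xs - wedge l (\<lambda>ys. f (x # ys)) xs"
  unfolding wedge_def
  by (simp only: list.size add_Suc_right add_0_right sum.lessThan_Suc_shift)
    (simp add: sum_negf mult.assoc)

lemma del_update:
  assumes "i < length xs" "m < length xs" "i \<noteq> m"
  shows "del i (xs[m := x]) = (del i xs)[(if m < i then m else m - 1) := x]"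
  using assms
  by (intro nth_equalityI) (auto simp: nth_append nth_list_update min_def)

lemma del_nth:
  assumes "i < length xs" "m < length xs - 1"
  shows "del i xs ! m = xs ! (if m < i then m else Suc m)"
  using assms by (auto simp: nth_append min_def)

text \<open>
  If the arguments \<open>i\<close> and \<open>j\<close> agree, all terms but these two have a repeated argument. The two cancel,
  because the lists from which one or the other copy is deleted differ by moving this
  vector past \<open>j - i - 1\<close> others.
\<close>

lemma wedge_Alt:
  fixes f :: "'a::real_vector form"
  assumes l: "linear l" and f: "f \<in> Alt k"
  shows "wedge l f \<in> Alt (Suc k)"
  unfolding Alt_def
proof (intro CollectI conjI allI impI)
  fix xs :: "'a list" assume "length xs \<noteq> Suc k"
  then have "f (del i xs) = 0" if "i < length xs" for i
    using that by (intro Alt_length[OF f]) auto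
  then show "wedge l f xs = 0" by (simp add: wedge_def)
next
  fix xs :: "'a list" and m assume xs: "length xs = Suc k" and m: "m < Suc k"
  have "linear (\<lambda>x. (- 1) ^ i * (l (xs[m := x] ! i) * f (del i (xs[m := x]))))"
    if i: "i < Suc k" for i
  proof (cases "i = m")
    case True
    then show ?thesis using l m xs by (auto simp: linear_iff algebra_simps)
  next
    case False
    have "linear (\<lambda>x. f ((del i xs)[(if m < i then m else m - 1) := x]))"
      using xs i m False by (intro Alt_linear[OF f]) auto
    then have "linear (\<lambda>x. f (del i (xs[m := x])))"
      using del_update[of i xs m] xs i m False by simp
    then show ?thesis using False by (auto simp: linear_iff algebra_simps)
  qed
  then have "linear (\<lambda>x. \<Sum>i<Suc k. (- 1) ^ i * (l (xs[m := x] ! i) * f (del i (xs[m := x]))))"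
    by (intro linear_compose_sum) auto
  then show "linear (\<lambda>x. wedge l f (xs[m := x]))"
    using xs by (simp add: wedge_def)
next
  fix xs :: "'a list" and i j
  assume xs: "length xs = Suc k" and ij: "i < j" "j < Suc k" and eq: "xs ! i = xs ! j"
  let ?t = "\<lambda>m. (- 1) ^ m * (l (xs ! m) * f (del m xs))"
  have other: "?t m = 0" if m: "m < Suc k" "m \<noteq> i" "m \<noteq> j" for m
  proof -
    have "f (del m xs) = 0"
    proof (rule Alt_repeat[OF f, of "if i < m then i else i - 1" "if j < m then j else j - 1"])
      show "del m xs ! (if i < m then i else i - 1) = del m xs ! (if j < m then j else j - 1)"
        using del_nth[of m xs "if i < m then i else i - 1"] del_nth[of m xs "if j < m then j else j - 1"]
          m ij xs eq by (auto split: if_splits)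
    qed (use m ij xs in auto)
    then show ?thesis by simp
  qed
  define as bs cs x where "as = take i xs" and "bs = take (j - Suc i) (drop (Suc i) xs)"
    and "cs = drop (Suc j) xs" and "x = xs ! i"
  have len: "length as = i" "length bs = j - Suc i"
    using ij xs by (auto simp: as_def bs_def)
  have "drop (Suc i) xs = bs @ xs ! j # cs"
    using id_take_nth_drop[of "j - Suc i" "drop (Suc i) xs"] ij xs by (simp add: bs_def cs_def)
  then have split: "xs = as @ x # bs @ x # cs"
    using id_take_nth_drop[of i xs] ij xs eq by (simp add: as_def x_def)
  have di: "del i xs = as @ bs @ x # cs"
    unfolding split using len by simp
  have "del j xs = as @ x # bs @ cs"
  proof -
    have "j = length (as @ x # bs)" using len ij by simp
    then show ?thesis unfolding split by simp
  qed
  then have "f (del j xs) = (- 1) ^ (j - Suc i) * f (del i xs)"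
    using Alt_move[OF f, of as x bs cs] len di by simp
  then have "?t j = - ?t i"
    using eq ij by (auto simp: less_iff_Suc_add power_add algebra_simps)
  moreover have "wedge l f xs = (\<Sum>m\<in>{i, j}. ?t m)"
    unfolding wedge_def xs using ij other by (intro sum.mono_neutral_right) auto
  ultimately show "wedge l f xs = 0" using ij by simp
qed

text \<open>
  The iterated wedge of the dual functionals: in its expansion along the first functional, only the
  first term is non-zero. This is the determinant, without matrices.
\<close>

lemma exists_Alt_dual:
  fixes es :: "'a::real_vector list"
  assumes "\<And>i j. i < length es \<Longrightarrow> j < length es \<Longrightarrow> l i (es ! j) = (if i = j then 1 else (0::real))"
    and "\<And>i. i < length es \<Longrightarrow> linear (l i)"
  shows "\<exists>f. f \<in> Alt (length es) \<and> f es = 1"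
  using assms
proof (induction es arbitrary: l)
  case Nil
  have "(\<lambda>xs. if xs = [] then 1 else 0) \<in> Alt 0" by (auto simp: Alt_def)
  then show ?case by force
next
  case (Cons e es)
  obtain f where f: "f \<in> Alt (length es)" "f es = 1"
  proof -
    have "l (Suc i) (es ! j) = (if i = j then 1 else 0)" if "i < length es" "j < length es" for i j
      using Cons.prems(1)[of "Suc i" "Suc j"] that by simp
    moreover have "linear (l (Suc i))" if "i < length es" for i
      using Cons.prems(2)[of "Suc i"] that by simp
    ultimately show thesis using Cons.IH[of "\<lambda>i. l (Suc i)"] that by blast
  qed
  have "l 0 (es ! i) = 0" if "i < length es" for i
    using Cons.prems(1)[of 0 "Suc i"] that by simp
  then have "wedge (l 0) f (e # es) = 1"
    using Cons.prems(1)[of 0 0] f by (simp add: wedge_Cons) (simp add: wedge_def)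
  then show ?case using wedge_Alt[OF Cons.prems(2) f(1), of 0] by auto
qed

section \<open>Lebesgue measure in affine coordinates\<close>

text \<open>
  This is the uniqueness of Haar measure. Choose \<open>g\<close> with integral \<open>1\<close>. In the double integral of
  \<open>f x * g y\<close>, the translations \<open>x := x + y\<close> and \<open>y := y - x\<close> lead to \<open>f y * g (y - x)\<close>, whose
  inner integral is independent of \<open>y\<close>.
\<close>

lemma translation_invariant_proportional_lborel:
  fixes \<mu> :: "'a::euclidean_space measure"
  assumes sigma: "sigma_finite_measure \<mu>" and sets [measurable_cong]: "sets \<mu> = sets borel"
    and inv: "\<And>a. distr \<mu> borel (\<lambda>x. a + x) = \<mu>"
  shows "\<exists>c. \<forall>f\<in>borel_measurable borel. (\<integral>\<^sup>+x. f x \<partial>\<mu>) = c * (\<integral>\<^sup>+x. f x \<partial>lborel)"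
proof -
  interpret sigma_finite_measure \<mu> by fact
  interpret P: pair_sigma_finite \<mu> lborel
    by (rule pair_sigma_finite.intro) (auto intro: sigma lborel.sigma_finite_measure_axioms)
  define g :: "'a \<Rightarrow> ennreal" where "g = indicator (cbox 0 One)"
  have g [measurable]: "g \<in> borel_measurable borel" by (simp add: g_def)
  have g1: "(\<integral>\<^sup>+x. g x \<partial>lborel) = 1"
    by (simp add: g_def emeasure_lborel_cbox_eq inner_sum_left prod.neutral inner_Basis if_distrib)
  have shift\<mu>: "(\<integral>\<^sup>+x. f (a + x) \<partial>\<mu>) = (\<integral>\<^sup>+x. f x \<partial>\<mu>)" if [measurable]: "f \<in> borel_measurable borel"
    for f :: "'a \<Rightarrow> ennreal" and a
    by (subst (2) inv[of a, symmetric]) (simp add: nn_integral_distr)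
  have shift_lborel: "(\<integral>\<^sup>+x. f (a + x) \<partial>lborel) = (\<integral>\<^sup>+x. f x \<partial>lborel)"
    if [measurable]: "f \<in> borel_measurable borel" for f :: "'a \<Rightarrow> ennreal" and a
    by (subst (2) lborel_distr_plus[of a, symmetric]) (simp add: nn_integral_distr)
  have "(\<integral>\<^sup>+x. f x \<partial>\<mu>) = (\<integral>\<^sup>+x. g (- x) \<partial>\<mu>) * (\<integral>\<^sup>+x. f x \<partial>lborel)"
    if [measurable]: "f \<in> borel_measurable borel" for f
  proof -
    have "(\<integral>\<^sup>+x. f x \<partial>\<mu>) = (\<integral>\<^sup>+x. \<integral>\<^sup>+y. f x * g y \<partial>lborel \<partial>\<mu>)"
      by (simp add: nn_integral_cmult g1)
    also have "\<dots> = (\<integral>\<^sup>+y. \<integral>\<^sup>+x. f x * g y \<partial>\<mu> \<partial>lborel)"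
      by (rule P.Fubini'[symmetric]) measurable
    also have "\<dots> = (\<integral>\<^sup>+y. \<integral>\<^sup>+x. f (y + x) * g y \<partial>\<mu> \<partial>lborel)"
      using shift\<mu>[of "\<lambda>x. f x * g y" y for y] by simp
    also have "\<dots> = (\<integral>\<^sup>+x. \<integral>\<^sup>+y. f (y + x) * g y \<partial>lborel \<partial>\<mu>)"
      by (rule P.Fubini') measurable
    also have "\<dots> = (\<integral>\<^sup>+x. \<integral>\<^sup>+y. f y * g (y - x) \<partial>lborel \<partial>\<mu>)"
      using shift_lborel[of "\<lambda>y. f y * g (y - x)" "x" for x]
      by (auto simp: add.commute intro: nn_integral_cong)
    also have "\<dots> = (\<integral>\<^sup>+y. \<integral>\<^sup>+x. f y * g (y - x) \<partial>\<mu> \<partial>lborel)"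
      by (rule P.Fubini'[symmetric]) measurable
    also have "\<dots> = (\<integral>\<^sup>+y. f y * (\<integral>\<^sup>+x. g (- x) \<partial>\<mu>) \<partial>lborel)"
      using shift\<mu>[of "\<lambda>x. g (y - x)" "y" for y]
      by (intro nn_integral_cong) (simp add: nn_integral_cmult)
    finally show ?thesis by (simp add: nn_integral_multc mult.commute)
  qed
  then show ?thesis by blast
qed

interpretation lborel_product: product_sigma_finite "\<lambda>_. lborel :: real measure"
  by standard

lemma PiM_lborel_translation:
  fixes s :: "nat \<Rightarrow> real"
  defines "P k \<equiv> Pi\<^sub>M {..<k} (\<lambda>_. lborel :: real measure)"
  shows "distr (P k) (P k) (\<lambda>t. \<lambda>i\<in>{..<k}. s i + t i) = P k"
  unfolding P_def
proof (rule lborel_product.PiM_eqI)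
  fix A :: "nat \<Rightarrow> real set" assume A: "\<And>i. i \<in> {..<k} \<Longrightarrow> A i \<in> sets lborel"
  have m: "(\<lambda>t. \<lambda>i\<in>{..<k}. s i + t i) \<in> measurable (Pi\<^sub>M {..<k} (\<lambda>_. lborel)) (Pi\<^sub>M {..<k} (\<lambda>_. lborel :: real measure))"
    by measurable
  have A': "(\<lambda>y. s i + y) -` A i \<in> sets lborel" if "i < k" for i
    using measurable_sets[of "\<lambda>y. s i + y" borel borel "A i"] A[of i] that by simp
  have "emeasure (distr (Pi\<^sub>M {..<k} (\<lambda>_. lborel)) (Pi\<^sub>M {..<k} (\<lambda>_. lborel)) (\<lambda>t. \<lambda>i\<in>{..<k}. s i + t i)) (Pi\<^sub>E {..<k} A)
     = emeasure (Pi\<^sub>M {..<k} (\<lambda>_. lborel)) (Pi\<^sub>E {..<k} (\<lambda>i. (\<lambda>y. s i + y) -` A i))"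
    using A by (subst emeasure_distr[OF m])
      (auto intro!: sets_PiM_I_finite arg_cong[where f = "emeasure _"]
        simp: space_PiM PiE_iff extensional_def)
  also have "\<dots> = (\<Prod>i<k. emeasure lborel ((\<lambda>y. s i + y) -` A i))"
    using A' by (subst lborel_product.emeasure_PiM) auto
  also have "\<dots> = (\<Prod>i<k. emeasure lborel (A i))"
  proof (intro prod.cong refl)
    fix i assume "i \<in> {..<k}"
    then have [measurable]: "A i \<in> sets borel" using A by simp
    show "emeasure lborel ((\<lambda>y. s i + y) -` A i) = emeasure lborel (A i)"
      by (subst (2) lborel_distr_plus[of "s i", symmetric]) (simp add: emeasure_distr)
  qed
  finally show "emeasure (distr (Pi\<^sub>M {..<k} (\<lambda>_. lborel)) (Pi\<^sub>M {..<k} (\<lambda>_. lborel)) (\<lambda>t. \<lambda>i\<in>{..<k}. s i + t i)) (Pi\<^sub>E {..<k} A)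
     = (\<Prod>i<k. emeasure lborel (A i))" .
qed auto

lemma integrable_PiM_bounded_support:
  fixes F :: "(nat \<Rightarrow> real) \<Rightarrow> real"
  assumes meas: "F \<in> borel_measurable (Pi\<^sub>M {..<k} (\<lambda>_. lborel))"
    and bound: "\<And>t. \<bar>F t\<bar> \<le> C" and supp: "\<And>t i. F t \<noteq> 0 \<Longrightarrow> i < k \<Longrightarrow> \<bar>t i\<bar> \<le> M"
  shows "integrable (Pi\<^sub>M {..<k} (\<lambda>_. lborel)) F"
proof (rule Bochner_Integration.integrable_bound)
  let ?B = "Pi\<^sub>E {..<k} (\<lambda>_. {- M..M})"
  have B: "?B \<in> sets (Pi\<^sub>M {..<k} (\<lambda>_. lborel))" by (rule sets_PiM_I_finite) auto
  have "emeasure (Pi\<^sub>M {..<k} (\<lambda>_. lborel)) ?B = (\<Prod>i<k. emeasure lborel {- M..M})"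
    by (rule lborel_product.emeasure_PiM) auto
  also have "\<dots> < \<infinity>" by (auto simp: less_top[symmetric] power_eq_top_ennreal emeasure_lborel_Icc_eq)
  finally show "integrable (Pi\<^sub>M {..<k} (\<lambda>_. lborel)) (\<lambda>t. C * indicator ?B t)"
    using B by (intro integrable_mult_right integrable_real_indicator)
  show "AE t in Pi\<^sub>M {..<k} (\<lambda>_. lborel). norm (F t) \<le> norm (C * indicator ?B t)"
  proof (rule AE_I2)
    fix t assume t: "t \<in> space (Pi\<^sub>M {..<k} (\<lambda>_. lborel :: real measure))"
    show "norm (F t) \<le> norm (C * indicator ?B t)"
    proof (cases "F t = 0")
      case False
      then have "t \<in> ?B" using supp[OF False] t by (force simp: space_PiM PiE_iff abs_le_iff)
      then show ?thesis using bound[of t] by simp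
    qed simp
  qed
qed (rule meas)

text \<open>
  By Fubini's theorem, as each line in direction \<open>i\<close> meets the hyperplane in a single point.
\<close>

lemma AE_PiM_not_hyperplane:
  fixes a :: "nat \<Rightarrow> real"
  assumes i: "i < k" "a i \<noteq> 0"
  shows "AE t in Pi\<^sub>M {..<k} (\<lambda>_. lborel). (\<Sum>j<k. a j * t j) \<noteq> b"
proof -
  let ?P = "Pi\<^sub>M {..<k} (\<lambda>_. lborel :: real measure)" and ?I = "{..<k} - {i}"
  let ?N = "{t \<in> space ?P. (\<Sum>j<k. a j * t j) = b}"
  have ins: "insert i ?I = {..<k}" using i by auto
  have N: "?N \<in> sets ?P" by measurable
  have "emeasure ?P ?N = (\<integral>\<^sup>+t. indicator ?N t \<partial>?P)" using N by simp
  also have "\<dots> = (\<integral>\<^sup>+t. \<integral>\<^sup>+y. indicator ?N (t(i := y)) \<partial>lborel \<partial>Pi\<^sub>M ?I (\<lambda>_. lborel))"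
    using lborel_product.product_nn_integral_insert[of ?I i "indicator ?N"] N ins by simp
  also have "\<dots> = (\<integral>\<^sup>+t. 0 \<partial>Pi\<^sub>M ?I (\<lambda>_. lborel :: real measure))"
  proof (rule nn_integral_cong)
    fix t :: "nat \<Rightarrow> real"
    let ?y = "(b - (\<Sum>j\<in>?I. a j * t j)) / a i"
    have "indicator ?N (t(i := y)) \<le> (indicator {?y} y :: ennreal)" for y
    proof -
      have "(\<Sum>j<k. a j * (t(i := y)) j) = a i * y + (\<Sum>j\<in>?I. a j * t j)"
        using sum.remove[of "{..<k}" i "\<lambda>j. a j * (t(i := y)) j"] i by auto
      then show ?thesis using i by (auto simp: indicator_def field_simps)
    qed
    then have "(\<integral>\<^sup>+y. indicator ?N (t(i := y)) \<partial>lborel) \<le> (\<integral>\<^sup>+y. indicator {?y} y \<partial>lborel)"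
      by (intro nn_integral_mono)
    then show "(\<integral>\<^sup>+y. indicator ?N (t(i := y)) \<partial>lborel) = 0" by simp
  qed
  finally have "?N \<in> null_sets ?P" using N by (simp add: null_sets_def)
  then show ?thesis by (rule AE_I') auto
qed

text \<open>
  The image of the product measure under the chart is translation-invariant and finite on bounded
  sets, hence a multiple of Lebesgue measure. The factor \<open>c\<close> is the inverse of a determinant.
\<close>

lemma integral_affine_chart:
  fixes e :: "nat \<Rightarrow> 'a::euclidean_space" and l :: "nat \<Rightarrow> 'a \<Rightarrow> real"
  assumes lin: "\<And>i. i < k \<Longrightarrow> linear (l i)"
    and dual: "\<And>i j. i < k \<Longrightarrow> j < k \<Longrightarrow> l i (e j) = (if i = j then 1 else 0)"
    and repr: "\<And>x. (\<Sum>i<k. l i x *\<^sub>R e i) = x"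
  shows "\<exists>c>0. \<forall>f\<in>borel_measurable borel.
    (LINT t|Pi\<^sub>M {..<k} (\<lambda>_. lborel). f (p + (\<Sum>i<k. t i *\<^sub>R e i))) = c * (LINT x|lborel. f x :: real)"
proof -
  let ?P = "Pi\<^sub>M {..<k} (\<lambda>_. lborel :: real measure)"
  define \<phi> where "\<phi> t = p + (\<Sum>i<k. t i *\<^sub>R e i)" for t
  have \<phi> [measurable]: "\<phi> \<in> measurable ?P borel" unfolding \<phi>_def by measurable
  define \<mu> where "\<mu> = distr ?P borel \<phi>"
  have sets [measurable_cong]: "sets \<mu> = sets borel" by (simp add: \<mu>_def)
  have coord: "l i (\<phi> t - p) = t i" if "i < k" for i t
    using that by (simp add: \<phi>_def linear_sum[OF lin] linear_scale[OF lin] dual mult_delta_right)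
  have bounded_finite: "emeasure \<mu> B < \<infinity>" if B: "bounded B" "B \<in> sets borel" for B
  proof -
    obtain r where r: "\<And>x. x \<in> B \<Longrightarrow> norm x \<le> r" using B(1) by (auto simp: bounded_iff)
    define K where "K = (\<Sum>i<k. onorm (l i)) * (r + norm p)"
    have K: "\<bar>l i (x - p)\<bar> \<le> K" if "i < k" "x \<in> B" for i x
    proof -
      have "\<bar>l i (x - p)\<bar> \<le> onorm (l i) * norm (x - p)"
        using onorm[OF linear_conv_bounded_linear[THEN iffD1, OF lin[OF that(1)]], of "x - p"] by simp
      also have "\<dots> \<le> (\<Sum>i<k. onorm (l i)) * (r + norm p)"
      proof (intro mult_mono)
        show "onorm (l i) \<le> (\<Sum>i<k. onorm (l i))"
          using that lin by (intro member_le_sum) (auto intro!: onorm_pos_le simp: linear_conv_bounded_linear[symmetric])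
        show "norm (x - p) \<le> r + norm p" using norm_triangle_ineq4[of x p] r[OF that(2)] by simp
        show "0 \<le> (\<Sum>i<k. onorm (l i))"
          using lin by (intro sum_nonneg) (auto intro!: onorm_pos_le simp: linear_conv_bounded_linear[symmetric])
      qed simp
      finally show ?thesis by (simp add: K_def)
    qed
    have "emeasure \<mu> B = emeasure ?P (\<phi> -` B \<inter> space ?P)"
      unfolding \<mu>_def using B by (simp add: emeasure_distr)
    also have "\<dots> \<le> emeasure ?P (Pi\<^sub>E {..<k} (\<lambda>_. {- K..K}))"
    proof (rule emeasure_mono)
      show "\<phi> -` B \<inter> space ?P \<subseteq> Pi\<^sub>E {..<k} (\<lambda>_. {- K..K})"
        using K coord by (force simp: space_PiM PiE_iff abs_le_iff)
    qed (rule sets_PiM_I_finite, auto)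
    also have "\<dots> = (\<Prod>i<k. emeasure lborel {- K..K})"
      by (rule lborel_product.emeasure_PiM) auto
    also have "\<dots> < \<infinity>" by (auto simp: less_top[symmetric] power_eq_top_ennreal emeasure_lborel_Icc_eq)
    finally show ?thesis .
  qed
  have sigma: "sigma_finite_measure \<mu>"
  proof
    show "\<exists>A. countable A \<and> A \<subseteq> sets \<mu> \<and> \<Union>A = space \<mu> \<and> (\<forall>a\<in>A. emeasure \<mu> a \<noteq> \<infinity>)"
    proof (intro exI[of _ "range (\<lambda>m::nat. cball 0 (real m))"] conjI ballI)
      show "\<Union>(range (\<lambda>m::nat. cball (0::'a) (real m))) = space \<mu>"
        by (auto simp: \<mu>_def real_arch_simple)
      fix A assume "A \<in> range (\<lambda>m::nat. cball (0::'a) (real m))"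
      then show "emeasure \<mu> A \<noteq> \<infinity>" using bounded_finite[of A] by force
    qed (auto simp: \<mu>_def)
  qed
  have inv: "distr \<mu> borel (\<lambda>x. a + x) = \<mu>" for a
  proof -
    let ?s = "\<lambda>t. \<lambda>i\<in>{..<k}. l i a + t i"
    have [measurable]: "?s \<in> measurable ?P ?P" by measurable
    have "distr \<mu> borel (\<lambda>x. a + x) = distr ?P borel (\<lambda>t. a + \<phi> t)"
      unfolding \<mu>_def by (subst distr_distr) (auto simp: comp_def)
    also have "(\<lambda>t. a + \<phi> t) = \<phi> \<circ> ?s"
    proof
      fix t show "a + \<phi> t = (\<phi> \<circ> ?s) t"
        using repr[of a] by (simp add: \<phi>_def scaleR_add_left sum.distrib)
    qed
    also have "distr ?P borel (\<phi> \<circ> ?s) = distr (distr ?P ?P ?s) borel \<phi>"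
      by (subst distr_distr) auto
    also have "\<dots> = \<mu>" by (simp only: PiM_lborel_translation \<mu>_def)
    finally show ?thesis .
  qed
  obtain c where c: "\<And>f. f \<in> borel_measurable borel \<Longrightarrow> (\<integral>\<^sup>+x. f x \<partial>\<mu>) = c * (\<integral>\<^sup>+x. f x \<partial>lborel)"
    using translation_invariant_proportional_lborel[OF sigma sets inv] by blast
  have "c < \<infinity>"
  proof -
    have "c = (\<integral>\<^sup>+x. indicator (cbox 0 One) x \<partial>\<mu>)"
      by (subst c) (auto simp: emeasure_lborel_cbox_eq inner_sum_left prod.neutral inner_Basis if_distrib)
    also have "\<dots> = emeasure \<mu> (cbox 0 One)" by (simp add: sets)
    also have "\<dots> < \<infinity>" by (rule bounded_finite) auto
    finally show ?thesis .
  qed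
  moreover have "c \<noteq> 0"
  proof
    assume "c = 0"
    then have "emeasure \<mu> (space \<mu>) = 0" using c[of "\<lambda>_. 1"] by simp
    then have "emeasure ?P (space ?P) = 0"
      unfolding \<mu>_def by (simp add: emeasure_distr)
    moreover have "emeasure ?P (space ?P) = (\<Prod>i<k. emeasure lborel (UNIV :: real set))"
      using lborel_product.emeasure_PiM[of "{..<k}" "\<lambda>_. UNIV"] by (simp add: space_PiM)
    ultimately show False by (simp add: emeasure_lborel_UNIV)
  qed
  ultimately obtain c' where c': "c = ennreal c'" "c' > 0"
    by (cases c) (auto simp: zero_less_iff_neq_zero)
  have "\<mu> = density lborel (\<lambda>_. c)"
  proof (rule measure_eqI)
    fix A assume "A \<in> sets \<mu>"
    then have [measurable]: "A \<in> sets borel" by (simp add: sets)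
    have "emeasure \<mu> A = (\<integral>\<^sup>+x. indicator A x \<partial>\<mu>)" by simp
    also have "\<dots> = c * (\<integral>\<^sup>+x. indicator A x \<partial>lborel)" by (rule c) measurable
    also have "\<dots> = emeasure (density lborel (\<lambda>_. c)) A"
      by (simp add: emeasure_density nn_integral_cmult)
    finally show "emeasure \<mu> A = emeasure (density lborel (\<lambda>_. c)) A" .
  qed (simp add: sets)
  then have "(LINT x|\<mu>. f x) = c' * (LINT x|lborel. f x)" if "f \<in> borel_measurable borel" for f :: "'a \<Rightarrow> real"
    using that c' by (simp add: integral_density)
  moreover have "(LINT x|\<mu>. f x) = (LINT t|?P. f (\<phi> t))" if "f \<in> borel_measurable borel" for f :: "'a \<Rightarrow> real"
    unfolding \<mu>_def using that by (intro integral_distr) auto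
  ultimately show ?thesis using c' by (auto simp: \<phi>_def)
qed

section \<open>Lipschitz functions\<close>

definition lipschitzian :: "('a::real_normed_vector \<Rightarrow> real) \<Rightarrow> bool" where
  "lipschitzian f \<longleftrightarrow> (\<exists>L. \<forall>x y. \<bar>f x - f y\<bar> \<le> L * norm (x - y))"

lemma lipschitzian_linear: "linear f \<Longrightarrow> lipschitzian (\<lambda>x. c + f x)" for f :: "'a::euclidean_space \<Rightarrow> real"
  unfolding lipschitzian_def
  by (rule exI[of _ "onorm f"]) (simp add: linear_diff[symmetric] onorm[of f, simplified] linear_conv_bounded_linear)

lemma lipschitzian_cmult: "lipschitzian f \<Longrightarrow> lipschitzian (\<lambda>x. c * f x)"
  unfolding lipschitzian_def
proof (elim exE)
  fix L assume L: "\<forall>x y. \<bar>f x - f y\<bar> \<le> L * norm (x - y)"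
  have "\<bar>c * f x - c * f y\<bar> \<le> \<bar>c\<bar> * L * norm (x - y)" for x y
    using mult_left_mono[OF L[rule_format, of x y], of "\<bar>c\<bar>"]
    by (simp add: abs_mult[symmetric] algebra_simps)
  then show "\<exists>L. \<forall>x y. \<bar>c * f x - c * f y\<bar> \<le> L * norm (x - y)" by blast
qed

lemma lipschitzian_diff: "lipschitzian f \<Longrightarrow> lipschitzian g \<Longrightarrow> lipschitzian (\<lambda>x. f x - g x)"
  unfolding lipschitzian_def
proof (elim exE)
  fix L M assume *: "\<forall>x y. \<bar>f x - f y\<bar> \<le> L * norm (x - y)" "\<forall>x y. \<bar>g x - g y\<bar> \<le> M * norm (x - y)"
  have "\<bar>f x - g x - (f y - g y)\<bar> \<le> (L + M) * norm (x - y)" for x y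
    using *[THEN spec, THEN spec, of x y] by (simp add: algebra_simps abs_le_iff)
  then show "\<exists>L. \<forall>x y. \<bar>f x - g x - (f y - g y)\<bar> \<le> L * norm (x - y)" by blast
qed

lemma lipschitzian_sum:
  assumes "\<And>i. i \<in> I \<Longrightarrow> lipschitzian (f i)" shows "lipschitzian (\<lambda>x. \<Sum>i\<in>I. f i x)"
proof -
  obtain L where L: "\<And>i x y. i \<in> I \<Longrightarrow> \<bar>f i x - f i y\<bar> \<le> L i * norm (x - y)"
    using assms unfolding lipschitzian_def by metis
  have "\<bar>(\<Sum>i\<in>I. f i x) - (\<Sum>i\<in>I. f i y)\<bar> \<le> (\<Sum>i\<in>I. L i) * norm (x - y)" for x y
    unfolding sum_subtractf[symmetric] sum_distrib_right
    by (rule order.trans[OF sum_abs sum_mono[OF L]])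
  then show ?thesis unfolding lipschitzian_def by blast
qed

lemma lipschitzian_Min:
  assumes I: "finite I" "I \<noteq> {}" and "\<And>i. i \<in> I \<Longrightarrow> lipschitzian (f i)"
  shows "lipschitzian (\<lambda>x. Min ((\<lambda>i. f i x) ` I))"
proof -
  obtain L where L: "\<And>i x y. i \<in> I \<Longrightarrow> \<bar>f i x - f i y\<bar> \<le> L i * norm (x - y)"
    using assms(3) unfolding lipschitzian_def by metis
  define M where "M = (\<Sum>i\<in>I. max 0 (L i))"
  have M: "L i \<le> M" if "i \<in> I" for i
    using member_le_sum[of i I "\<lambda>i. max 0 (L i)"] that I(1) by (simp add: M_def)
  have one: "Min ((\<lambda>i. f i x) ` I) \<le> Min ((\<lambda>i. f i y) ` I) + M * norm (x - y)" for x y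
  proof -
    obtain i where i: "i \<in> I" "Min ((\<lambda>i. f i y) ` I) = f i y"
    proof -
      have "Min ((\<lambda>i. f i y) ` I) \<in> (\<lambda>i. f i y) ` I" using I by (intro Min_in) auto
      then show thesis using that by blast
    qed
    have "Min ((\<lambda>i. f i x) ` I) \<le> f i x" using I i by simp
    also have "\<dots> \<le> f i y + L i * norm (x - y)" using L[OF i(1), of x y] by (simp add: abs_le_iff)
    also have "\<dots> \<le> f i y + M * norm (x - y)" using mult_right_mono[OF M[OF i(1)], of "norm (x - y)"] by simp
    finally show ?thesis using i by simp
  qed
  have "\<bar>Min ((\<lambda>i. f i x) ` I) - Min ((\<lambda>i. f i y) ` I)\<bar> \<le> M * norm (x - y)" for x y
    using one[of x y] one[of y x] by (simp add: norm_minus_commute abs_le_iff)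
  then show ?thesis unfolding lipschitzian_def by blast
qed

lemma lipschitzian_continuous: "lipschitzian f \<Longrightarrow> continuous_on A f"
  unfolding lipschitzian_def
proof (elim exE)
  fix L assume L: "\<forall>x y. \<bar>f x - f y\<bar> \<le> L * norm (x - y)"
  have "(max L 0)-lipschitz_on A f"
  proof (rule lipschitz_onI)
    fix x y :: 'a
    have "L * norm (x - y) \<le> max L 0 * norm (x - y)" by (intro mult_right_mono) auto
    then show "dist (f x) (f y) \<le> max L 0 * dist x y"
      using L[THEN spec, THEN spec, of x y] by (simp add: dist_norm)
  qed simp
  then show "continuous_on A f" by (rule lipschitz_on_continuous_on)
qed

lemma lipschitzian_common:
  assumes "finite I" "\<And>i. i \<in> I \<Longrightarrow> lipschitzian (f i)"
  obtains L where "\<And>i x y. i \<in> I \<Longrightarrow> \<bar>f i x - f i y\<bar> \<le> L * norm (x - y)"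
proof -
  obtain L where L: "\<And>i x y. i \<in> I \<Longrightarrow> \<bar>f i x - f i y\<bar> \<le> L i * norm (x - y)"
    using assms(2) unfolding lipschitzian_def by metis
  have "\<bar>f i x - f i y\<bar> \<le> (\<Sum>i\<in>I. max 0 (L i)) * norm (x - y)" if "i \<in> I" for i x y
  proof -
    have "L i \<le> (\<Sum>i\<in>I. max 0 (L i))"
      using member_le_sum[of i I "\<lambda>i. max 0 (L i)"] that assms(1) by simp
    from mult_right_mono[OF this, of "norm (x - y)"] L[OF that, of x y] show ?thesis by simp
  qed
  then show thesis by (rule that)
qed

section \<open>Test functions\<close>

text \<open>
  A continuously differentiable function that is positive on the positive half-line only. Cutoffs and bumps
  are made from it.
\<close>

definition pos_sq :: "real \<Rightarrow> real" where "pos_sq s = (max 0 s)\<^sup>2"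

lemma DERIV_pos_sq [derivative_intros]:
  assumes "(f has_real_derivative f') (at x within X)"
  shows "((\<lambda>x. pos_sq (f x)) has_real_derivative 2 * max 0 (f x) * f') (at x within X)"
proof -
  have "(pos_sq has_real_derivative 2 * max 0 s) (at s)" for s
  proof (cases s "0::real" rule: linorder_cases)
    case less
    have "((\<lambda>_. 0) has_real_derivative 2 * max 0 s) (at s)" using less by simp
    then show ?thesis
      by (rule has_field_derivative_transform_within_open[of _ _ _ "{..<0}"])
        (use less in \<open>auto simp: pos_sq_def\<close>)
  next
    case equal
    have "(\<lambda>h. (pos_sq (0 + h) - pos_sq 0) / h) \<midarrow>0\<rightarrow> 0"
    proof (rule LIM_I, intro exI conjI allI impI)
      fix r :: real assume r: "0 < r" show "0 < r" by fact
      fix h :: real assume h: "h \<noteq> 0 \<and> norm (h - 0) < r"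
      then have "\<bar>max 0 h\<bar>\<^sup>2 / \<bar>h\<bar> \<le> \<bar>h\<bar>"
        by (auto simp: max_def power2_eq_square)
      then show "norm ((pos_sq (0 + h) - pos_sq 0) / h - 0) < r"
        using h by (auto simp: pos_sq_def abs_divide power_abs[symmetric])
    qed
    then show ?thesis using equal by (simp add: has_field_derivative_iff)
  next
    case greater
    have "((\<lambda>s. s\<^sup>2) has_real_derivative 2 * max 0 s) (at s)"
      using greater by (auto intro!: derivative_eq_intros)
    then show ?thesis
      by (rule has_field_derivative_transform_within_open[of _ _ _ "{0<..}"])
        (use greater in \<open>auto simp: pos_sq_def\<close>)
  qed
  from DERIV_chain2[OF this assms] show ?thesis .
qed

text \<open>
  A continuously differentiable step that rises from \<open>0\<close> to \<open>1\<close> between \<open>1\<close> and \<open>2\<close>.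
\<close>

definition cutoff :: "real \<Rightarrow> real" where
  "cutoff s = pos_sq (s - 1) / (pos_sq (s - 1) + pos_sq (2 - s))"

definition cutoff' :: "real \<Rightarrow> real" where
  "cutoff' s = (2 * max 0 (s - 1) * pos_sq (2 - s) + pos_sq (s - 1) * (2 * max 0 (2 - s)))
     / (pos_sq (s - 1) + pos_sq (2 - s))\<^sup>2"

lemma cutoff_denominator_pos: "0 < pos_sq (s - 1) + pos_sq (2 - s)"
proof (cases "1 < s")
  case True
  then have "0 < pos_sq (s - 1)" by (simp add: pos_sq_def)
  then show ?thesis by (simp add: pos_sq_def add_pos_nonneg)
next
  case False
  then have "0 < pos_sq (2 - s)" by (simp add: pos_sq_def)
  then show ?thesis by (simp add: pos_sq_def add_nonneg_pos)
qed

lemma DERIV_cutoff: "(cutoff has_real_derivative cutoff' s) (at s)"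
  unfolding cutoff_def cutoff'_def using cutoff_denominator_pos[of s]
  by (auto intro!: derivative_eq_intros simp: power2_eq_square algebra_simps)

lemma continuous_cutoff': "continuous_on UNIV cutoff'"
  unfolding cutoff'_def pos_sq_def
  using cutoff_denominator_pos[unfolded pos_sq_def]
  by (auto intro!: continuous_intros simp: less_imp_neq[symmetric])

lemma continuous_cutoff: "continuous_on UNIV cutoff"
  using DERIV_cutoff by (meson DERIV_continuous_on has_field_derivative_at_within)

lemma cutoff_0: "s \<le> 1 \<Longrightarrow> cutoff s = 0" and cutoff_1: "2 \<le> s \<Longrightarrow> cutoff s = 1"
  by (simp_all add: cutoff_def pos_sq_def)

lemma cutoff_bounds: "0 \<le> cutoff s" "cutoff s \<le> 1"
  using cutoff_denominator_pos[of s] by (simp_all add: cutoff_def pos_sq_def)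

lemma cutoff'_0: "s \<le> 1 \<or> 2 \<le> s \<Longrightarrow> cutoff' s = 0"
  by (auto simp: cutoff'_def pos_sq_def)

lemma continuous_compact_support:
  fixes f :: "'a::euclidean_space \<Rightarrow> real"
  assumes f: "continuous_on UNIV f" and K: "compact K" "\<And>x. x \<notin> K \<Longrightarrow> f x = 0"
  shows "integrable lborel f" and "\<exists>C\<ge>0. \<forall>x. \<bar>f x\<bar> \<le> C"
proof -
  have "integrable lborel (\<lambda>x. indicator K x *\<^sub>R f x)"
    by (rule borel_integrable_compact) (auto intro: K(1) continuous_on_subset[OF f])
  also have "(\<lambda>x. indicator K x *\<^sub>R f x) = f"
    using K by (auto simp: indicator_def fun_eq_iff)
  finally show "integrable lborel f" .
  have "compact (f ` K)" by (rule compact_continuous_image) (auto intro: K(1) continuous_on_subset[OF f])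
  then obtain C where C: "\<And>x. x \<in> K \<Longrightarrow> \<bar>f x\<bar> \<le> C"
    using compact_imp_bounded[of "f ` K"] by (auto simp: bounded_iff)
  then have "\<bar>f x\<bar> \<le> max 0 C" for x
    using K(2)[of x] by (cases "x \<in> K") (auto simp: le_max_iff_disj)
  then show "\<exists>C\<ge>0. \<forall>x. \<bar>f x\<bar> \<le> C" by (intro exI[of _ "max 0 C"]) auto
qed

lemma exists_bump:
  fixes U :: "'a::euclidean_space set"
  assumes "open U" "x0 \<in> U"
  obtains \<phi> \<phi>' where "test_function U \<phi> \<phi>'" "0 < (LINT x|lborel. \<phi> x)"
proof -
  obtain r where r: "r > 0" "cball x0 r \<subseteq> U"
    using assms open_contains_cball by blast
  define \<phi> where "\<phi> x = pos_sq (r\<^sup>2 - (x - x0) \<bullet> (x - x0))" for x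
  define \<phi>' where "\<phi>' x h = 2 * max 0 (r\<^sup>2 - (x - x0) \<bullet> (x - x0)) * (- 2 * ((x - x0) \<bullet> h))" for x h
  have ne: "r\<^sup>2 - (x - x0) \<bullet> (x - x0) > 0 \<longleftrightarrow> x \<in> ball x0 r" for x
  proof -
    have "(norm (x - x0))\<^sup>2 < r\<^sup>2 \<longleftrightarrow> norm (x - x0) < r"
      using r by (intro iffI) (auto intro: power2_less_imp_less power_strict_mono)
    then show ?thesis by (simp add: dist_norm norm_minus_commute[of x0] power2_norm_eq_inner)
  qed
  have D: "(\<phi> has_derivative \<phi>' x) (at x)" for x
  proof -
    have "((\<lambda>x. r\<^sup>2 - (x - x0) \<bullet> (x - x0)) has_derivative (\<lambda>h. - 2 * ((x - x0) \<bullet> h))) (at x)"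
      by (auto intro!: derivative_eq_intros simp: inner_commute)
    moreover have "(pos_sq has_derivative (*) (2 * max 0 s)) (at s)" for s
      using DERIV_pos_sq[OF DERIV_ident, of s UNIV] by (simp add: has_field_derivative_def)
    ultimately show ?thesis
      unfolding \<phi>_def \<phi>'_def by (rule has_derivative_compose)
  qed
  have cont: "continuous_on UNIV \<phi>"
    using D by (meson continuous_at_imp_continuous_on has_derivative_continuous)
  have supp: "\<phi> x = 0" if "x \<notin> cball x0 r" for x
    using ne[of x] that by (simp add: \<phi>_def pos_sq_def)
  have test: "test_function U \<phi> \<phi>'"
    unfolding test_function_def
  proof (intro conjI allI)
    show "continuous_on UNIV (\<lambda>x. \<phi>' x h)" for h
      unfolding \<phi>'_def by (intro continuous_intros)
    show "\<exists>K\<subseteq>U. compact K \<and> (\<forall>x. x \<notin> K \<longrightarrow> \<phi> x = 0)"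
      using r supp by (intro exI[of _ "cball x0 r"]) auto
  qed (rule D)
  have int: "integrable lborel \<phi>"
    by (rule continuous_compact_support(1)[OF cont compact_cball supp])
  have nonneg: "0 \<le> \<phi> x" for x by (simp add: \<phi>_def pos_sq_def)
  have "(LINT x|lborel. \<phi> x) \<noteq> 0"
  proof
    assume "(LINT x|lborel. \<phi> x) = 0"
    then have "AE x in lborel. \<phi> x = 0"
      using integral_nonneg_eq_0_iff_AE[OF int] nonneg by simp
    then have "AE x in lborel. x \<notin> ball x0 r"
    proof eventually_elim
      case (elim x)
      then show ?case using ne[of x] by (auto simp: \<phi>_def pos_sq_def max_def split: if_splits)
    qed
    then have "emeasure lborel (ball x0 r) = 0"
      by (subst (asm) AE_iff_measurable[of "ball x0 r"]) auto
    then show False using content_ball_pos[OF r(1), of x0] by (simp add: measure_def)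
  qed
  then have "0 < (LINT x|lborel. \<phi> x)"
    using Bochner_Integration.integral_nonneg[of lborel \<phi>] nonneg by (simp add: less_le)
  with test show thesis by (rule that)
qed

lemma test_functionD:
  assumes "test_function U \<phi> \<phi>'"
  shows "(\<phi> has_derivative \<phi>' x) (at x)" "linear (\<phi>' x)" "continuous_on UNIV \<phi>"
    "continuous_on UNIV (\<lambda>x. \<phi>' x h)"
  using assms has_derivative_linear
  by (auto simp: test_function_def intro!: continuous_at_imp_continuous_on has_derivative_continuous)

lemma test_function_support:
  fixes U :: "'a::euclidean_space set"
  assumes test: "test_function U \<phi> \<phi>'"
  obtains K where "K \<subseteq> U" "compact K" "\<And>x. x \<notin> K \<Longrightarrow> \<phi> x = 0" "\<And>x h. x \<notin> K \<Longrightarrow> \<phi>' x h = 0"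
proof -
  obtain K where K: "K \<subseteq> U" "compact K" "\<And>x. x \<notin> K \<Longrightarrow> \<phi> x = 0"
    using test by (auto simp: test_function_def)
  have "\<phi>' x h = 0" if "x \<notin> K" for x h
  proof -
    have "((\<lambda>_. 0) has_derivative \<phi>' x) (at x)"
      by (rule has_derivative_transform_within_open[OF test_functionD(1)[OF test], of "- K"])
        (use that K compact_imp_closed in auto)
    then have "\<phi>' x = (\<lambda>_. 0)" by (rule has_derivative_unique) simp
    then show ?thesis by simp
  qed
  with K show thesis by (rule that)
qed

lemma integral_lborel_translation:
  fixes f :: "'a::euclidean_space \<Rightarrow> real"
  assumes [measurable]: "f \<in> borel_measurable borel"
  shows "(LINT x|lborel. f (a + x)) = (LINT x|lborel. f x)"
  by (subst (2) lborel_distr_plus[of a, symmetric]) (simp add: integral_distr)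

text \<open>
  Translation invariance moves the difference quotients from \<open>\<phi>\<close> to \<open>g\<close>. Those of \<open>\<phi>\<close>
  are bounded with a common bounded support, those of \<open>g\<close> are bounded by the Lipschitz constant, so both
  sides pass to the limit. The limit \<open>d\<close> is asked for the sum over \<open>p\<close> only: for the field
  \<open>\<Sum>p. g p x *\<^sub>R h p\<close> it is the divergence, which may be constant when the summands are not.
\<close>

lemma integral_by_parts_lipschitz:
  fixes g :: "'p \<Rightarrow> 'a::euclidean_space \<Rightarrow> real" and h :: "'p \<Rightarrow> 'a"
  assumes test: "test_function U \<phi> \<phi>'"
    and lip: "\<And>p x y. p \<in> P \<Longrightarrow> \<bar>g p x - g p y\<bar> \<le> L * norm (x - y)"
    and div: "AE x in lborel. \<phi> x \<noteq> 0 \<longrightarrow>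
      (\<lambda>m. \<Sum>p\<in>P. (g p x - g p (x - (1 / Suc m) *\<^sub>R h p)) / (1 / Suc m)) \<longlonglongrightarrow> d"
  shows "(LINT x|lborel. (\<Sum>p\<in>P. g p x * \<phi>' x (h p))) = - d * (LINT x|lborel. \<phi> x)"
proof -
  obtain K where K: "compact K" "\<And>x. x \<notin> K \<Longrightarrow> \<phi> x = 0" "\<And>x h. x \<notin> K \<Longrightarrow> \<phi>' x h = 0"
    using test_function_support[OF test] by metis
  obtain R where R: "\<And>x. x \<in> K \<Longrightarrow> norm x \<le> R" using compact_imp_bounded[OF K(1)] by (auto simp: bounded_iff)
  note D = test_functionD[OF test]
  let ?e = "\<lambda>m. 1 / real (Suc m)"
  have e: "0 < ?e m" "?e m \<le> 1" for m by auto
  have e0: "?e \<longlonglongrightarrow> 0" using LIMSEQ_inverse_real_of_nat by (simp add: inverse_eq_divide)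
  have contg: "continuous_on UNIV (g p)" if "p \<in> P" for p
    using lip[OF that] by (intro lipschitzian_continuous) (auto simp: lipschitzian_def)
  have quot: "(\<lambda>m. LINT x|lborel. g p x * ((\<phi> (x + ?e m *\<^sub>R h p) - \<phi> x) / ?e m))
      \<longlonglongrightarrow> (LINT x|lborel. g p x * \<phi>' x (h p))"
    and move: "(LINT x|lborel. g p x * ((\<phi> (x + ?e m *\<^sub>R h p) - \<phi> x) / ?e m))
      = - (LINT x|lborel. (g p x - g p (x - ?e m *\<^sub>R h p)) / ?e m * \<phi> x)"
    and int: "integrable lborel (\<lambda>x. (g p x - g p (x - ?e m *\<^sub>R h p)) / ?e m * \<phi> x)"
    and int': "integrable lborel (\<lambda>x. g p x * \<phi>' x (h p))" if p: "p \<in> P" for p m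
  proof -
    note cont [continuous_intros] = continuous_on_compose2[OF contg[OF p]] continuous_on_compose2[OF D(3)]
      continuous_on_compose2[OF D(4)]
    define B where "B = cball (0::'a) (R + norm (h p))"
    have KB: "x \<in> B" if "x + ?e m *\<^sub>R h p \<in> K \<or> x \<in> K" for x m
    proof -
      have "norm x \<le> norm (x + ?e m *\<^sub>R h p) + norm (?e m *\<^sub>R h p)"
        using norm_triangle_ineq4[of "x + ?e m *\<^sub>R h p" "?e m *\<^sub>R h p"] by simp
      moreover have "norm (?e m *\<^sub>R h p) \<le> norm (h p)"
        using mult_right_mono[OF e(2)[of m], of "norm (h p)"] by simp
      ultimately have "norm x \<le> R + norm (h p)"
        using that R[of x] R[of "x + ?e m *\<^sub>R h p"] norm_ge_zero[of "h p"] by linarith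
      then show ?thesis by (simp add: B_def)
    qed
    have "bounded (g p ` B)"
      by (intro compact_imp_bounded compact_continuous_image continuous_on_subset[OF contg[OF p]])
        (auto simp: B_def)
    then obtain G where G: "\<And>x. x \<in> B \<Longrightarrow> \<bar>g p x\<bar> \<le> G" by (auto simp: bounded_iff)
    obtain C where C: "0 \<le> C" "\<And>x. \<bar>\<phi>' x (h p)\<bar> \<le> C"
      using continuous_compact_support(2)[OF D(4) K(1,3)] by auto
    have line: "((\<lambda>t. \<phi> (x + t *\<^sub>R h p)) has_real_derivative \<phi>' (x + t *\<^sub>R h p) (h p)) (at t)" for x t
    proof -
      have "((\<lambda>t. x + t *\<^sub>R h p) has_derivative (\<lambda>s. s *\<^sub>R h p)) (at t)"
        by (auto intro!: derivative_eq_intros)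
      from has_derivative_compose[OF this D(1)] show ?thesis
        by (simp add: has_field_derivative_def linear_scale[OF D(2)] mult_commute_abs)
    qed
    have bound: "\<bar>(\<phi> (x + ?e m *\<^sub>R h p) - \<phi> x) / ?e m\<bar> \<le> C" for x m
    proof -
      obtain z where "\<phi> (x + ?e m *\<^sub>R h p) - \<phi> (x + 0 *\<^sub>R h p) = (?e m - 0) * \<phi>' (x + z *\<^sub>R h p) (h p)"
        using MVT2[OF e(1) line] by blast
      then show ?thesis using C(2)[of "x + z *\<^sub>R h p"] e(1)[of m] by simp
    qed
    have intC: "integrable lborel f" if "continuous_on UNIV f" "\<And>x. x \<notin> B \<Longrightarrow> f x = 0" for f :: "'a \<Rightarrow> real"
      by (rule continuous_compact_support(1)[OF that(1), of B]) (use that(2) in \<open>auto simp: B_def\<close>)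
    show int': "integrable lborel (\<lambda>x. g p x * \<phi>' x (h p))"
      by (rule intC) (use K(3) KB in \<open>auto intro!: continuous_intros\<close>)
    show "(\<lambda>m. LINT x|lborel. g p x * ((\<phi> (x + ?e m *\<^sub>R h p) - \<phi> x) / ?e m))
      \<longlonglongrightarrow> (LINT x|lborel. g p x * \<phi>' x (h p))"
    proof (rule integral_dominated_convergence[where w = "\<lambda>x. indicator B x *\<^sub>R (\<bar>g p x\<bar> * C)"])
      show "integrable lborel (\<lambda>x. indicator B x *\<^sub>R (\<bar>g p x\<bar> * C))"
        by (rule borel_integrable_compact) (auto simp: B_def intro!: continuous_intros)
      show "AE x in lborel. (\<lambda>m. g p x * ((\<phi> (x + ?e m *\<^sub>R h p) - \<phi> x) / ?e m)) \<longlonglongrightarrow> g p x * \<phi>' x (h p)"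
      proof (rule AE_I2)
        fix x
        have "((\<lambda>t. (\<phi> (x + (0 + t) *\<^sub>R h p) - \<phi> (x + 0 *\<^sub>R h p)) / t) \<longlongrightarrow> \<phi>' (x + 0 *\<^sub>R h p) (h p)) (at 0)"
          using line[of x 0] unfolding DERIV_def by simp
        moreover have "filterlim ?e (at 0) sequentially"
          using e0 by (auto simp: filterlim_at intro!: always_eventually)
        ultimately have "(\<lambda>m. (\<phi> (x + (0 + ?e m) *\<^sub>R h p) - \<phi> (x + 0 *\<^sub>R h p)) / ?e m) \<longlonglongrightarrow> \<phi>' (x + 0 *\<^sub>R h p) (h p)"
          by (rule filterlim_compose)
        then show "(\<lambda>m. g p x * ((\<phi> (x + ?e m *\<^sub>R h p) - \<phi> x) / ?e m)) \<longlonglongrightarrow> g p x * \<phi>' x (h p)"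
          by (intro tendsto_mult_left) simp
      qed
      show "AE x in lborel. norm (g p x * ((\<phi> (x + ?e m *\<^sub>R h p) - \<phi> x) / ?e m)) \<le> indicator B x *\<^sub>R (\<bar>g p x\<bar> * C)" for m
      proof (rule AE_I2)
        fix x
        show "norm (g p x * ((\<phi> (x + ?e m *\<^sub>R h p) - \<phi> x) / ?e m)) \<le> indicator B x *\<^sub>R (\<bar>g p x\<bar> * C)"
        proof (cases "x \<in> B")
          case True
          have "\<bar>g p x\<bar> * \<bar>(\<phi> (x + ?e m *\<^sub>R h p) - \<phi> x) / ?e m\<bar> \<le> \<bar>g p x\<bar> * C"
            by (rule mult_left_mono[OF bound]) simp
          then show ?thesis using True by (simp add: abs_mult)
        next
          case False
          then have "\<phi> (x + ?e m *\<^sub>R h p) = 0" "\<phi> x = 0" using KB K(2) by blast+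
          then show ?thesis using False by simp
        qed
      qed
    next
      show "(\<lambda>x. g p x * \<phi>' x (h p)) \<in> borel_measurable lborel" using int' by simp
      show "(\<lambda>x. g p x * ((\<phi> (x + ?e m *\<^sub>R h p) - \<phi> x) / ?e m)) \<in> borel_measurable lborel" for m
        by (simp, rule borel_measurable_continuous_onI) (auto intro!: continuous_intros)
    qed
    have i1: "integrable lborel (\<lambda>x. g p x * \<phi> (x + ?e m *\<^sub>R h p))"
      by (rule intC) (use K(2) KB in \<open>auto intro!: continuous_intros\<close>)
    have i2: "integrable lborel (\<lambda>x. g p x * \<phi> x)"
      by (rule intC) (use K(2) KB in \<open>auto intro!: continuous_intros\<close>)
    have i3: "integrable lborel (\<lambda>x. g p (x - ?e m *\<^sub>R h p) * \<phi> x)"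
      by (rule intC) (use K(2) KB in \<open>auto intro!: continuous_intros\<close>)
    have sh: "(LINT x|lborel. g p x * \<phi> (x + ?e m *\<^sub>R h p)) = (LINT x|lborel. g p (x - ?e m *\<^sub>R h p) * \<phi> x)"
    proof -
      have "(\<lambda>x. g p (x - ?e m *\<^sub>R h p) * \<phi> x) \<in> borel_measurable borel"
        using i3 by simp
      from integral_lborel_translation[OF this, of "?e m *\<^sub>R h p"] show ?thesis
        by (simp add: add.commute)
    qed
    show "integrable lborel (\<lambda>x. (g p x - g p (x - ?e m *\<^sub>R h p)) / ?e m * \<phi> x)"
      using integrable_mult_right[OF Bochner_Integration.integrable_diff[OF i2 i3], of "1 / ?e m"]
      by (simp add: algebra_simps)
    have "(LINT x|lborel. g p x * ((\<phi> (x + ?e m *\<^sub>R h p) - \<phi> x) / ?e m))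
        = (LINT x|lborel. (g p x * \<phi> (x + ?e m *\<^sub>R h p) - g p x * \<phi> x) / ?e m)"
      by (simp add: algebra_simps)
    also have "\<dots> = ((LINT x|lborel. g p x * \<phi> (x + ?e m *\<^sub>R h p)) - (LINT x|lborel. g p x * \<phi> x)) / ?e m"
      using i1 i2 by (simp add: Bochner_Integration.integral_diff)
    also have "\<dots> = - (((LINT x|lborel. g p x * \<phi> x) - (LINT x|lborel. g p (x - ?e m *\<^sub>R h p) * \<phi> x)) / ?e m)"
      unfolding sh by (simp add: algebra_simps)
    also have "\<dots> = - (LINT x|lborel. (g p x * \<phi> x - g p (x - ?e m *\<^sub>R h p) * \<phi> x) / ?e m)"
      using i2 i3 by (simp add: Bochner_Integration.integral_diff)
    also have "\<dots> = - (LINT x|lborel. (g p x - g p (x - ?e m *\<^sub>R h p)) / ?e m * \<phi> x)"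
      by (simp add: algebra_simps)
    finally show "(LINT x|lborel. g p x * ((\<phi> (x + ?e m *\<^sub>R h p) - \<phi> x) / ?e m))
      = - (LINT x|lborel. (g p x - g p (x - ?e m *\<^sub>R h p)) / ?e m * \<phi> x)" .
  qed
  let ?Q = "\<lambda>m x. (\<Sum>p\<in>P. (g p x - g p (x - ?e m *\<^sub>R h p)) / ?e m)"
  have int\<phi>: "integrable lborel \<phi>" by (rule continuous_compact_support(1)[OF D(3) K(1,2)])
  have "(\<lambda>m. LINT x|lborel. ?Q m x * \<phi> x) \<longlonglongrightarrow> (LINT x|lborel. d * \<phi> x)"
  proof (rule integral_dominated_convergence[where w = "\<lambda>x. (\<Sum>p\<in>P. L * norm (h p)) * \<bar>\<phi> x\<bar>"])
    show "integrable lborel (\<lambda>x. (\<Sum>p\<in>P. L * norm (h p)) * \<bar>\<phi> x\<bar>)"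
      using int\<phi> by simp
    show "AE x in lborel. (\<lambda>m. ?Q m x * \<phi> x) \<longlonglongrightarrow> d * \<phi> x"
      using div
    proof eventually_elim
      case (elim x)
      then show ?case by (cases "\<phi> x = 0") (auto intro!: tendsto_mult_right)
    qed
    show "AE x in lborel. norm (?Q m x * \<phi> x) \<le> (\<Sum>p\<in>P. L * norm (h p)) * \<bar>\<phi> x\<bar>" for m
    proof (rule AE_I2)
      fix x
      have "\<bar>?Q m x\<bar> \<le> (\<Sum>p\<in>P. \<bar>(g p x - g p (x - ?e m *\<^sub>R h p)) / ?e m\<bar>)" by (rule sum_abs)
      also have "\<dots> \<le> (\<Sum>p\<in>P. L * norm (h p))"
      proof (rule sum_mono)
        fix p assume "p \<in> P"
        then have "\<bar>g p x - g p (x - ?e m *\<^sub>R h p)\<bar> \<le> L * (?e m * norm (h p))"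
          using lip[of p x "x - ?e m *\<^sub>R h p"] by simp
        then show "\<bar>(g p x - g p (x - ?e m *\<^sub>R h p)) / ?e m\<bar> \<le> L * norm (h p)"
          by (subst abs_divide, subst abs_of_pos[OF e(1)], subst pos_divide_le_eq[OF e(1)])
            (simp only: mult_ac)
      qed
      finally show "norm (?Q m x * \<phi> x) \<le> (\<Sum>p\<in>P. L * norm (h p)) * \<bar>\<phi> x\<bar>"
        by (simp add: abs_mult mult_right_mono)
    qed
  next
    show "(\<lambda>x. d * \<phi> x) \<in> borel_measurable lborel" using int\<phi> by simp
    show "(\<lambda>x. ?Q m x * \<phi> x) \<in> borel_measurable lborel" for m
      unfolding sum_distrib_right using int[THEN borel_measurable_integrable]
      by (intro borel_measurable_sum)
  qed
  moreover have "(LINT x|lborel. ?Q m x * \<phi> x)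
      = - (\<Sum>p\<in>P. LINT x|lborel. g p x * ((\<phi> (x + ?e m *\<^sub>R h p) - \<phi> x) / ?e m))" for m
  proof -
    have "(LINT x|lborel. ?Q m x * \<phi> x)
        = (\<Sum>p\<in>P. LINT x|lborel. (g p x - g p (x - ?e m *\<^sub>R h p)) / ?e m * \<phi> x)"
      unfolding sum_distrib_right by (rule Bochner_Integration.integral_sum) (rule int)
    also have "\<dots> = (\<Sum>p\<in>P. - (LINT x|lborel. g p x * ((\<phi> (x + ?e m *\<^sub>R h p) - \<phi> x) / ?e m)))"
      using move by (intro sum.cong) auto
    finally show ?thesis by (simp only: sum_negf)
  qed
  moreover have "(\<lambda>m. - (\<Sum>p\<in>P. LINT x|lborel. g p x * ((\<phi> (x + ?e m *\<^sub>R h p) - \<phi> x) / ?e m)))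
      \<longlonglongrightarrow> - (\<Sum>p\<in>P. LINT x|lborel. g p x * \<phi>' x (h p))"
    using quot by (intro tendsto_minus tendsto_sum)
  ultimately have "(LINT x|lborel. d * \<phi> x) = - (\<Sum>p\<in>P. LINT x|lborel. g p x * \<phi>' x (h p))"
    using LIMSEQ_unique by simp
  moreover have "(LINT x|lborel. (\<Sum>p\<in>P. g p x * \<phi>' x (h p))) = (\<Sum>p\<in>P. LINT x|lborel. g p x * \<phi>' x (h p))"
    by (rule Bochner_Integration.integral_sum) (rule int')
  ultimately show ?thesis by simp
qed

section \<open>Barycentric coordinates and vector proxies\<close>

abbreviation edges :: "'a::real_vector list \<Rightarrow> 'a list" where
  "edges ps \<equiv> map (\<lambda>q. q - ps ! 0) (tl ps)"

locale full_simplex =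
  fixes n :: nat and S :: "'a::euclidean_space set" and W :: "'a set \<Rightarrow> 'a"
    and ori :: "'a set \<Rightarrow> 'a list"
  assumes n2: "n \<ge> 2" and dim_n: "DIM('a) = n" and card_S: "card S = n + 1"
    and indep: "\<not> affine_dependent S" and inp: "inpoints S W" and orient: "orientations S ori"
begin

lemma finite_S [simp, intro]: "finite S" using card_S card.infinite by fastforce

lemma S_ne [simp]: "S \<noteq> {}" using card_S by auto

lemma affine_hull_S: "affine hull S = UNIV"
  using affine_independent_span_eq[OF indep] card_S dim_n by simp

text \<open>
  The vectors from \<open>v\<close> to the other vertices form a basis, on which the linear part is prescribed.
\<close>

lemma exists_bary:
  assumes v: "v \<in> S"
  shows "\<exists>b l c. linear l \<and> b = (\<lambda>x. c + l x) \<and> (\<forall>w\<in>S. b w = (if w = v then 1 else (0::real)))"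
proof -
  let ?B = "(\<lambda>w. w - v) ` (S - {v})"
  have "independent ?B"
    using indep affine_dependent_iff_dependent2[OF v] by auto
  then obtain l :: "'a \<Rightarrow> real" where l: "linear l" "\<And>x. x \<in> ?B \<Longrightarrow> l x = - 1"
    using linear_independent_extend[of ?B "\<lambda>_. - 1"] by blast
  have "1 - l v + l w = (if w = v then 1 else 0)" if "w \<in> S" for w
  proof (cases "w = v")
    case False
    then have "l (w - v) = - 1" using that by (intro l(2)) auto
    then show ?thesis using False by (simp add: linear_diff[OF l(1)])
  qed simp
  then show ?thesis using l(1) by (intro exI[of _ "\<lambda>x. (1 - l v) + l x"] exI[of _ l] exI[of _ "1 - l v"]) auto
qed

definition bary :: "'a \<Rightarrow> 'a \<Rightarrow> real" where
  "bary v = (SOME b. \<exists>l c. linear l \<and> b = (\<lambda>x. c + l x) \<and> (\<forall>w\<in>S. b w = (if w = v then 1 else 0)))"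

text \<open>
  The linear part of the affine function \<open>bary v\<close>.
\<close>

definition grad :: "'a \<Rightarrow> 'a \<Rightarrow> real" where
  "grad v h = bary v h - bary v 0"

lemma bary_spec: "v \<in> S \<Longrightarrow> linear (grad v) \<and> (\<forall>w\<in>S. bary v w = (if w = v then 1 else 0))"
proof -
  assume "v \<in> S"
  then obtain l c where *: "linear l" "bary v = (\<lambda>x. c + l x)" "\<forall>w\<in>S. bary v w = (if w = v then 1 else 0)"
    using someI_ex[OF exists_bary[of v]] unfolding bary_def[symmetric] by blast
  then have "grad v = l" by (auto simp: grad_def fun_eq_iff linear_0)
  with * show ?thesis by simp
qed

lemma linear_grad: "v \<in> S \<Longrightarrow> linear (grad v)"
  and bary_vertex: "v \<in> S \<Longrightarrow> w \<in> S \<Longrightarrow> bary v w = (if w = v then 1 else 0)"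
  using bary_spec by auto

lemma bary_grad: "bary v x = bary v 0 + grad v x"
  by (simp add: grad_def)

lemma grad_diff: "v \<in> S \<Longrightarrow> grad v (x - y) = bary v x - bary v y"
  by (simp add: linear_diff[OF linear_grad]) (simp add: grad_def)

lemma bary_add: "v \<in> S \<Longrightarrow> bary v (x + h) = bary v x + grad v h"
  using grad_diff[of v "x + h" x] by simp

lemma continuous_bary [continuous_intros]:
  assumes "v \<in> S" "continuous_on A f" shows "continuous_on A (\<lambda>x. bary v (f x))"
  unfolding bary_grad[of v "f _"]
  by (intro continuous_on_add continuous_on_const bounded_linear.continuous_on[OF _ assms(2)]
    linear_conv_bounded_linear[THEN iffD1] linear_grad assms(1))

lemma bary_combination:
  assumes v: "v \<in> S" and c: "(\<Sum>p\<in>P. c p) = 1"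
  shows "bary v (\<Sum>p\<in>P. c p *\<^sub>R f p) = (\<Sum>p\<in>P. c p * bary v (f p))"
proof -
  have "bary v (\<Sum>p\<in>P. c p *\<^sub>R f p) = (\<Sum>p\<in>P. c p) * bary v 0 + (\<Sum>p\<in>P. c p * grad v (f p))"
    using c by (subst bary_grad) (simp add: linear_sum[OF linear_grad[OF v]] linear_scale[OF linear_grad[OF v]])
  also have "\<dots> = (\<Sum>p\<in>P. c p * bary v (f p))"
    unfolding bary_grad[of v "f _"] by (simp add: sum_distrib_right sum.distrib algebra_simps)
  finally show ?thesis .
qed

lemma bary_sum_vertices:
  assumes "v \<in> S" "(\<Sum>w\<in>S. c w) = 1"
  shows "bary v (\<Sum>w\<in>S. c w *\<^sub>R w) = c v"
  using assms by (subst bary_combination) (auto simp: bary_vertex mult_delta_right)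

lemma sum_bary: "(\<Sum>v\<in>S. bary v x) = 1" and bary_repr: "(\<Sum>v\<in>S. bary v x *\<^sub>R v) = x"
proof -
  obtain u where u: "sum u S = 1" "(\<Sum>v\<in>S. u v *\<^sub>R v) = x"
    using affine_hull_S affine_hull_finite[OF finite_S] by blast
  then have "bary v x = u v" if "v \<in> S" for v using bary_sum_vertices[OF that u(1)] by simp
  then have "(\<Sum>v\<in>S. bary v x) = sum u S" "(\<Sum>v\<in>S. bary v x *\<^sub>R v) = (\<Sum>v\<in>S. u v *\<^sub>R v)"
    by (auto intro!: sum.cong)
  with u show "(\<Sum>v\<in>S. bary v x) = 1" "(\<Sum>v\<in>S. bary v x *\<^sub>R v) = x" by simp_all
qed

lemma sum_grad: "(\<Sum>v\<in>S. grad v h) = 0" and grad_repr: "(\<Sum>v\<in>S. grad v h *\<^sub>R v) = h"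
  using sum_bary[of h] sum_bary[of 0] bary_repr[of h] bary_repr[of 0]
  by (simp_all add: grad_def sum_subtractf scaleR_diff_left)

lemma grad_eq_0: "(\<And>v. v \<in> S \<Longrightarrow> grad v h = 0) \<Longrightarrow> h = 0"
  using grad_repr[of h] by simp

lemma grad_of_combination:
  assumes "(\<Sum>w\<in>S. a w) = 0" "v \<in> S"
  shows "grad v (\<Sum>w\<in>S. a w *\<^sub>R w) = a v"
proof -
  have "grad v (\<Sum>w\<in>S. a w *\<^sub>R w) = (\<Sum>w\<in>S. a w * (bary v w - bary v 0))"
    using assms(2) by (simp add: linear_sum[OF linear_grad] linear_scale[OF linear_grad]) (simp add: grad_def)
  also have "\<dots> = (\<Sum>w\<in>S. a w * bary v w) - (\<Sum>w\<in>S. a w) * bary v 0"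
    by (simp add: sum_distrib_right sum_subtractf algebra_simps)
  also have "\<dots> = a v" using assms by (simp add: bary_vertex mult_delta_right)
  finally show ?thesis .
qed

lemma hull_iff: "x \<in> convex hull S \<longleftrightarrow> (\<forall>v\<in>S. 0 \<le> bary v x)"
proof
  assume "x \<in> convex hull S"
  then obtain u where u: "\<forall>v\<in>S. 0 \<le> u v" "sum u S = 1" "(\<Sum>v\<in>S. u v *\<^sub>R v) = x"
    unfolding convex_hull_finite[OF finite_S] by blast
  then show "\<forall>v\<in>S. 0 \<le> bary v x" using bary_sum_vertices[OF _ u(2)] by auto
next
  assume "\<forall>v\<in>S. 0 \<le> bary v x"
  then show "x \<in> convex hull S"
    unfolding convex_hull_finite[OF finite_S] using sum_bary[of x] bary_repr[of x]
    by (intro CollectI exI[of _ "\<lambda>v. bary v x"]) simp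
qed

lemma interior_iff: "x \<in> interior (convex hull S) \<longleftrightarrow> (\<forall>v\<in>S. 0 < bary v x)"
proof -
  have "x \<in> interior (convex hull S) \<longleftrightarrow>
      (\<exists>u. (\<forall>v\<in>S. 0 < u v) \<and> sum u S = 1 \<and> (\<Sum>v\<in>S. u v *\<^sub>R v) = x)"
    using interior_convex_hull_explicit_minimal[OF indep] card_S dim_n by simp
  also have "\<dots> \<longleftrightarrow> (\<forall>v\<in>S. 0 < bary v x)"
  proof
    assume "\<exists>u. (\<forall>v\<in>S. 0 < u v) \<and> sum u S = 1 \<and> (\<Sum>v\<in>S. u v *\<^sub>R v) = x"
    then obtain u where u: "\<forall>v\<in>S. 0 < u v" "sum u S = 1" "(\<Sum>v\<in>S. u v *\<^sub>R v) = x" by blast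
    then show "\<forall>v\<in>S. 0 < bary v x" using bary_sum_vertices[OF _ u(2)] by auto
  next
    assume "\<forall>v\<in>S. 0 < bary v x"
    then show "\<exists>u. (\<forall>v\<in>S. 0 < u v) \<and> sum u S = 1 \<and> (\<Sum>v\<in>S. u v *\<^sub>R v) = x"
      using sum_bary[of x] bary_repr[of x] by (intro exI[of _ "\<lambda>v. bary v x"]) simp
  qed
  finally show ?thesis .
qed

lemma compact_hull: "compact (convex hull S)"
  by (simp add: finite_imp_compact_convex_hull)


subsection \<open>The volume form\<close>

lemma edges_dual:
  assumes ps: "distinct ps" "set ps = S"
  shows "length ps = Suc n" "length (edges ps) = n"
    "\<And>i j. i < n \<Longrightarrow> j < n \<Longrightarrow> grad (ps ! Suc i) (edges ps ! j) = (if i = j then 1 else 0)"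
    "\<And>x. (\<Sum>i<n. grad (ps ! Suc i) x *\<^sub>R edges ps ! i) = x"
    "\<And>i. i \<le> n \<Longrightarrow> ps ! i \<in> S"
proof -
  show len: "length ps = Suc n" using distinct_card[OF ps(1)] ps(2) card_S by simp
  then show "length (edges ps) = n" by simp
  show in_S: "ps ! i \<in> S" if "i \<le> n" for i using that len ps(2) nth_mem[of i ps] by auto
  have inj: "ps ! i = ps ! j \<longleftrightarrow> i = j" if "i \<le> n" "j \<le> n" for i j
    using that len ps(1) by (simp add: nth_eq_iff_index_eq)
  have e: "edges ps ! j = ps ! Suc j - ps ! 0" if "j < n" for j
    using that len by (simp add: nth_tl)
  show "grad (ps ! Suc i) (edges ps ! j) = (if i = j then 1 else 0)" if "i < n" "j < n" for i j
    using that in_S[of "Suc i"] in_S[of "Suc j"] in_S[of 0] inj[of "Suc i" "Suc j"] inj[of 0 "Suc i"]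
    by (auto simp: e grad_diff bary_vertex)
  fix x
  have bij: "bij_betw (\<lambda>i. ps ! i) {..<Suc n} S"
    using bij_betw_nth[OF ps(1), of "{..<Suc n}" S] len ps(2) by simp
  have "x = (\<Sum>i<Suc n. grad (ps ! i) x *\<^sub>R ps ! i)"
    using grad_repr[of x] sum.reindex_bij_betw[OF bij, of "\<lambda>v. grad v x *\<^sub>R v"] by simp
  also have "\<dots> = (\<Sum>i<Suc n. grad (ps ! i) x *\<^sub>R ps ! i) - (\<Sum>i<Suc n. grad (ps ! i) x) *\<^sub>R ps ! 0"
    using sum_grad[of x] sum.reindex_bij_betw[OF bij, of "\<lambda>v. grad v x"] by simp
  also have "\<dots> = (\<Sum>i<Suc n. grad (ps ! i) x *\<^sub>R (ps ! i - ps ! 0))"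
    by (simp only: scaleR_diff_right sum_subtractf scaleR_sum_left)
  also have "\<dots> = (\<Sum>i<n. grad (ps ! Suc i) x *\<^sub>R edges ps ! i)"
    by (subst sum.lessThan_Suc_shift) (simp add: e)
  finally show "(\<Sum>i<n. grad (ps ! Suc i) x *\<^sub>R edges ps ! i) = x" by simp
qed

lemma edges_distinct_span:
  assumes ps: "distinct ps" "set ps = S"
  shows "distinct (edges ps)" "span (set (edges ps)) = UNIV"
proof -
  note d = edges_dual[OF ps]
  show "distinct (edges ps)"
    unfolding distinct_conv_nth using d(2,3) by (metis zero_neq_one)
  have "x \<in> span (set (edges ps))" for x
  proof -
    have "(\<Sum>i<n. grad (ps ! Suc i) x *\<^sub>R edges ps ! i) \<in> span (set (edges ps))"
      using d(2) by (intro span_sum span_scale span_base) (metis lessThan_iff nth_mem)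
    then show ?thesis using d(4) by simp
  qed
  then show "span (set (edges ps)) = UNIV" by auto
qed

lemma Alt_n_eq_0:
  assumes f: "f \<in> Alt n" and ps: "distinct ps" "set ps = S" and 0: "f (edges ps) = 0"
  shows "f = 0"
proof (rule Alt_eq_0I[OF f edges_distinct_span(2)[OF ps]])
  fix C assume C: "C \<subseteq> set (edges ps)" "card C = n" "finite C"
  have "card (set (edges ps)) = n"
    using distinct_card[OF edges_distinct_span(1)[OF ps]] edges_dual(2)[OF ps] by simp
  then have "C = set (edges ps)" using C card_subset_eq[OF _ C(1)] by simp
  then show "\<exists>xs. distinct xs \<and> set xs = C \<and> f xs = 0"
    using 0 edges_distinct_span(1)[OF ps] by blast
qed

lemma ori_face: "T \<subseteq> S \<Longrightarrow> T \<noteq> {} \<Longrightarrow> distinct (ori T) \<and> set (ori T) = T"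
  using orient by (auto simp: orientations_def faces_def)

lemmas ori_S = ori_face[OF order.refl S_ne, THEN conjunct1] ori_face[OF order.refl S_ne, THEN conjunct2]

text \<open>
  With this reference basis an integral over \<open>S\<close> evaluates forms on \<open>frame\<close>, where \<open>vol\<close>
  is \<open>1\<close>.
\<close>

definition frame :: "'a list" where "frame = edges (ori S)"

lemmas frame_dual = edges_dual(2-4)[OF ori_S, folded frame_def]
lemmas frame_distinct_span = edges_distinct_span[OF ori_S, folded frame_def]
lemmas ori_nth_S = edges_dual(5)[OF ori_S]

lemma exists_vol: "\<exists>f. f \<in> Alt n \<and> f frame = 1"
  using exists_Alt_dual[of frame "\<lambda>i. grad (ori S ! Suc i)"] frame_dual linear_grad ori_nth_S by auto

definition vol :: "'a form" where "vol = (SOME f. f \<in> Alt n \<and> f frame = 1)"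

lemma vol_Alt: "vol \<in> Alt n" and vol_frame: "vol frame = 1"
  using someI_ex[OF exists_vol] by (simp_all add: vol_def)

lemma Alt_n_multiple: assumes "f \<in> Alt n" shows "f xs = f frame * vol xs"
proof -
  have "f - f frame *\<^sub>R vol = 0"
  proof (rule Alt_n_eq_0[OF _ ori_S])
    show "f - f frame *\<^sub>R vol \<in> Alt n"
      by (intro subspace_diff[OF subspace_Alt] subspace_scale[OF subspace_Alt] assms vol_Alt)
    show "(f - f frame *\<^sub>R vol) (edges (ori S)) = 0"
      unfolding frame_def[symmetric] by (simp add: scaleR_fun_def vol_frame)
  qed
  then show ?thesis by (metis eq_iff_diff_eq_0 scaleR_fun_def real_scaleR_def)
qed

text \<open>
  The vector whose contraction with \<open>vol\<close> is \<open>f\<close>, see \<open>contract_proxy\<close>. Its coordinates are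
  read off as in Cramer's rule.
\<close>

definition proxy :: "'a form \<Rightarrow> 'a" where
  "proxy f = (\<Sum>i<n. ((- 1) ^ i * f (del i frame)) *\<^sub>R frame ! i)"

definition contract :: "'a \<Rightarrow> 'a form" where
  "contract v = (\<lambda>xs. vol (v # xs))"

lemma proxy_add: "proxy (f + g) = proxy f + proxy g"
  by (simp add: proxy_def sum.distrib algebra_simps)

lemma proxy_scale: "proxy (c *\<^sub>R f) = c *\<^sub>R proxy f"
  by (simp add: proxy_def scaleR_sum_right scaleR_fun_def mult.left_commute)

lemma contract_linear: "linear (\<lambda>v. contract v xs)"
  unfolding contract_def using Alt_linear_at[OF vol_Alt, of "[]"] by simp

lemma contract_Alt: "contract v \<in> Alt (n - 1)"
proof -
  have "contract v xs = 0" if "length xs \<noteq> n - 1" for xs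
    unfolding contract_def by (rule Alt_length[OF vol_Alt]) (use that in auto)
  moreover have "linear (\<lambda>x. contract v (xs[i := x]))" if "length xs = n - 1" "i < n - 1" for xs i
    unfolding contract_def using Alt_linear[OF vol_Alt, of "v # xs" "Suc i"] that by simp
  moreover have "contract v xs = 0" if "length xs = n - 1" "i < j" "j < n - 1" "xs ! i = xs ! j" for xs i j
    unfolding contract_def using Alt_repeat[OF vol_Alt, of "Suc i" "Suc j" "v # xs"] that by simp
  ultimately show ?thesis unfolding Alt_def by blast
qed

lemma proxy_coord: "i < n \<Longrightarrow> grad (ori S ! Suc i) (proxy f) = (- 1) ^ i * f (del i frame)"
  using ori_nth_S[of "Suc i"]
  by (simp add: proxy_def linear_sum[OF linear_grad] linear_scale[OF linear_grad] frame_dual mult_delta_right)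

text \<open>
  A set of \<open>n - 1\<close> vectors of the frame omits just one, so \<open>f\<close> is determined by the \<open>n\<close> coordinates
  of its proxy.
\<close>

lemma proxy_inject:
  assumes f: "f \<in> Alt (n - 1)" and 0: "proxy f = 0" shows "f = 0"
proof (rule Alt_eq_0I[OF f frame_distinct_span(2)])
  fix C assume C: "C \<subseteq> set frame" "card C = n - 1" "finite C"
  have "card (set frame) = n"
    using distinct_card[OF frame_distinct_span(1)] frame_dual(1) by simp
  then have "card (set frame - C) = 1" using C n2 by (simp add: card_Diff_subset)
  then obtain x where x: "set frame - C = {x}" by (rule card_1_singletonE)
  then obtain i where i: "i < n" "x = frame ! i"
    using frame_dual(1) by (metis Diff_iff in_set_conv_nth insertI1)
  have split: "frame = take i frame @ x # drop (Suc i) frame"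
    using i frame_dual(1) by (simp add: id_take_nth_drop)
  have "distinct (take i frame @ x # drop (Suc i) frame)"
    using frame_distinct_span(1) by (subst (asm) split)
  then have d: "distinct (del i frame)" "x \<notin> set (del i frame)" by auto
  have "set frame = insert x (set (del i frame))" by (subst split) auto
  then have "set (del i frame) = set frame - {x}" using d(2) by simp
  also have "\<dots> = C" using x C(1) by blast
  finally have "set (del i frame) = C" .
  moreover have "f (del i frame) = 0"
    using proxy_coord[OF i(1), of f] 0 ori_nth_S[of "Suc i"] i linear_0[OF linear_grad] by simp
  ultimately show "\<exists>xs. distinct xs \<and> set xs = C \<and> f xs = 0"
    using d(1) by blast
qed

text \<open>
  This turns the weak exterior derivative of a form into the weak divergence of its proxy.
\<close>

lemma wedge_proxy:
  assumes l: "linear l" and f: "f \<in> Alt (n - 1)"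
  shows "wedge l f xs = l (proxy f) * vol xs"
proof -
  have "wedge l f \<in> Alt n" using wedge_Alt[OF l f] n2 by simp
  moreover have "wedge l f frame = l (proxy f)"
    by (simp add: wedge_def proxy_def frame_dual(1) linear_sum[OF l] linear_scale[OF l] algebra_simps)
  ultimately show ?thesis using Alt_n_multiple[of "wedge l f" xs] by simp
qed

lemma proxy_contract: "proxy (contract v) = v"
proof (rule linear_eq_on_span[where B = "set frame", of "\<lambda>v. proxy (contract v)" "\<lambda>v. v"])
  show "linear (\<lambda>v. proxy (contract v))"
  proof (rule linearI)
    fix v w :: 'a and c :: real
    have "contract (v + w) = contract v + contract w"
      by (simp add: fun_eq_iff linear_add[OF contract_linear])
    then show "proxy (contract (v + w)) = proxy (contract v) + proxy (contract w)" by (simp add: proxy_add)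
    have "contract (c *\<^sub>R v) = c *\<^sub>R contract v"
      by (simp add: fun_eq_iff scaleR_fun_def linear_scale[OF contract_linear])
    then show "proxy (contract (c *\<^sub>R v)) = c *\<^sub>R proxy (contract v)" by (simp add: proxy_scale)
  qed
  show "v \<in> span (set frame)" using frame_distinct_span(2) by simp
  fix e assume "e \<in> set frame"
  then obtain m where m: "m < n" "e = frame ! m" by (metis frame_dual(1) in_set_conv_nth)
  have "(- 1) ^ i * contract e (del i frame) = (if i = m then 1 else 0)" if "i < n" for i
  proof (cases "i = m")
    case True
    then show ?thesis using Alt_move_to_front[OF vol_Alt, of m frame] m frame_dual(1)
      by (simp add: contract_def vol_frame flip: power_add mult_2)
  next
    case False
    have "e \<in> set (del i frame)"
    proof -
      have "del i frame ! (if m < i then m else m - 1) = e" "(if m < i then m else m - 1) < length (del i frame)"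
        using m that False frame_dual(1) del_nth[of i frame "if m < i then m else m - 1"] by auto
      then show ?thesis by (metis nth_mem)
    qed
    then have "contract e (del i frame) = 0"
      unfolding contract_def by (intro Alt_not_distinct[OF vol_Alt]) auto
    then show ?thesis using False by simp
  qed
  then show "proxy (contract e) = e"
    using m by (simp add: proxy_def if_distrib[of "\<lambda>c. c *\<^sub>R _"] cong: if_cong)
qed (auto simp: linear_id[unfolded id_def])

lemma contract_proxy: assumes "f \<in> Alt (n - 1)" shows "contract (proxy f) = f"
proof -
  have "proxy (contract (proxy f) - f) = 0"
    using proxy_add[of "contract (proxy f)" "- 1 *\<^sub>R f"] proxy_scale[of "- 1" f] proxy_contract by simp
  then have "contract (proxy f) - f = 0"
    by (intro proxy_inject subspace_diff[OF subspace_Alt] contract_Alt assms)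
  then show ?thesis by simp
qed

text \<open>
  The form evaluated on the facet is the flux of its proxy through the facet. As functions of the
  proxy, both sides vanish on the edges of the facet, so they are proportional; the factor is
  non-zero because \<open>vol\<close> does not vanish on a basis.
\<close>

lemma facet_form:
  assumes i: "i \<in> S" and ps: "distinct ps" "set ps = S - {i}"
  shows "\<exists>\<kappa>. \<kappa> \<noteq> 0 \<and> (\<forall>f\<in>Alt (n - 1). f (edges ps) = \<kappa> * grad i (proxy f))"
proof -
  let ?qs = "ps @ [i]"
  have qs: "distinct ?qs" "set ?qs = S" using ps i by auto
  have len: "length ps = n" using distinct_card[OF ps(1)] ps(2) card_S i by simp
  then have ne: "ps \<noteq> []" using n2 by auto
  have e: "edges ?qs = edges ps @ [i - ps ! 0]" using ne by (simp add: nth_append)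
  define \<kappa> where "\<kappa> = contract (i - ps ! 0) (edges ps)"
  have "\<kappa> = (- 1) ^ length (edges ps) * vol (edges ?qs)"
    using Alt_move[OF vol_Alt, of "[]" "i - ps ! 0" "edges ps" "[]"] e by (simp add: \<kappa>_def contract_def)
  moreover have "vol (edges ?qs) \<noteq> 0" using Alt_n_eq_0[OF vol_Alt qs] vol_frame by auto
  ultimately have "\<kappa> \<noteq> 0" by simp
  have 0: "ps ! 0 \<in> S - {i}" using ps(2) ne nth_mem[of 0 ps] by auto
  have "contract v (edges ps) = \<kappa> * grad i v" for v
  proof (rule linear_eq_on_span[where B = "set (edges ?qs)", of "\<lambda>v. contract v (edges ps)" "\<lambda>v. \<kappa> * grad i v"])
    show "linear (\<lambda>v. \<kappa> * grad i v)"
      using linear_compose_scale_right[OF linear_grad[OF i], of \<kappa>] by simp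
    show "v \<in> span (set (edges ?qs))" using edges_distinct_span(2)[OF qs] by simp
    fix x assume "x \<in> set (edges ?qs)"
    then consider "x = i - ps ! 0" | "x \<in> set (edges ps)" unfolding e by auto
    then show "contract x (edges ps) = \<kappa> * grad i x"
    proof cases
      case 1
      then show ?thesis using 0 i by (auto simp: \<kappa>_def grad_diff bary_vertex)
    next
      case 2
      then obtain q where q: "q \<in> set (tl ps)" "x = q - ps ! 0" by auto
      then have "q \<in> S - {i}" using ps(2) ne list.set_sel(2)[of ps q] by blast
      then have "grad i x = 0" using q 0 i by (auto simp: grad_diff bary_vertex)
      moreover have "contract x (edges ps) = 0"
        unfolding contract_def using 2 by (intro Alt_not_distinct[OF vol_Alt]) auto
      ultimately show ?thesis by simp
    qed
  qed (rule contract_linear)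
  then have "f (edges ps) = \<kappa> * grad i (proxy f)" if "f \<in> Alt (n - 1)" for f
    using contract_proxy[OF that] by metis
  with \<open>\<kappa> \<noteq> 0\<close> show ?thesis by blast
qed

lemma dim_Alt_vectors: "dim (Alt (n - 1) :: 'a form set) = n"
proof -
  have "dim (Alt (n - 1) :: 'a form set) = card {..<n}"
  proof (rule dim_eq_card_coordinates[where \<Psi> = "\<lambda>f i. grad (ori S ! Suc i) (proxy f)"])
    fix g :: "nat \<Rightarrow> real"
    show "\<exists>f\<in>Alt (n - 1). \<forall>i\<in>{..<n}. grad (ori S ! Suc i) (proxy f) = g i"
    proof (intro bexI ballI)
      fix i assume "i \<in> {..<n}"
      then show "grad (ori S ! Suc i) (proxy (contract (\<Sum>j<n. g j *\<^sub>R frame ! j))) = g i"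
        using ori_nth_S[of "Suc i"]
        by (simp add: proxy_contract linear_sum[OF linear_grad] linear_scale[OF linear_grad] frame_dual mult_delta_right)
    qed (rule contract_Alt)
  next
    fix f :: "'a form" assume "f \<in> Alt (n - 1)" "\<And>i. i \<in> {..<n} \<Longrightarrow> grad (ori S ! Suc i) (proxy f) = 0"
    then show "f = 0" using frame_dual(3)[of "proxy f"] by (intro proxy_inject) auto
  next
    fix f g :: "'a form" and i c assume "i \<in> {..<n}"
    then have "linear (grad (ori S ! Suc i))" by (simp add: linear_grad ori_nth_S)
    then show "grad (ori S ! Suc i) (proxy (f + g)) = grad (ori S ! Suc i) (proxy f) + grad (ori S ! Suc i) (proxy g)"
      "grad (ori S ! Suc i) (proxy (c *\<^sub>R f)) = c * grad (ori S ! Suc i) (proxy f)"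
      by (simp_all add: proxy_add proxy_scale linear_add linear_scale)
  qed (simp_all add: subspace_Alt)
  then show ?thesis by simp
qed

end

section \<open>The refined simplex and its nodal functions\<close>

context full_simplex
begin

definition wS :: "'a \<Rightarrow> real" where "wS k = bary k (W S)"
definition wF :: "'a \<Rightarrow> 'a \<Rightarrow> real" where "wF i k = bary k (W (S - {i}))"

lemma ridge_ne: "S - {i, j} \<noteq> {}"
proof
  assume "S - {i, j} = {}"
  then have "card S \<le> card {i, j}" by (intro card_mono) auto
  also have "\<dots> \<le> 2" by (simp add: card_insert_if)
  finally show False using card_S n2 by simp
qed

lemma facet_ne: "S - {i} \<noteq> {}"
  using ridge_ne[of i i] by simp

lemma wS_pos: "k \<in> S \<Longrightarrow> 0 < wS k"
proof -
  assume k: "k \<in> S"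
  have "W S \<in> rel_interior (convex hull S)" using inp by (simp add: inpoints_def faces_def)
  then obtain u where "\<forall>v\<in>S. 0 < u v" "sum u S = 1" "W S = (\<Sum>v\<in>S. u v *\<^sub>R v)"
    unfolding rel_interior_convex_hull_explicit[OF indep] by auto
  then show ?thesis using bary_sum_vertices[OF k, of u] k by (simp add: wS_def)
qed

lemma sum_wS: "(\<Sum>k\<in>S. wS k) = 1"
  by (simp add: wS_def sum_bary)

lemma wF_pos: "i \<in> S \<Longrightarrow> k \<in> S \<Longrightarrow> k \<noteq> i \<Longrightarrow> 0 < wF i k"
  and wF_0: "i \<in> S \<Longrightarrow> wF i i = 0"
proof -
  assume i: "i \<in> S"
  have "W (S - {i}) \<in> rel_interior (convex hull (S - {i}))"
    using inp facet_ne[of i] by (auto simp: inpoints_def faces_def)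
  moreover have "\<not> affine_dependent (S - {i})"
    using indep affine_independent_subset by blast
  ultimately obtain u where u: "\<forall>v\<in>S - {i}. 0 < u v" "sum u (S - {i}) = 1" "W (S - {i}) = (\<Sum>v\<in>S - {i}. u v *\<^sub>R v)"
    unfolding rel_interior_convex_hull_explicit[OF \<open>\<not> affine_dependent (S - {i})\<close>] by auto
  have b: "wF i k = (\<Sum>v\<in>S - {i}. u v * bary k v)" if "k \<in> S" for k
    unfolding wF_def u(3) by (rule bary_combination[OF that u(2)])
  show "wF i i = 0" using b[OF i] i by (auto simp: bary_vertex intro!: sum.neutral)
  assume k: "k \<in> S" "k \<noteq> i"
  have "wF i k = (\<Sum>v\<in>S - {i}. if v = k then u v else 0)"
    unfolding b[OF k(1)] using k by (intro sum.cong) (auto simp: bary_vertex)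
  then show "0 < wF i k" using k u(1) by simp
qed

lemma sum_wF: "(\<Sum>k\<in>S. wF i k) = 1"
  by (simp add: wF_def sum_bary)

text \<open>
  The nodal functions at \<open>W S\<close>, at the inpoint of the facet opposite \<open>i\<close> and at the vertex \<open>k\<close>. The ray
  from \<open>W S\<close> through a point leaves \<open>S\<close> through the facet opposite the \<open>i\<close> for which
  \<open>bary i x / wS i\<close> is smallest, and this minimum is the share of \<open>W S\<close>. The rest lies over this facet,
  as its coordinate \<open>i\<close> is zero, and the same step within the facet gives the share of the facet
  inpoint. For any other facet the second minimum is \<open>0\<close>, because the vanishing coordinate \<open>i\<close> takes
  part in it. As minima of affine functions, the nodal functions are Lipschitz on the whole space, so
  nothing has to be glued along the cells.
\<close>

definition lamS :: "'a \<Rightarrow> real" where "lamS x = Min ((\<lambda>k. bary k x / wS k) ` S)"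
definition rest :: "'a \<Rightarrow> 'a \<Rightarrow> real" where "rest k x = bary k x - wS k * lamS x"
definition lamF :: "'a \<Rightarrow> 'a \<Rightarrow> real" where "lamF i x = Min ((\<lambda>j. rest j x / wF i j) ` (S - {i}))"
definition lamV :: "'a \<Rightarrow> 'a \<Rightarrow> real" where "lamV k x = rest k x - (\<Sum>i\<in>S. wF i k * lamF i x)"

lemma lipschitzian_bary: "k \<in> S \<Longrightarrow> lipschitzian (bary k)"
  using lipschitzian_linear[OF linear_grad, of k "bary k 0"] bary_grad[of k] by (metis (no_types, lifting) ext)

lemma lipschitzian_nodal:
  "lipschitzian lamS" "k \<in> S \<Longrightarrow> lipschitzian (rest k)" "i \<in> S \<Longrightarrow> lipschitzian (lamF i)"
  "k \<in> S \<Longrightarrow> lipschitzian (lamV k)"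
proof -
  show S: "lipschitzian lamS"
    unfolding lamS_def[abs_def] divide_inverse mult.commute[of "bary _ _"]
    by (intro lipschitzian_Min lipschitzian_cmult lipschitzian_bary) auto
  show rest: "lipschitzian (rest k)" if "k \<in> S" for k
    unfolding rest_def[abs_def] by (intro lipschitzian_diff lipschitzian_cmult S lipschitzian_bary that)
  show F: "lipschitzian (lamF i)" if "i \<in> S" for i
    unfolding lamF_def[abs_def] divide_inverse mult.commute[of "rest _ _"]
    using facet_ne by (intro lipschitzian_Min lipschitzian_cmult rest) auto
  show "lipschitzian (lamV k)" if "k \<in> S"
    unfolding lamV_def[abs_def]
    by (intro lipschitzian_diff lipschitzian_sum lipschitzian_cmult rest F that)
qed


subsection \<open>Barycentric coordinates of the cells\<close>

text \<open>
  The maximal simplices of the refinement, given by a facet (opposite \<open>i\<close>) and a face of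
  codimension two in it (opposite \<open>i\<close> and \<open>j\<close>).
\<close>

definition cell :: "'a \<Rightarrow> 'a \<Rightarrow> 'a set" where
  "cell i j = {W S, W (S - {i})} \<union> (S - {i, j})"

text \<open>
  The barycentric coordinates of the cell \<open>(i, j)\<close> that belong to \<open>W S\<close>, to the facet inpoint and to the
  vertex \<open>k\<close>, extended to affine functions on the whole space; \<open>gS\<close>, \<open>gF\<close> and \<open>gV\<close> are their
  linear parts. The vertices \<open>i\<close> and \<open>j\<close>, which are not in the cell, get the coordinate \<open>0\<close>, so
  sums may run over all of \<open>S\<close>.
\<close>

definition cS :: "'a \<Rightarrow> 'a \<Rightarrow> real" where "cS i x = bary i x / wS i"
definition cF :: "'a \<Rightarrow> 'a \<Rightarrow> 'a \<Rightarrow> real" where "cF i j x = (bary j x - wS j * cS i x) / wF i j"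
definition cV :: "'a \<Rightarrow> 'a \<Rightarrow> 'a \<Rightarrow> 'a \<Rightarrow> real" where
  "cV i j k x = bary k x - wS k * cS i x - wF i k * cF i j x"

definition gS :: "'a \<Rightarrow> 'a \<Rightarrow> real" where "gS i h = grad i h / wS i"
definition gF :: "'a \<Rightarrow> 'a \<Rightarrow> 'a \<Rightarrow> real" where "gF i j h = (grad j h - wS j * gS i h) / wF i j"
definition gV :: "'a \<Rightarrow> 'a \<Rightarrow> 'a \<Rightarrow> 'a \<Rightarrow> real" where
  "gV i j k h = grad k h - wS k * gS i h - wF i k * gF i j h"

lemma cell_coord_add:
  assumes "i \<in> S" "j \<in> S"
  shows "cS i (x + h) = cS i x + gS i h" "cF i j (x + h) = cF i j x + gF i j h"
    "k \<in> S \<Longrightarrow> cV i j k (x + h) = cV i j k x + gV i j k h"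
  using assms
  by (simp_all only: cS_def cF_def cV_def gS_def gF_def gV_def bary_add)
    (simp_all add: add_divide_distrib diff_divide_distrib algebra_simps)

lemma linear_cell_grad:
  assumes "i \<in> S" "j \<in> S"
  shows "linear (gS i)" "linear (gF i j)" "k \<in> S \<Longrightarrow> linear (gV i j k)"
  using assms linear_grad[of i] linear_grad[of j] linear_grad[of k]
  by (auto simp: linear_iff gS_def gF_def gV_def field_simps add_divide_distrib diff_divide_distrib)

lemma cell_coord_ij:
  assumes "i \<in> S" "j \<in> S" "i \<noteq> j"
  shows "cV i j i x = 0" "cV i j j x = 0"
  using assms wS_pos[of i] wF_pos[of i j] by (simp_all add: cV_def cS_def cF_def wF_0)

lemma cell_coord_sum:
  assumes "i \<in> S" "j \<in> S" "i \<noteq> j"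
  shows "cS i x + cF i j x + (\<Sum>k\<in>S. cV i j k x) = 1"
    "cS i x *\<^sub>R W S + cF i j x *\<^sub>R W (S - {i}) + (\<Sum>k\<in>S. cV i j k x *\<^sub>R k) = x"
proof -
  have "(\<Sum>k\<in>S. cV i j k x) = (\<Sum>k\<in>S. bary k x) - (\<Sum>k\<in>S. wS k) * cS i x - (\<Sum>k\<in>S. wF i k) * cF i j x"
    by (simp add: cV_def sum_subtractf sum_distrib_right)
  then show "cS i x + cF i j x + (\<Sum>k\<in>S. cV i j k x) = 1" by (simp add: sum_bary sum_wS sum_wF)
  have "(\<Sum>k\<in>S. cV i j k x *\<^sub>R k) = (\<Sum>k\<in>S. bary k x *\<^sub>R k) - cS i x *\<^sub>R (\<Sum>k\<in>S. wS k *\<^sub>R k)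
      - cF i j x *\<^sub>R (\<Sum>k\<in>S. wF i k *\<^sub>R k)"
    by (simp add: cV_def sum_subtractf scaleR_sum_right scaleR_diff_left mult.commute)
  then show "cS i x *\<^sub>R W S + cF i j x *\<^sub>R W (S - {i}) + (\<Sum>k\<in>S. cV i j k x *\<^sub>R k) = x"
    unfolding wS_def wF_def by (simp only: bary_repr) simp
qed

lemma bary_affine: "k \<in> S \<Longrightarrow> u + v = 1 \<Longrightarrow> bary k (u *\<^sub>R x + v *\<^sub>R y) = u * bary k x + v * bary k y"
proof -
  assume k: "k \<in> S" and uv: "u + v = 1"
  have "u * bary k x + v * bary k y = (u + v) * bary k 0 + (u * grad k x + v * grad k y)"
    by (simp add: grad_def algebra_simps)
  then show ?thesis using uv
    by (subst bary_grad) (simp add: linear_add[OF linear_grad[OF k]] linear_scale[OF linear_grad[OF k]])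
qed

lemma cell_coord_affine:
  assumes "i \<in> S" "j \<in> S" "u + v = 1"
  shows "cS i (u *\<^sub>R x + v *\<^sub>R y) = u * cS i x + v * cS i y"
    "cF i j (u *\<^sub>R x + v *\<^sub>R y) = u * cF i j x + v * cF i j y"
    "k \<in> S \<Longrightarrow> cV i j k (u *\<^sub>R x + v *\<^sub>R y) = u * cV i j k x + v * cV i j k y"
  using assms
  by (simp_all add: cS_def cF_def cV_def bary_affine add_divide_distrib diff_divide_distrib algebra_simps)

lemma cell_hull_iff:
  assumes ij: "i \<in> S" "j \<in> S" "i \<noteq> j"
  shows "x \<in> convex hull (cell i j) \<longleftrightarrow> 0 \<le> cS i x \<and> 0 \<le> cF i j x \<and> (\<forall>k\<in>S. 0 \<le> cV i j k x)"
proof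
  let ?A = "{x. 0 \<le> cS i x \<and> 0 \<le> cF i j x \<and> (\<forall>k\<in>S. 0 \<le> cV i j k x)}"
  have "convex ?A"
    by (rule convexI) (auto simp: cell_coord_affine[OF ij(1,2)] intro!: add_nonneg_nonneg mult_nonneg_nonneg)
  moreover have "cell i j \<subseteq> ?A"
  proof
    fix y assume "y \<in> cell i j"
    then consider "y = W S" | "y = W (S - {i})" | "y \<in> S - {i, j}" by (auto simp: cell_def)
    then show "y \<in> ?A"
    proof cases
      case 1
      then have "bary k y = wS k" for k by (simp add: wS_def)
      then show ?thesis using wS_pos[OF ij(1)] by (simp add: cS_def cF_def cV_def)
    next
      case 2
      then have "bary k y = wF i k" for k by (simp add: wF_def)
      then show ?thesis using wS_pos[OF ij(1)] wF_pos[of i j] ij by (simp add: cS_def cF_def cV_def wF_0)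
    next
      case 3
      then show ?thesis using ij by (auto simp: cS_def cF_def cV_def bary_vertex)
    qed
  qed
  ultimately have "convex hull (cell i j) \<subseteq> ?A" by (simp add: hull_minimal)
  then show "x \<in> convex hull (cell i j) \<Longrightarrow> 0 \<le> cS i x \<and> 0 \<le> cF i j x \<and> (\<forall>k\<in>S. 0 \<le> cV i j k x)"
    by blast
next
  let ?c = "cell i j"
  assume x: "0 \<le> cS i x \<and> 0 \<le> cF i j x \<and> (\<forall>k\<in>S. 0 \<le> cV i j k x)"

  \<comment> \<open>the places of \<open>i\<close> and \<open>j\<close>, whose coordinates vanish, are given to the two inpoints\<close>
  define c where "c k = cV i j k x + (if k = i then cS i x else 0) + (if k = j then cF i j x else 0)" for k
  define q where "q k = (if k = i then W S else if k = j then W (S - {i}) else k)" for k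
  have "(\<Sum>k\<in>S. c k *\<^sub>R q k) \<in> convex hull ?c"
  proof (rule convex_sum)
    show "sum c S = 1"
      using ij cell_coord_sum(1)[OF ij, of x] by (simp add: c_def sum.distrib)
    show "0 \<le> c k" if "k \<in> S" for k using x that by (simp add: c_def)
    show "q k \<in> convex hull ?c" if "k \<in> S" for k
      using that by (intro hull_inc) (simp add: q_def cell_def)
  qed auto
  also have "(\<Sum>k\<in>S. c k *\<^sub>R q k)
      = (\<Sum>k\<in>S. cV i j k x *\<^sub>R k + (if k = i then cS i x *\<^sub>R W S else 0)
          + (if k = j then cF i j x *\<^sub>R W (S - {i}) else 0))"
    using ij(3) by (intro sum.cong) (auto simp: c_def q_def cell_coord_ij[OF ij])
  also have "\<dots> = x"
    using ij cell_coord_sum(2)[OF ij, of x] by (simp add: sum.distrib algebra_simps)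
  finally show "x \<in> convex hull ?c" .
qed

text \<open>
  On the cell, the minimum in \<open>lamS\<close> is attained at \<open>i\<close> and that in \<open>lamF i\<close> at \<open>j\<close>. The other
  \<open>lamF l\<close> vanish because \<open>rest i\<close> does.
\<close>

lemma nodal_on_cell:
  assumes ij: "i \<in> S" "j \<in> S" "i \<noteq> j" and x: "x \<in> convex hull (cell i j)"
  shows "lamS x = cS i x" "\<And>l. l \<in> S \<Longrightarrow> lamF l x = (if l = i then cF i j x else 0)"
    "\<And>k. k \<in> S \<Longrightarrow> lamV k x = cV i j k x"
proof -
  have pos: "0 \<le> cS i x" "0 \<le> cF i j x" "\<And>k. k \<in> S \<Longrightarrow> 0 \<le> cV i j k x"
    using x cell_hull_iff[OF ij] by auto
  have b: "bary k x = wS k * cS i x + wF i k * cF i j x + cV i j k x" for k by (simp add: cV_def)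
  have ge: "0 \<le> wF i k" if "k \<in> S" for k using wF_pos[of i k] wF_0[of i] ij that by (cases "k = i") auto
  show S: "lamS x = cS i x"
    unfolding lamS_def
  proof (rule Min_eqI)
    show "cS i x \<in> (\<lambda>k. bary k x / wS k) ` S" using ij by (auto simp: cS_def)
    fix y assume "y \<in> (\<lambda>k. bary k x / wS k) ` S"
    then obtain k where k: "k \<in> S" "y = bary k x / wS k" by auto
    have "cS i x * wS k \<le> bary k x"
      unfolding b using pos(2) pos(3)[OF k(1)] ge[OF k(1)] by (simp add: mult.commute)
    then show "cS i x \<le> y" using wS_pos[OF k(1)] k by (simp add: pos_le_divide_eq)
  qed simp
  have r: "rest k x = wF i k * cF i j x + cV i j k x" for k using b[of k] by (simp add: rest_def S)
  have r0: "0 \<le> rest k x" if "k \<in> S" for k unfolding r using pos ge that by simp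
  show F: "lamF l x = (if l = i then cF i j x else 0)" if l: "l \<in> S" for l
  proof (cases "l = i")
    case True
    have "lamF i x = cF i j x"
      unfolding lamF_def
    proof (rule Min_eqI)
      have "rest j x / wF i j = cF i j x"
        using r[of j] cell_coord_ij[OF ij] wF_pos[of i j] ij by simp
      then show "cF i j x \<in> (\<lambda>j. rest j x / wF i j) ` (S - {i})" using ij by force
      fix y assume "y \<in> (\<lambda>j. rest j x / wF i j) ` (S - {i})"
      then obtain k where k: "k \<in> S" "k \<noteq> i" "y = rest k x / wF i k" by auto
      then show "cF i j x \<le> y" using r[of k] pos(3)[of k] wF_pos[of i k] ij by (simp add: pos_le_divide_eq)
    qed simp
    then show ?thesis using True by simp
  next
    case False
    have "lamF l x = 0"
      unfolding lamF_def
    proof (rule Min_eqI)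
      have "rest i x / wF l i = 0" using r[of i] cell_coord_ij[OF ij] ij by (simp add: wF_0)
      then show "0 \<in> (\<lambda>j. rest j x / wF l j) ` (S - {l})" using ij False by force
      fix y assume "y \<in> (\<lambda>j. rest j x / wF l j) ` (S - {l})"
      then obtain k where k: "k \<in> S" "k \<noteq> l" "y = rest k x / wF l k" by auto
      then show "0 \<le> y" using r0[of k] wF_pos[of l k] l by simp
    qed simp
    then show ?thesis using False by simp
  qed
  fix k assume k: "k \<in> S"
  have "(\<Sum>l\<in>S. wF l k * lamF l x) = (\<Sum>l\<in>S. if l = i then wF i k * cF i j x else 0)"
    by (intro sum.cong) (auto simp: F)
  then show "lamV k x = cV i j k x" using ij by (simp add: lamV_def r)
qed

text \<open>
  The indices \<open>i\<close> and \<open>j\<close> are those at which the two minima are attained.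
\<close>

lemma cells_cover:
  assumes x: "x \<in> convex hull S"
  obtains i j where "i \<in> S" "j \<in> S" "i \<noteq> j" "x \<in> convex hull (cell i j)"
proof -
  have "lamS x \<in> (\<lambda>k. bary k x / wS k) ` S" unfolding lamS_def by (rule Min_in) auto
  then obtain i where i: "i \<in> S" "lamS x = bary i x / wS i" by auto
  have S: "lamS x * wS k \<le> bary k x" if "k \<in> S" for k
  proof -
    have "lamS x \<le> bary k x / wS k" unfolding lamS_def using that by simp
    then show ?thesis using wS_pos[OF that] by (simp add: pos_le_divide_eq)
  qed
  have "lamF i x \<in> (\<lambda>j. rest j x / wF i j) ` (S - {i})"
    unfolding lamF_def using facet_ne by (intro Min_in) auto
  then obtain j where j: "j \<in> S" "j \<noteq> i" "lamF i x = rest j x / wF i j" by auto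
  have F: "lamF i x * wF i k \<le> rest k x" if "k \<in> S" "k \<noteq> i" for k
  proof -
    have "lamF i x \<le> rest k x / wF i k" unfolding lamF_def using that by simp
    then show ?thesis using wF_pos[OF i(1) that] by (simp add: pos_le_divide_eq)
  qed
  have eq: "cS i x = lamS x" "cF i j x = lamF i x"
    using i j by (simp_all add: cS_def cF_def rest_def)
  have "x \<in> convex hull (cell i j)"
    unfolding cell_hull_iff[OF i(1) j(1) j(2)[symmetric]]
  proof (intro conjI ballI)
    show "0 \<le> cS i x" using x i wS_pos[of i] by (simp add: cS_def hull_iff)
    show "0 \<le> cF i j x" using S[OF j(1)] wF_pos[OF i(1) j(1,2)] by (simp add: eq j rest_def mult.commute)
    fix k assume k: "k \<in> S"
    show "0 \<le> cV i j k x"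
    proof (cases "k = i")
      case False
      then show ?thesis using F[OF k] by (simp add: cV_def eq rest_def algebra_simps)
    qed (use cell_coord_ij i j in simp)
  qed
  with i j that show thesis by blast
qed

lemma cell_subset_hull:
  assumes ij: "i \<in> S" "j \<in> S" "i \<noteq> j" shows "convex hull (cell i j) \<subseteq> convex hull S"
proof
  fix x assume "x \<in> convex hull (cell i j)"
  then have pos: "0 \<le> cS i x" "0 \<le> cF i j x" "\<And>k. k \<in> S \<Longrightarrow> 0 \<le> cV i j k x"
    using cell_hull_iff[OF ij] by auto
  have ge: "0 \<le> wF i k" if "k \<in> S" for k using wF_pos[of i k] wF_0[of i] ij that by (cases "k = i") auto
  have "bary k x = wS k * cS i x + wF i k * cF i j x + cV i j k x" for k by (simp add: cV_def)
  then have "0 \<le> bary k x" if "k \<in> S" for k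
    using pos(1,2) pos(3)[OF that] ge[OF that] wS_pos[OF that] by simp
  then show "x \<in> convex hull S" by (simp add: hull_iff)
qed

lemma interior_cell_nonempty:
  assumes ij: "i \<in> S" "j \<in> S" "i \<noteq> j" shows "interior (convex hull (cell i j)) \<noteq> {}"
proof -
  let ?A = "{x. 0 < cS i x} \<inter> {x. 0 < cF i j x} \<inter> (\<Inter>k\<in>S - {i, j}. {x. 0 < cV i j k x})"
  have "open {x. 0 < cS i x}" "open {x. 0 < cF i j x}" "\<And>k. k \<in> S \<Longrightarrow> open {x. 0 < cV i j k x}"
    unfolding cS_def cF_def cV_def using wS_pos[of i] wF_pos[of i j] ij
    by (auto intro!: open_Collect_less continuous_intros simp: less_imp_neq[symmetric])
  then have op: "open ?A" by (intro open_Int open_INT) auto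
  have sub: "?A \<subseteq> convex hull (cell i j)"
  proof
    fix x assume x: "x \<in> ?A"
    have "0 \<le> cV i j k x" if "k \<in> S" for k
      using x that cell_coord_ij[OF ij, of x] by (cases "k = i \<or> k = j") (auto intro: less_imp_le)
    then show "x \<in> convex hull (cell i j)" using x by (auto simp: cell_hull_iff[OF ij])
  qed
  \<comment> \<open>\<open>x\<close> is the barycentre of the cell\<close>
  define N where "N = real (n + 1)"
  define c where "c k = wS k / N + wF i k / N + (if k = i \<or> k = j then 0 else 1 / N)" for k
  define x where "x = (\<Sum>k\<in>S. c k *\<^sub>R k)"
  have N: "N > 0" by (simp add: N_def)
  have "(\<Sum>k\<in>S. (if k = i \<or> k = j then 0 else 1 / N)) = (\<Sum>k\<in>S - {i, j}. 1 / N)"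
    by (rule sum.mono_neutral_cong_right) auto
  also have "\<dots> = (N - 2) / N"
    using card_S ij n2 by (simp add: card_Diff_subset N_def)
  finally have "(\<Sum>k\<in>S. wS k / N + wF i k / N + (if k = i \<or> k = j then 0 else 1 / N)) = 1 / N + 1 / N + (N - 2) / N"
    by (simp only: sum.distrib sum_divide_distrib[symmetric] sum_wS sum_wF)
  then have "sum c S = 1 / N + 1 / N + (N - 2) / N" by (simp add: c_def)
  then have "sum c S = 1" using N by (simp add: field_simps)
  then have b: "bary k x = c k" if "k \<in> S" for k
    using bary_sum_vertices[OF that] by (simp add: x_def)
  have "cS i x = 1 / N" using b[OF ij(1)] wS_pos[OF ij(1)] N by (simp add: cS_def c_def wF_0 ij field_simps)
  moreover from this have "cF i j x = 1 / N"
    using b[OF ij(2)] wF_pos[of i j] ij N by (simp add: cF_def c_def field_simps)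
  ultimately have "x \<in> ?A" using b N by (auto simp: cV_def c_def)
  then have "x \<in> interior (convex hull (cell i j))" using interior_maximal[OF sub op] by blast
  then show ?thesis by blast
qed

lemma cell_in_refinement:
  assumes ij: "i \<in> S" "j \<in> S" "i \<noteq> j" shows "cell i j \<in> refinement (n - 1 - 1) W S"
proof -
  have cards: "card (S - {i, j}) = n - 1" "card (S - {i}) = n"
    using card_S ij by (simp_all add: card_Diff_subset)
  show ?thesis
    unfolding refinement_def cell_def using n2 cards card_S ij facet_ne ridge_ne
    by (intro CollectI conjI exI[of _ "S - {i, j}"] exI[of _ "{S, S - {i}}"])
      (auto simp: faces_def chain_subset_def)
qed

text \<open>
  Apart from \<open>S\<close> itself, a chain of faces with at least \<open>n\<close> vertices contains at most one facet.
\<close>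

lemma refinement_subset_cell:
  assumes "\<sigma> \<in> refinement (n - 1 - 1) W S"
  obtains i j where "i \<in> S" "j \<in> S" "i \<noteq> j" "\<sigma> \<subseteq> cell i j"
proof -
  obtain F C where F: "F \<in> faces S" "card F \<le> n - 1 - 1 + 1"
    and C: "C \<subseteq> {G \<in> faces S. card G \<ge> n - 1 - 1 + 2 \<and> F \<subset> G}" "chain\<^sub>\<subseteq> C" and \<sigma>: "\<sigma> \<subseteq> W ` C \<union> F"
    using assms unfolding refinement_def by blast
  have FS: "F \<subseteq> S" "card F \<le> n - 1" using F n2 by (auto simp: faces_def)
  have G: "G = S \<or> (\<exists>i\<in>S. G = S - {i} \<and> i \<notin> F)" if "G \<in> C" for G
  proof -
    have G: "G \<subseteq> S" "card G \<ge> n" "F \<subset> G" using that C n2 by (auto simp: faces_def)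
    have "card (S - G) \<le> 1" using G card_S by (simp add: card_Diff_subset finite_subset)
    then consider "S - G = {}" | i where "S - G = {i}"
      by (metis card_1_singletonE card_0_eq finite_Diff finite_S le_Suc_eq le_zero_eq One_nat_def)
    then show ?thesis using G by cases blast+
  qed
  have "card (S - F) \<ge> 2" using FS card_S n2 by (simp add: card_Diff_subset finite_subset)
  then obtain a b where ab: "a \<in> S - F" "b \<in> S - F" "a \<noteq> b"
    by (metis card_le_Suc0_iff_eq finite_Diff finite_S not_less_eq_eq numeral_2_eq_2)
  obtain i where i: "i \<in> S - F" "C \<subseteq> {S, S - {i}}"
  proof (cases "\<exists>i\<in>S - F. S - {i} \<in> C")
    case True
    then obtain i where i: "i \<in> S - F" "S - {i} \<in> C" by blast
    have "G \<in> {S, S - {i}}" if g: "G \<in> C" for G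
    proof -
      consider "G = S" | k where "k \<in> S" "G = S - {k}" using G[OF g] by blast
      then show ?thesis
      proof cases
        case 2
        have "G \<subseteq> S - {i} \<or> S - {i} \<subseteq> G" using C(2) g i(2) by (auto simp: chain_subset_def)
        then show ?thesis using 2 i(1) by blast
      qed simp
    qed
    then show thesis using that i by blast
  next
    case False
    then have "C \<subseteq> {S, S - {a}}" using G by blast
    then show thesis using that ab by blast
  qed
  obtain j where j: "j \<in> S - F" "j \<noteq> i" using ab by metis
  have "W ` C \<subseteq> {W S, W (S - {i})}" "F \<subseteq> S - {i, j}" using i j FS by blast+
  then have "\<sigma> \<subseteq> cell i j" using \<sigma> unfolding cell_def by blast
  then show thesis using that i j by blast
qed

lemma AE_interior_cell:
  "AE x in lborel. x \<in> convex hull S \<longrightarrow> (\<exists>i\<in>S. \<exists>j\<in>S. i \<noteq> j \<and> x \<in> interior (convex hull (cell i j)))"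
proof -
  let ?N = "\<Union>i\<in>S. \<Union>j\<in>S. frontier (convex hull (cell i j))"
  have "frontier (convex hull (cell i j)) \<in> null_sets lborel" for i j
  proof -
    have "negligible (frontier (convex hull (cell i j)))"
      by (rule negligible_convex_frontier) simp
    then show ?thesis
      by (simp add: negligible_iff_null_sets null_sets_completion_iff)
  qed
  then have "?N \<in> null_sets lborel" by (intro null_sets.finite_UN) auto
  then show ?thesis
  proof (rule AE_I')
    show "{x \<in> space lborel. \<not> (x \<in> convex hull S \<longrightarrow> (\<exists>i\<in>S. \<exists>j\<in>S. i \<noteq> j \<and> x \<in> interior (convex hull (cell i j))))} \<subseteq> ?N"
    proof (rule subsetI)
      fix x
      assume "x \<in> {x \<in> space lborel. \<not> (x \<in> convex hull S \<longrightarrow> (\<exists>i\<in>S. \<exists>j\<in>S. i \<noteq> j \<and> x \<in> interior (convex hull (cell i j))))}"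
      then have x: "x \<in> convex hull S"
        and no: "\<not> (\<exists>i\<in>S. \<exists>j\<in>S. i \<noteq> j \<and> x \<in> interior (convex hull (cell i j)))" by auto
      obtain i j where ij: "i \<in> S" "j \<in> S" "i \<noteq> j" "x \<in> convex hull (cell i j)" using cells_cover[OF x] .
      then have "x \<in> frontier (convex hull (cell i j))"
        using no closure_subset by (auto simp: frontier_def)
      then show "x \<in> ?N" using ij by blast
    qed
  qed
qed

lemma nodal_at_vertex:
  assumes k: "k \<in> S"
  shows "lamS k = 0" "i \<in> S \<Longrightarrow> lamF i k = 0" "l \<in> S \<Longrightarrow> lamV l k = (if l = k then 1 else 0)"
proof -
  obtain a where a: "a \<in> S - {k}" using facet_ne by blast
  obtain b where b: "b \<in> S - {k, a}" using ridge_ne by blast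
  have ab: "a \<in> S" "b \<in> S" "a \<noteq> b" and kc: "k \<in> convex hull (cell a b)"
    using a b k by (auto simp: cell_def intro!: hull_inc)
  note nod = nodal_on_cell[OF ab kc]
  have c: "cS a k = 0" "cF a b k = 0" using a b k by (auto simp: cS_def cF_def bary_vertex)
  show "lamS k = 0" using nod c by simp
  show "lamF i k = 0" if "i \<in> S" using nod(2)[OF that] c by simp
  show "lamV l k = (if l = k then 1 else 0)" if "l \<in> S"
    using nod(3)[OF that] c k that by (auto simp: cV_def bary_vertex)
qed

lemma nodal_on_facet:
  assumes i: "i \<in> S" and x: "x \<in> convex hull S" "bary i x = 0"
  shows "lamS x = 0" "\<And>l. l \<in> S \<Longrightarrow> l \<noteq> i \<Longrightarrow> lamF l x = 0" "0 \<le> lamF i x"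
    "(\<And>k. k \<in> S \<Longrightarrow> k \<noteq> i \<Longrightarrow> 0 < bary k x) \<Longrightarrow> 0 < lamF i x"
proof -
  have pos: "0 \<le> bary k x" if "k \<in> S" for k using x that by (simp add: hull_iff)
  show S: "lamS x = 0"
    unfolding lamS_def
  proof (rule Min_eqI)
    show "0 \<in> (\<lambda>k. bary k x / wS k) ` S" using i x(2) by force
  qed (use pos wS_pos in \<open>auto intro!: divide_nonneg_pos\<close>)
  have r: "rest k x = bary k x" for k by (simp add: rest_def S)
  show "lamF l x = 0" if "l \<in> S" "l \<noteq> i" for l
    unfolding lamF_def r
  proof (rule Min_eqI)
    show "0 \<in> (\<lambda>k. bary k x / wF l k) ` (S - {l})" using i x(2) that by force
  qed (use pos wF_pos that in \<open>auto intro!: divide_nonneg_pos\<close>)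
  have "lamF i x \<in> (\<lambda>j. rest j x / wF i j) ` (S - {i})"
    unfolding lamF_def using facet_ne by (intro Min_in) auto
  then obtain j where j: "j \<in> S" "j \<noteq> i" "lamF i x = bary j x / wF i j" by (auto simp: r)
  then show "0 \<le> lamF i x" using pos wF_pos[OF i] by (simp add: divide_nonneg_pos)
  show "0 < lamF i x" if "\<And>k. k \<in> S \<Longrightarrow> k \<noteq> i \<Longrightarrow> 0 < bary k x"
    using j that[of j] wF_pos[OF i] by simp
qed

end

section \<open>Fields of locally constant divergence\<close>

context full_simplex
begin

text \<open>
  The field with the values \<open>P k\<close> at the vertices, \<open>Q i\<close> at the facet inpoints (indexed by the opposite vertex)
  and \<open>A\<close> at \<open>W S\<close>.
\<close>

definition nodal_field :: "('a \<Rightarrow> 'a) \<Rightarrow> ('a \<Rightarrow> 'a) \<Rightarrow> 'a \<Rightarrow> 'a \<Rightarrow> 'a" where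
  "nodal_field P Q A x = lamS x *\<^sub>R A + (\<Sum>i\<in>S. lamF i x *\<^sub>R Q i) + (\<Sum>k\<in>S. lamV k x *\<^sub>R P k)"

definition nodal_form :: "('a \<Rightarrow> 'a) \<Rightarrow> ('a \<Rightarrow> 'a) \<Rightarrow> 'a \<Rightarrow> 'a \<Rightarrow> 'a form" where
  "nodal_form P Q A = (\<lambda>x. if x \<in> convex hull S then contract (nodal_field P Q A x) else 0)"

text \<open>
  The divergence on the cell \<open>(i, j)\<close>: a field \<open>\<Sum>p. \<lambda>\<^sub>p v\<^sub>p\<close> with affine \<open>\<lambda>\<^sub>p\<close> has the
  divergence \<open>\<Sum>p. d\<lambda>\<^sub>p(v\<^sub>p)\<close>.
\<close>

definition cdiv :: "('a \<Rightarrow> 'a) \<Rightarrow> ('a \<Rightarrow> 'a) \<Rightarrow> 'a \<Rightarrow> 'a \<Rightarrow> 'a \<Rightarrow> real" where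
  "cdiv P Q A i j = gS i A + gF i j (Q i) + (\<Sum>k\<in>S. gV i j k (P k))"

abbreviation const_div :: "('a \<Rightarrow> 'a) \<Rightarrow> ('a \<Rightarrow> 'a) \<Rightarrow> 'a \<Rightarrow> real \<Rightarrow> bool" where
  "const_div P Q A d \<equiv> \<forall>i\<in>S. \<forall>j\<in>S. i \<noteq> j \<longrightarrow> cdiv P Q A i j = d"

abbreviation vol_form :: "real \<Rightarrow> 'a \<Rightarrow> 'a form" where
  "vol_form d \<equiv> (\<lambda>x. if x \<in> convex hull S then d *\<^sub>R vol else 0)"

lemma C0_formsD:
  assumes "u \<in> C0_forms k S"
  shows "u x \<in> Alt k" "x \<notin> convex hull S \<Longrightarrow> u x = 0" "continuous_on (convex hull S) (\<lambda>x. u x vs)"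
  using assms by (auto simp: C0_forms_def)

lemma interior_integrable:
  fixes f :: "'a \<Rightarrow> real"
  assumes "continuous_on (convex hull S) f"
  shows "set_integrable lborel (interior (convex hull S)) f"
proof (rule set_integrable_subset)
  show "set_integrable lborel (convex hull S) f"
    unfolding set_integrable_def using borel_integrable_compact[OF compact_hull assms] by simp
qed (auto simp: interior_subset)

text \<open>
  At each point the terms of the weak exterior derivative add up to \<open>wedge (\<phi>' x) (u x)\<close>.
  This is an \<open>n\<close>-form, so it suffices to test on a single basis.
\<close>

lemma has_ext_deriv_iff:
  assumes u: "u \<in> C0_forms (n - 1) S" and w: "w \<in> C0_forms n S"
  shows "has_ext_deriv (n - 1) S u w \<longleftrightarrow>
    (\<forall>\<phi> \<phi>'. test_function (interior (convex hull S)) \<phi> \<phi>' \<longrightarrow>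
      (LINT x:interior (convex hull S)|lborel. w x frame * \<phi> x) =
      - (LINT x:interior (convex hull S)|lborel. \<phi>' x (proxy (u x))))"
proof -
  let ?U = "interior (convex hull S)"
  have n: "Suc (n - 1) = n" using n2 by simp
  have rhs: "- (\<Sum>i<n. (- 1) ^ i * (LINT x:?U|lborel. u x (take i \<xi> @ drop (Suc i) \<xi>) * \<phi>' x (\<xi> ! i)))
      = - (LINT x:?U|lborel. \<phi>' x (proxy (u x))) * vol \<xi>"
    if t: "test_function ?U \<phi> \<phi>'" and len: "length \<xi> = n" for \<phi> \<phi>' \<xi>
  proof -
    have "(\<Sum>i<n. (- 1) ^ i * (LINT x:?U|lborel. u x (take i \<xi> @ drop (Suc i) \<xi>) * \<phi>' x (\<xi> ! i)))
        = (\<Sum>i<n. LINT x:?U|lborel. (- 1) ^ i * (u x (del i \<xi>) * \<phi>' x (\<xi> ! i)))" by simp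
    also have "\<dots> = (LINT x:?U|lborel. \<Sum>i<n. (- 1) ^ i * (u x (del i \<xi>) * \<phi>' x (\<xi> ! i)))"
      unfolding set_lebesgue_integral_def scaleR_sum_right
    proof (rule Bochner_Integration.integral_sum[symmetric])
      fix i
      have "set_integrable lborel ?U (\<lambda>x. (- 1) ^ i * (u x (del i \<xi>) * \<phi>' x (\<xi> ! i)))"
        by (intro interior_integrable continuous_intros C0_formsD(3)[OF u]
            continuous_on_subset[OF test_functionD(4)[OF t]]) simp
      then show "integrable lborel (\<lambda>x. indicator ?U x *\<^sub>R ((- 1) ^ i * (u x (del i \<xi>) * \<phi>' x (\<xi> ! i))))"
        by (simp add: set_integrable_def)
    qed
    also have "\<dots> = (LINT x:?U|lborel. \<phi>' x (proxy (u x)) * vol \<xi>)"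
    proof (rule set_lebesgue_integral_cong; (intro allI impI)?)
      fix x
      have "(\<Sum>i<n. (- 1) ^ i * (u x (del i \<xi>) * \<phi>' x (\<xi> ! i))) = wedge (\<phi>' x) (u x) \<xi>"
        by (simp add: wedge_def len mult.commute)
      then show "(\<Sum>i<n. (- 1) ^ i * (u x (del i \<xi>) * \<phi>' x (\<xi> ! i))) = \<phi>' x (proxy (u x)) * vol \<xi>"
        using wedge_proxy[OF test_functionD(2)[OF t] C0_formsD(1)[OF u]] by simp
    qed simp
    finally show ?thesis by simp
  qed
  have lhs: "(LINT x:?U|lborel. w x \<xi> * \<phi> x) = (LINT x:?U|lborel. w x frame * \<phi> x) * vol \<xi>" for \<xi> \<phi>
  proof -
    have "(\<lambda>x. w x \<xi> * \<phi> x) = (\<lambda>x. (w x frame * \<phi> x) * vol \<xi>)"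
      using Alt_n_multiple[OF C0_formsD(1)[OF w], of _ \<xi>] by (auto simp: fun_eq_iff)
    then show ?thesis by (simp only: set_integral_mult_left)
  qed
  show ?thesis
    unfolding has_ext_deriv_def n
  proof (intro iffI allI impI)
    fix \<phi> \<phi>' assume *: "\<forall>\<phi> \<phi>' \<xi>. test_function ?U \<phi> \<phi>' \<longrightarrow> length \<xi> = n \<longrightarrow>
       (LINT x:?U|lborel. w x \<xi> * \<phi> x) =
       - (\<Sum>i<n. (- 1) ^ i * (LINT x:?U|lborel. u x (take i \<xi> @ drop (Suc i) \<xi>) * \<phi>' x (\<xi> ! i)))"
      and t: "test_function ?U \<phi> \<phi>'"
    then show "(LINT x:?U|lborel. w x frame * \<phi> x) = - (LINT x:?U|lborel. \<phi>' x (proxy (u x)))"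
      using *[rule_format, OF t frame_dual(1)] rhs[OF t frame_dual(1)] by (simp add: vol_frame)
  next
    fix \<phi> \<phi>' and \<xi> :: "'a list" assume *: "\<forall>\<phi> \<phi>'. test_function ?U \<phi> \<phi>' \<longrightarrow>
        (LINT x:?U|lborel. w x frame * \<phi> x) = - (LINT x:?U|lborel. \<phi>' x (proxy (u x)))"
      and t: "test_function ?U \<phi> \<phi>'" and len: "length \<xi> = n"
    show "(LINT x:?U|lborel. w x \<xi> * \<phi> x) =
       - (\<Sum>i<n. (- 1) ^ i * (LINT x:?U|lborel. u x (take i \<xi> @ drop (Suc i) \<xi>) * \<phi>' x (\<xi> ! i)))"
      unfolding rhs[OF t len] lhs[of \<xi>] using *[rule_format, OF t] by simp
  qed
qed

lemma contract_sum: "contract (\<Sum>i\<in>I. f i) xs = (\<Sum>i\<in>I. contract (f i) xs)"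
  by (rule linear_sum[OF contract_linear])

lemma contract_nodal_field:
  "contract (nodal_field P Q A x) vs = lamS x * contract A vs + (\<Sum>i\<in>S. lamF i x * contract (Q i) vs)
    + (\<Sum>k\<in>S. lamV k x * contract (P k) vs)"
  by (simp add: nodal_field_def linear_add[OF contract_linear] contract_sum linear_scale[OF contract_linear])

lemma contract_nodal_field_on_cell:
  assumes ij: "i \<in> S" "j \<in> S" "i \<noteq> j" and x: "x \<in> convex hull (cell i j)"
  shows "contract (nodal_field P Q A x) vs = cS i x * contract A vs + cF i j x * contract (Q i) vs
    + (\<Sum>k\<in>S. cV i j k x * contract (P k) vs)"
proof -
  have "(\<Sum>l\<in>S. lamF l x * contract (Q l) vs) = (\<Sum>l\<in>S. if l = i then cF i j x * contract (Q i) vs else 0)"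
    by (intro sum.cong) (auto simp: nodal_on_cell(2)[OF ij x])
  moreover have "(\<Sum>k\<in>S. lamV k x * contract (P k) vs) = (\<Sum>k\<in>S. cV i j k x * contract (P k) vs)"
    by (intro sum.cong) (auto simp: nodal_on_cell(3)[OF ij x])
  ultimately show ?thesis using ij by (simp add: contract_nodal_field nodal_on_cell(1)[OF ij x])
qed

lemma continuous_nodal:
  "continuous_on X lamS" "i \<in> S \<Longrightarrow> continuous_on X (lamF i)" "i \<in> S \<Longrightarrow> continuous_on X (lamV i)"
  by (rule lipschitzian_continuous, rule lipschitzian_nodal, assumption?)+

lemma nodal_form_C0P1: "nodal_form P Q A \<in> C0P1_forms (n - 1) S (refinement (n - 1 - 1) W S)"
proof -
  have "continuous_on (convex hull S) (\<lambda>x. nodal_form P Q A x vs)" for vs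
  proof -
    have "continuous_on (convex hull S) (\<lambda>x. contract (nodal_field P Q A x) vs)"
      unfolding contract_nodal_field by (intro continuous_intros continuous_nodal)
    then show ?thesis
      by (rule continuous_on_eq) (simp add: nodal_form_def)
  qed
  then have C0: "nodal_form P Q A \<in> C0_forms (n - 1) S"
    using contract_Alt by (auto simp: C0_forms_def nodal_form_def subspace_0[OF subspace_Alt])
  have "\<exists>L c. linear L \<and> (\<forall>x\<in>convex hull \<sigma>. nodal_form P Q A x vs = c + L x)"
    if \<sigma>: "\<sigma> \<in> refinement (n - 1 - 1) W S" for \<sigma> vs
  proof -
    obtain i j where ij: "i \<in> S" "j \<in> S" "i \<noteq> j" and sub: "\<sigma> \<subseteq> cell i j"
      using refinement_subset_cell[OF \<sigma>] .
    define g where "g x = cS i x * contract A vs + cF i j x * contract (Q i) vs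
      + (\<Sum>k\<in>S. cV i j k x * contract (P k) vs)" for x
    define L where "L x = gS i x * contract A vs + gF i j x * contract (Q i) vs
      + (\<Sum>k\<in>S. gV i j k x * contract (P k) vs)" for x
    have "linear L"
    proof (rule linearI)
      note lin = linear_cell_grad[OF ij(1,2)]
      fix x y and b :: real
      show "L (x + y) = L x + L y"
        by (simp add: L_def linear_add[OF lin(1)] linear_add[OF lin(2)] linear_add[OF lin(3)]
            sum.distrib algebra_simps)
      show "L (b *\<^sub>R x) = b *\<^sub>R L x"
        by (simp add: L_def linear_scale[OF lin(1)] linear_scale[OF lin(2)] linear_scale[OF lin(3)]
            sum_distrib_left algebra_simps)
    qed
    moreover have g: "g x = g 0 + L x" for x
    proof -
      have "cV i j k x = cV i j k 0 + gV i j k x" if "k \<in> S" for k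
        using cell_coord_add(3)[OF ij(1,2) that, of 0 x] by simp
      then have "(\<Sum>k\<in>S. cV i j k x * contract (P k) vs)
          = (\<Sum>k\<in>S. (cV i j k 0 + gV i j k x) * contract (P k) vs)"
        by (simp cong: sum.cong)
      also have "\<dots> = (\<Sum>k\<in>S. cV i j k 0 * contract (P k) vs) + (\<Sum>k\<in>S. gV i j k x * contract (P k) vs)"
        by (simp only: distrib_right sum.distrib)
      finally have "(\<Sum>k\<in>S. cV i j k x * contract (P k) vs)
          = (\<Sum>k\<in>S. cV i j k 0 * contract (P k) vs) + (\<Sum>k\<in>S. gV i j k x * contract (P k) vs)" .
      moreover have "cS i x = cS i 0 + gS i x" "cF i j x = cF i j 0 + gF i j x"
        using cell_coord_add(1,2)[OF ij(1,2), of 0 x] by simp_all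
      ultimately show ?thesis by (simp only: g_def L_def distrib_right)
    qed
    moreover have "nodal_form P Q A x vs = g 0 + L x" if "x \<in> convex hull \<sigma>" for x
    proof -
      have x: "x \<in> convex hull (cell i j)" using that hull_mono[OF sub] by blast
      then have "x \<in> convex hull S" using cell_subset_hull[OF ij] by blast
      then have "nodal_form P Q A x vs = g x"
        using contract_nodal_field_on_cell[OF ij x] by (simp add: nodal_form_def g_def)
      then show ?thesis using g[of x] by (rule trans)
    qed
    ultimately show ?thesis by blast
  qed
  with C0 show ?thesis by (simp add: C0P1_forms_def)
qed

lemma C0P1_nodal_form:
  assumes u: "u \<in> C0P1_forms (n - 1) S (refinement (n - 1 - 1) W S)"
  shows "u = nodal_form (\<lambda>k. proxy (u k)) (\<lambda>i. proxy (u (W (S - {i})))) (proxy (u (W S)))"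
proof (intro ext)
  fix x vs
  let ?v = "nodal_form (\<lambda>k. proxy (u k)) (\<lambda>i. proxy (u (W (S - {i})))) (proxy (u (W S)))"
  have C0: "u \<in> C0_forms (n - 1) S" using u by (simp add: C0P1_forms_def)
  note cv = contract_proxy[OF C0_formsD(1)[OF C0]]
  show "u x vs = ?v x vs"
  proof (cases "x \<in> convex hull S")
    case True
    then obtain i j where ij: "i \<in> S" "j \<in> S" "i \<noteq> j" and x: "x \<in> convex hull (cell i j)"
      using cells_cover by blast
    obtain L c where L: "linear L" "\<And>y. y \<in> convex hull (cell i j) \<Longrightarrow> u y vs = c + L y"
      using u cell_in_refinement[OF ij] unfolding C0P1_forms_def by blast
    have V: "cV i j k x * u k vs = cV i j k x * (c + L k)" if "k \<in> S" for k
    proof (cases "k = i \<or> k = j")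
      case False
      then show ?thesis using that L(2)[of k] by (simp add: cell_def hull_inc)
    qed (use cell_coord_ij[OF ij] in auto)
    have W: "u (W S) vs = c + L (W S)" "u (W (S - {i})) vs = c + L (W (S - {i}))"
      using L(2) by (simp_all add: cell_def hull_inc)
    have "u x vs = c + L x" using L(2)[OF x] .
    also have "\<dots> = c * (cS i x + cF i j x + (\<Sum>k\<in>S. cV i j k x))
        + L (cS i x *\<^sub>R W S + cF i j x *\<^sub>R W (S - {i}) + (\<Sum>k\<in>S. cV i j k x *\<^sub>R k))"
      by (simp only: cell_coord_sum[OF ij] mult_1_right)
    also have "\<dots> = cS i x * (c + L (W S)) + cF i j x * (c + L (W (S - {i}))) + (\<Sum>k\<in>S. cV i j k x * (c + L k))"
      by (simp add: linear_add[OF L(1)] linear_scale[OF L(1)] linear_sum[OF L(1)] algebra_simps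
          sum.distrib sum_distrib_left)
    also have "(\<Sum>k\<in>S. cV i j k x * (c + L k)) = (\<Sum>k\<in>S. cV i j k x * u k vs)"
      by (rule sum.cong[OF refl V[symmetric]])
    also have "cS i x * (c + L (W S)) + cF i j x * (c + L (W (S - {i}))) + \<dots> = ?v x vs"
      using True by (simp add: nodal_form_def contract_nodal_field_on_cell[OF ij x] cv W)
    finally show ?thesis .
  next
    case False
    then show ?thesis using C0_formsD(2)[OF C0] by (simp add: nodal_form_def)
  qed
qed

lemma proxy_nodal_form: "x \<in> convex hull S \<Longrightarrow> proxy (nodal_form P Q A x) = nodal_field P Q A x"
  by (simp add: nodal_form_def proxy_contract)

lemma cell_difference_quotient:
  assumes ij: "i \<in> S" "j \<in> S" "i \<noteq> j" and x: "x \<in> interior (convex hull (cell i j))"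
  shows "(\<lambda>m. (lamS x - lamS (x - (1 / Suc m) *\<^sub>R h)) / (1 / Suc m)) \<longlonglongrightarrow> gS i h"
    "l \<in> S \<Longrightarrow> (\<lambda>m. (lamF l x - lamF l (x - (1 / Suc m) *\<^sub>R h)) / (1 / Suc m)) \<longlonglongrightarrow> (if l = i then gF i j h else 0)"
    "k \<in> S \<Longrightarrow> (\<lambda>m. (lamV k x - lamV k (x - (1 / Suc m) *\<^sub>R h)) / (1 / Suc m)) \<longlonglongrightarrow> gV i j k h"
proof -
  have "(\<lambda>m. x - (1 / real (Suc m)) *\<^sub>R h) \<longlonglongrightarrow> x - 0 *\<^sub>R h"
    using LIMSEQ_inverse_real_of_nat by (intro tendsto_intros) (simp add: inverse_eq_divide)
  then have "\<forall>\<^sub>F m in sequentially. x - (1 / real (Suc m)) *\<^sub>R h \<in> interior (convex hull (cell i j))"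
    using x by (intro topological_tendstoD[of _ x]) auto
  then have ev: "\<forall>\<^sub>F m in sequentially. x - (1 / real (Suc m)) *\<^sub>R h \<in> convex hull (cell i j)"
    by (rule eventually_mono) (use interior_subset in blast)
  have xin: "x \<in> convex hull (cell i j)" using x interior_subset by blast
  have eqs: "lamS x - lamS (x - e *\<^sub>R h) = e * gS i h"
    "l \<in> S \<Longrightarrow> lamF l x - lamF l (x - e *\<^sub>R h) = e * (if l = i then gF i j h else 0)"
    "k \<in> S \<Longrightarrow> lamV k x - lamV k (x - e *\<^sub>R h) = e * gV i j k h"
    if y: "x - e *\<^sub>R h \<in> convex hull (cell i j)" for e l k
    using cell_coord_add(1,2)[OF ij(1,2), of "x - e *\<^sub>R h" "e *\<^sub>R h"]
      cell_coord_add(3)[OF ij(1,2), of k "x - e *\<^sub>R h" "e *\<^sub>R h"] linear_cell_grad[OF ij(1,2)]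
    by (auto simp: nodal_on_cell[OF ij xin] nodal_on_cell[OF ij y] linear_scale)
  have lim: "(\<lambda>m. f m / (1 / real (Suc m))) \<longlonglongrightarrow> c" if "\<forall>\<^sub>F m in sequentially. f m = (1 / real (Suc m)) * c" for f :: "nat \<Rightarrow> real" and c
    by (rule tendsto_eventually, rule eventually_mono[OF that]) simp
  show "(\<lambda>m. (lamS x - lamS (x - (1 / Suc m) *\<^sub>R h)) / (1 / Suc m)) \<longlonglongrightarrow> gS i h"
    by (rule lim, rule eventually_mono[OF ev]) (rule eqs)
  show "(\<lambda>m. (lamF l x - lamF l (x - (1 / Suc m) *\<^sub>R h)) / (1 / Suc m)) \<longlonglongrightarrow> (if l = i then gF i j h else 0)" if "l \<in> S"
    by (rule lim, rule eventually_mono[OF ev]) (rule eqs, assumption, rule that)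
  show "(\<lambda>m. (lamV k x - lamV k (x - (1 / Suc m) *\<^sub>R h)) / (1 / Suc m)) \<longlonglongrightarrow> gV i j k h" if "k \<in> S"
    by (rule lim, rule eventually_mono[OF ev]) (rule eqs, assumption, rule that)
qed

text \<open>
  Near a point in the interior of a cell, the difference quotients of the nodal functions are constant and
  add up to the divergence of the cell. This is applied when all cells have the same divergence,
  and when the support of \<open>\<phi>\<close> lies in one cell.
\<close>

lemma weak_divergence_nodal_form:
  assumes t: "test_function U \<phi> \<phi>'" and U: "U \<subseteq> interior (convex hull S)"
    and div: "AE x in lborel. \<phi> x \<noteq> 0 \<longrightarrow>
      (\<exists>i\<in>S. \<exists>j\<in>S. i \<noteq> j \<and> x \<in> interior (convex hull (cell i j)) \<and> cdiv P Q A i j = d)"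
  shows "(LINT x:interior (convex hull S)|lborel. \<phi>' x (proxy (nodal_form P Q A x)))
    = - d * (LINT x|lborel. \<phi> x)"
proof -
  define I :: "(unit + 'a + 'a) set" where "I = {()} <+> (S <+> S)"
  define lam where "lam p = (case p of Inl _ \<Rightarrow> lamS | Inr (Inl i) \<Rightarrow> lamF i | Inr (Inr k) \<Rightarrow> lamV k)" for p :: "unit + 'a + 'a"
  define val where "val p = (case p of Inl _ \<Rightarrow> A | Inr (Inl i) \<Rightarrow> Q i | Inr (Inr k) \<Rightarrow> P k)" for p :: "unit + 'a + 'a"
  have sumI: "(\<Sum>p\<in>I. f p) = f (Inl ()) + (\<Sum>i\<in>S. f (Inr (Inl i))) + (\<Sum>k\<in>S. f (Inr (Inr k)))"
    for f :: "unit + 'a + 'a \<Rightarrow> real"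
    by (simp add: I_def sum.Plus comp_def add.assoc)
  have "lipschitzian (lam p)" if "p \<in> I" for p
    using that lipschitzian_nodal by (auto simp: I_def lam_def)
  then obtain L where L: "\<And>p x y. p \<in> I \<Longrightarrow> \<bar>lam p x - lam p y\<bar> \<le> L * norm (x - y)"
    using lipschitzian_common[of I lam] by (auto simp: I_def)
  obtain K where K: "K \<subseteq> U" "\<And>x h. x \<notin> K \<Longrightarrow> \<phi>' x h = 0" using test_function_support[OF t] by metis
  have "(LINT x:interior (convex hull S)|lborel. \<phi>' x (proxy (nodal_form P Q A x)))
      = (LINT x|lborel. (\<Sum>p\<in>I. lam p x * \<phi>' x (val p)))"
    unfolding set_lebesgue_integral_def
  proof (rule Bochner_Integration.integral_cong[OF refl])
    fix x
    have lin: "linear (\<phi>' x)" by (rule test_functionD(2)[OF t])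
    show "indicator (interior (convex hull S)) x *\<^sub>R \<phi>' x (proxy (nodal_form P Q A x)) = (\<Sum>p\<in>I. lam p x * \<phi>' x (val p))"
    proof (cases "x \<in> interior (convex hull S)")
      case True
      then have "x \<in> convex hull S" using interior_subset by blast
      then show ?thesis using True
        by (simp add: proxy_nodal_form nodal_field_def sumI lam_def val_def linear_add[OF lin] linear_sum[OF lin] linear_scale[OF lin])
    next
      case False
      then have "x \<notin> K" using K U by blast
      then show ?thesis using False K by simp
    qed
  qed
  also have "\<dots> = - d * (LINT x|lborel. \<phi> x)"
  proof (rule integral_by_parts_lipschitz[OF t L])
    show "AE x in lborel. \<phi> x \<noteq> 0 \<longrightarrow>
      (\<lambda>m. \<Sum>p\<in>I. (lam p x - lam p (x - (1 / Suc m) *\<^sub>R val p)) / (1 / Suc m)) \<longlonglongrightarrow> d"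
      using div
    proof eventually_elim
      case (elim x)
      show ?case
      proof
        assume "\<phi> x \<noteq> 0"
        then obtain i j where ij: "i \<in> S" "j \<in> S" "i \<noteq> j" "x \<in> interior (convex hull (cell i j))" "cdiv P Q A i j = d"
          using elim by blast
        have "(\<lambda>m. \<Sum>p\<in>I. (lam p x - lam p (x - (1 / Suc m) *\<^sub>R val p)) / (1 / Suc m))
          \<longlonglongrightarrow> gS i A + (\<Sum>l\<in>S. if l = i then gF i j (Q l) else 0) + (\<Sum>k\<in>S. gV i j k (P k))"
          unfolding sumI using cell_difference_quotient[OF ij(1-4)]
          by (intro tendsto_add tendsto_sum) (auto simp: lam_def val_def)
        then show "(\<lambda>m. \<Sum>p\<in>I. (lam p x - lam p (x - (1 / Suc m) *\<^sub>R val p)) / (1 / Suc m)) \<longlonglongrightarrow> d"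
          using ij by (simp add: cdiv_def)
      qed
    qed
  qed
  finally show ?thesis .
qed

lemma vol_form_C0: "vol_form d \<in> C0_forms n S"
proof -
  have "continuous_on (convex hull S) (\<lambda>x. vol_form d x vs)" for vs
    by (rule continuous_on_eq[of _ "\<lambda>_. (d *\<^sub>R vol) vs"]) auto
  then show ?thesis
    by (auto simp: C0_forms_def subspace_0[OF subspace_Alt] intro!: subspace_scale[OF subspace_Alt] vol_Alt)
qed

lemma nodal_form_C0: "nodal_form P Q A \<in> C0_forms (n - 1) S"
  using nodal_form_C0P1 by (simp add: C0P1_forms_def)

lemma const_div_ext_deriv:
  assumes d: "const_div P Q A d"
  shows "has_ext_deriv (n - 1) S (nodal_form P Q A) (vol_form d)"
  unfolding has_ext_deriv_iff[OF nodal_form_C0 vol_form_C0]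
proof (intro allI impI)
  let ?U = "interior (convex hull S)"
  fix \<phi> \<phi>' assume t: "test_function ?U \<phi> \<phi>'"
  obtain K where K: "K \<subseteq> ?U" "\<And>x. x \<notin> K \<Longrightarrow> \<phi> x = 0" using test_function_support[OF t] by metis
  have "(LINT x:?U|lborel. vol_form d x frame * \<phi> x) = (LINT x|lborel. d * \<phi> x)"
    unfolding set_lebesgue_integral_def
  proof (rule Bochner_Integration.integral_cong[OF refl])
    fix x
    have "x \<in> ?U \<Longrightarrow> x \<in> convex hull S" "x \<notin> ?U \<Longrightarrow> \<phi> x = 0" using interior_subset K by blast+
    then show "indicator ?U x *\<^sub>R (vol_form d x frame * \<phi> x) = d * \<phi> x"
      by (auto simp: indicator_def scaleR_fun_def vol_frame)
  qed
  moreover have "(LINT x:?U|lborel. \<phi>' x (proxy (nodal_form P Q A x))) = - d * (LINT x|lborel. \<phi> x)"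
  proof (rule weak_divergence_nodal_form[OF t order.refl])
    show "AE x in lborel. \<phi> x \<noteq> 0 \<longrightarrow>
      (\<exists>i\<in>S. \<exists>j\<in>S. i \<noteq> j \<and> x \<in> interior (convex hull (cell i j)) \<and> cdiv P Q A i j = d)"
      using AE_interior_cell
    proof eventually_elim
      case (elim x)
      have "\<phi> x \<noteq> 0 \<Longrightarrow> x \<in> convex hull S" using K interior_subset by blast
      then show ?case using elim d by blast
    qed
  qed
  ultimately show "(LINT x:?U|lborel. vol_form d x frame * \<phi> x) = - (LINT x:?U|lborel. \<phi>' x (proxy (nodal_form P Q A x)))"
    by simp
qed

text \<open>
  A bump function supported in a cell singles out the divergence of this cell.
\<close>

lemma ext_deriv_0_const_div:
  assumes "has_ext_deriv (n - 1) S (nodal_form P Q A) 0" shows "const_div P Q A 0"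
proof (intro ballI impI)
  let ?U = "interior (convex hull S)"
  fix i j assume ij: "i \<in> S" "j \<in> S" "i \<noteq> j"
  have 0: "vol_form 0 = 0" by (auto simp: fun_eq_iff)
  obtain x0 where x0: "x0 \<in> interior (convex hull (cell i j))" using interior_cell_nonempty[OF ij] by blast
  obtain \<phi> \<phi>' where t: "test_function (interior (convex hull (cell i j))) \<phi> \<phi>'" and pos: "0 < (LINT x|lborel. \<phi> x)"
    using exists_bump[OF open_interior x0] by blast
  have sub: "interior (convex hull (cell i j)) \<subseteq> ?U" by (intro interior_mono cell_subset_hull ij)
  then have t': "test_function ?U \<phi> \<phi>'" using t unfolding test_function_def by blast
  have "has_ext_deriv (n - 1) S (nodal_form P Q A) (vol_form 0)" using assms by (subst 0)
  then have "(LINT x:?U|lborel. vol_form 0 x frame * \<phi> x) = - (LINT x:?U|lborel. \<phi>' x (proxy (nodal_form P Q A x)))"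
    using t' unfolding has_ext_deriv_iff[OF nodal_form_C0 vol_form_C0] by blast
  moreover have "vol_form 0 x frame = 0" for x by simp
  ultimately have "(LINT x:?U|lborel. \<phi>' x (proxy (nodal_form P Q A x))) = 0"
    by (simp only: set_lebesgue_integral_def) simp
  moreover have "(LINT x:?U|lborel. \<phi>' x (proxy (nodal_form P Q A x))) = - cdiv P Q A i j * (LINT x|lborel. \<phi> x)"
  proof (rule weak_divergence_nodal_form[OF t sub])
    obtain K where "K \<subseteq> interior (convex hull (cell i j))" "\<And>x. x \<notin> K \<Longrightarrow> \<phi> x = 0" using test_function_support[OF t] by metis
    then show "AE x in lborel. \<phi> x \<noteq> 0 \<longrightarrow>
      (\<exists>i'\<in>S. \<exists>j'\<in>S. i' \<noteq> j' \<and> x \<in> interior (convex hull (cell i' j')) \<and> cdiv P Q A i' j' = cdiv P Q A i j)"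
      using ij by (intro AE_I2) blast
  qed
  ultimately show "cdiv P Q A i j = 0" using pos by simp
qed

subsection \<open>The Poincare operator on constant forms\<close>

abbreviation radial :: "real \<Rightarrow> 'a \<Rightarrow> 'a" where "radial d y \<equiv> (d / n) *\<^sub>R (y - W S)"

text \<open>
  Along the segment from \<open>W S\<close> to \<open>x\<close> only the power of \<open>t\<close> varies, and its integral is \<open>1 / n\<close>. The affine
  field that remains is reproduced by the nodal functions.
\<close>

lemma poincare_const:
  assumes a: "a \<in> Alt n"
  shows "poincare n S W (\<lambda>x. if x \<in> convex hull S then a else 0)
    = nodal_form (radial (a frame)) (\<lambda>i. radial (a frame) (W (S - {i}))) (radial (a frame) (W S))" (is "?l = ?r")
proof (intro ext)
  fix x vs
  have WS: "W S \<in> convex hull S" using wS_pos by (auto simp: hull_iff wS_def intro: less_imp_le)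
  show "?l x vs = ?r x vs"
  proof (cases "x \<in> convex hull S")
    case True
    then obtain i j where ij: "i \<in> S" "j \<in> S" "i \<noteq> j" and x: "x \<in> convex hull (cell i j)"
      using cells_cover by blast
    have seg: "W S + t *\<^sub>R (x - W S) \<in> convex hull S" if "t \<in> {0..1}" for t
    proof -
      have "(1 - t) *\<^sub>R W S + t *\<^sub>R x \<in> convex hull S"
        using that WS True by (intro convexD[OF convex_convex_hull]) auto
      then show ?thesis by (simp add: algebra_simps)
    qed
    have "?l x vs = integral {0..1} (\<lambda>t. t ^ (n - 1)
        * (if W S + t *\<^sub>R (x - W S) \<in> convex hull S then a else 0) ((x - W S) # vs))"
      using True by (simp add: poincare_def)
    also have "\<dots> = integral {0..1} (\<lambda>t::real. t ^ (n - 1) * a ((x - W S) # vs))"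
      by (rule Henstock_Kurzweil_Integration.integral_cong) (simp add: seg)
    also have "\<dots> = integral {0..1} (\<lambda>t::real. t ^ (n - 1)) * a ((x - W S) # vs)"
      by simp
    also have "integral {0..1} (\<lambda>t::real. t ^ (n - 1)) = 1 / n"
    proof (rule integral_unique)
      have "((\<lambda>t::real. t ^ (n - 1)) has_integral (1 ^ n / n - 0 ^ n / n)) {0..1}"
      proof (rule fundamental_theorem_of_calculus)
        fix t :: real
        have "((\<lambda>t. t ^ n / n) has_real_derivative t ^ (n - 1)) (at t within {0..1})"
          using n2 by (auto intro!: derivative_eq_intros)
        then show "((\<lambda>t. t ^ n / n) has_vector_derivative t ^ (n - 1)) (at t within {0..1})"
          by (simp only: has_real_derivative_iff_has_vector_derivative)
      qed simp
      then show "((\<lambda>t::real. t ^ (n - 1)) has_integral 1 / n) {0..1}" using n2 by (simp add: power_0_left)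
    qed
    also have "1 / n * a ((x - W S) # vs) = contract (radial (a frame) x) vs"
      using Alt_n_multiple[OF a, of "(x - W S) # vs"] by (simp add: contract_def linear_scale[OF contract_linear, unfolded contract_def])
    also have "radial (a frame) x = nodal_field (radial (a frame)) (\<lambda>i. radial (a frame) (W (S - {i}))) (radial (a frame) (W S)) x"
    proof -
      let ?c = "a frame / n"
      have F: "(\<Sum>l\<in>S. lamF l x *\<^sub>R q l) = cF i j x *\<^sub>R q i" for q :: "'a \<Rightarrow> 'a"
      proof -
        have "(\<Sum>l\<in>S. lamF l x *\<^sub>R q l) = (\<Sum>l\<in>S. if l = i then cF i j x *\<^sub>R q i else 0)"
          by (intro sum.cong) (auto simp: nodal_on_cell(2)[OF ij x])
        then show ?thesis using ij by simp
      qed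
      have "radial (a frame) x = ?c *\<^sub>R ((cS i x *\<^sub>R W S + cF i j x *\<^sub>R W (S - {i}) + (\<Sum>k\<in>S. cV i j k x *\<^sub>R k))
          - (cS i x + cF i j x + (\<Sum>k\<in>S. cV i j k x)) *\<^sub>R W S)"
        by (simp only: cell_coord_sum[OF ij] scaleR_one)
      also have "\<dots> = cS i x *\<^sub>R radial (a frame) (W S) + cF i j x *\<^sub>R radial (a frame) (W (S - {i}))
          + (\<Sum>k\<in>S. cV i j k x *\<^sub>R radial (a frame) k)"
        by (simp add: algebra_simps scaleR_sum_left scaleR_sum_right sum_subtractf sum.distrib)
      finally show ?thesis
        unfolding nodal_field_def F by (simp add: nodal_on_cell(1,3)[OF ij x] cong: sum.cong)
    qed
    finally show ?thesis using True by (simp add: nodal_form_def)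
  next
    case False
    then show ?thesis by (simp add: poincare_def nodal_form_def)
  qed
qed

text \<open>
  The inpoint of the facet and the \<open>n - 1\<close> vertices of the cell each contribute \<open>d / n\<close>, and \<open>W S\<close>, where
  the field vanishes, contributes nothing.
\<close>

lemma const_div_radial:
  "const_div (radial d) (\<lambda>i. radial d (W (S - {i}))) (radial d (W S)) d"
proof (intro ballI impI)
  fix i j assume ij: "i \<in> S" "j \<in> S" "i \<noteq> j"
  note lin = linear_cell_grad[OF ij(1,2)]
  have b: "bary k (W S) = wS k" "bary k (W (S - {i})) = wF i k" for k by (simp_all add: wS_def wF_def)
  have w: "wS i > 0" "wF i j > 0" "wF i i = 0" using wS_pos wF_pos wF_0 ij by auto
  have F: "gF i j (y - W S) = cF i j y - cF i j (W S)" for y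
    using cell_coord_add(2)[OF ij(1,2), of "W S" "y - W S"] by simp
  have V: "gV i j k (y - W S) = cV i j k y - cV i j k (W S)" if "k \<in> S" for k y
    using cell_coord_add(3)[OF ij(1,2) that, of "W S" "y - W S"] by simp
  have W0: "cF i j (W S) = 0" "cV i j k (W S) = 0" for k using w by (simp_all add: cF_def cV_def cS_def b)
  have "cF i j (W (S - {i})) = 1" using w by (simp add: cF_def cS_def b)
  moreover have "cV i j k k = (if k = i \<or> k = j then 0 else 1)" if "k \<in> S" for k
  proof (cases "k = i \<or> k = j")
    case True
    then show ?thesis using cell_coord_ij[OF ij] by auto
  next
    case False
    then show ?thesis using that ij by (simp add: cV_def cS_def cF_def bary_vertex)
  qed
  then have "(\<Sum>k\<in>S. cV i j k k) = (\<Sum>k\<in>S - {i, j}. 1)"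
    by (intro sum.mono_neutral_cong_right) auto
  then have "(\<Sum>k\<in>S. cV i j k k) = real n - 1"
    using card_S ij n2 by (simp add: card_Diff_subset)
  moreover have "(\<Sum>k\<in>S. gV i j k (radial d k)) = (\<Sum>k\<in>S. (d / n) * cV i j k k)"
    by (intro sum.cong refl) (simp add: linear_scale[OF lin(3)] V W0)
  then have "(\<Sum>k\<in>S. gV i j k (radial d k)) = (d / n) * (\<Sum>k\<in>S. cV i j k k)"
    by (simp only: sum_distrib_left)
  ultimately have "cdiv (radial d) (\<lambda>i. radial d (W (S - {i}))) (radial d (W S)) i j = (d / n) * 1 + (d / n) * (real n - 1)"
    by (simp add: cdiv_def linear_scale[OF lin(2)] linear_0[OF lin(1)] F W0)
  also have "\<dots> = (d / n) * n" by (simp only: distrib_left[symmetric]) simp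
  finally show "cdiv (radial d) (\<lambda>i. radial d (W (S - {i}))) (radial d (W S)) i j = d" using n2 by simp
qed

lemma nodal_field_combine:
  "nodal_field (\<lambda>k. a *\<^sub>R P k + b *\<^sub>R P' k) (\<lambda>k. a *\<^sub>R Q k + b *\<^sub>R Q' k) (a *\<^sub>R A + b *\<^sub>R A') x
    = a *\<^sub>R nodal_field P Q A x + b *\<^sub>R nodal_field P' Q' A' x"
  by (simp add: nodal_field_def sum.distrib scaleR_sum_right algebra_simps)

lemma nodal_form_combine:
  "nodal_form (\<lambda>k. a *\<^sub>R P k + b *\<^sub>R P' k) (\<lambda>k. a *\<^sub>R Q k + b *\<^sub>R Q' k) (a *\<^sub>R A + b *\<^sub>R A')
    = a *\<^sub>R nodal_form P Q A + b *\<^sub>R nodal_form P' Q' A'"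
  by (auto simp: nodal_form_def fun_eq_iff scaleR_fun_def nodal_field_combine linear_add[OF contract_linear]
      linear_scale[OF contract_linear])

lemma cdiv_combine:
  assumes "i \<in> S" "j \<in> S"
  shows "cdiv (\<lambda>k. a *\<^sub>R P k + b *\<^sub>R P' k) (\<lambda>k. a *\<^sub>R Q k + b *\<^sub>R Q' k) (a *\<^sub>R A + b *\<^sub>R A') i j
    = a * cdiv P Q A i j + b * cdiv P' Q' A' i j"
proof -
  note lin = linear_cell_grad[OF assms]
  show ?thesis
    by (simp add: cdiv_def linear_add[OF lin(1)] linear_add[OF lin(2)] linear_add[OF lin(3)]
        linear_scale[OF lin(1)] linear_scale[OF lin(2)] linear_scale[OF lin(3)] sum.distrib
        sum_distrib_left algebra_simps)
qed

lemma K_space_iff: "u \<in> K_space (n - 1) S W \<longleftrightarrow> (\<exists>P Q A. u = nodal_form P Q A \<and> const_div P Q A 0)"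
proof
  assume "u \<in> K_space (n - 1) S W"
  then have u: "u \<in> C0P1_forms (n - 1) S (refinement (n - 1 - 1) W S)" "has_ext_deriv (n - 1) S u 0"
    by (simp_all add: K_space_def)
  then show "\<exists>P Q A. u = nodal_form P Q A \<and> const_div P Q A 0"
    using C0P1_nodal_form[OF u(1)] ext_deriv_0_const_div by metis
next
  assume "\<exists>P Q A. u = nodal_form P Q A \<and> const_div P Q A 0"
  then obtain P Q A where u: "u = nodal_form P Q A" "const_div P Q A 0" by blast
  have "vol_form 0 = 0" by (auto simp: fun_eq_iff)
  then show "u \<in> K_space (n - 1) S W"
    using nodal_form_C0P1 const_div_ext_deriv[OF u(2)] by (simp add: K_space_def u(1))
qed

lemma poincare_image:
  "poincare n S W ` const_forms n S
    = range (\<lambda>d. nodal_form (radial d) (\<lambda>i. radial d (W (S - {i}))) (radial d (W S)))" (is "?l = range ?p")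
proof
  show "?l \<subseteq> range ?p" by (auto simp: const_forms_def poincare_const)
  show "range ?p \<subseteq> ?l"
  proof
    fix y assume "y \<in> range ?p"
    then obtain d where d: "y = ?p d" by blast
    have a: "d *\<^sub>R vol \<in> Alt n" by (intro subspace_scale[OF subspace_Alt] vol_Alt)
    have "(d *\<^sub>R vol) frame = d" by (simp add: scaleR_fun_def vol_frame)
    then have "y = poincare n S W (vol_form d)" using poincare_const[OF a] d by simp
    moreover have "vol_form d \<in> const_forms n S" using a by (auto simp: const_forms_def)
    ultimately show "y \<in> ?l" by blast
  qed
qed

text \<open>
  The radial fields change the divergence by an arbitrary constant.
\<close>

lemma A_vec_iff: "u \<in> A_vec n S W \<longleftrightarrow> (\<exists>P Q A d. u = nodal_form P Q A \<and> const_div P Q A d)"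
proof
  assume "u \<in> A_vec n S W"
  then obtain P Q A d where u: "u = nodal_form P Q A
        + nodal_form (radial d) (\<lambda>i. radial d (W (S - {i}))) (radial d (W S))" and 0: "const_div P Q A 0"
    unfolding A_vec_def K_space_iff poincare_image by blast
  show "\<exists>P Q A d. u = nodal_form P Q A \<and> const_div P Q A d"
  proof (intro exI conjI)
    show "u = nodal_form (\<lambda>k. 1 *\<^sub>R P k + 1 *\<^sub>R radial d k)
        (\<lambda>i. 1 *\<^sub>R Q i + 1 *\<^sub>R radial d (W (S - {i}))) (1 *\<^sub>R A + 1 *\<^sub>R radial d (W S))"
      unfolding nodal_form_combine u by simp
    show "const_div (\<lambda>k. 1 *\<^sub>R P k + 1 *\<^sub>R radial d k)
        (\<lambda>i. 1 *\<^sub>R Q i + 1 *\<^sub>R radial d (W (S - {i}))) (1 *\<^sub>R A + 1 *\<^sub>R radial d (W S)) d"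
    proof (intro ballI impI)
      fix i j assume ij: "i \<in> S" "j \<in> S" "i \<noteq> j"
      then have "cdiv P Q A i j = 0"
        "cdiv (radial d) (\<lambda>i. radial d (W (S - {i}))) (radial d (W S)) i j = d"
        using 0 const_div_radial by blast+
      then show "cdiv (\<lambda>k. 1 *\<^sub>R P k + 1 *\<^sub>R radial d k)
        (\<lambda>i. 1 *\<^sub>R Q i + 1 *\<^sub>R radial d (W (S - {i}))) (1 *\<^sub>R A + 1 *\<^sub>R radial d (W S)) i j = d"
        by (simp only: cdiv_combine[OF ij(1,2)])
    qed
  qed
next
  assume "\<exists>P Q A d. u = nodal_form P Q A \<and> const_div P Q A d"
  then obtain P Q A d where u: "u = nodal_form P Q A" and d: "const_div P Q A d" by blast
  let ?b = "nodal_form (radial d) (\<lambda>i. radial d (W (S - {i}))) (radial d (W S))"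
  let ?P = "\<lambda>k. 1 *\<^sub>R P k + (- 1) *\<^sub>R radial d k" and ?Q = "\<lambda>i. 1 *\<^sub>R Q i + (- 1) *\<^sub>R radial d (W (S - {i}))"
    and ?A = "1 *\<^sub>R A + (- 1) *\<^sub>R radial d (W S)"
  have "nodal_form ?P ?Q ?A \<in> K_space (n - 1) S W"
    unfolding K_space_iff
  proof (intro exI conjI)
    show "const_div ?P ?Q ?A 0"
    proof (intro ballI impI)
      fix i j assume ij: "i \<in> S" "j \<in> S" "i \<noteq> j"
      then have "cdiv P Q A i j = d"
        "cdiv (radial d) (\<lambda>i. radial d (W (S - {i}))) (radial d (W S)) i j = d"
        using d const_div_radial by blast+
      then show "cdiv ?P ?Q ?A i j = 0"
        by (simp only: cdiv_combine[OF ij(1,2)])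
    qed
  qed (rule refl)
  moreover have "?b \<in> poincare n S W ` const_forms n S" unfolding poincare_image by blast
  moreover have "u = nodal_form ?P ?Q ?A + ?b" unfolding nodal_form_combine u by simp
  ultimately show "u \<in> A_vec n S W" unfolding A_vec_def by blast
qed

end

section \<open>Integrals over faces\<close>

definition std_simplex :: "nat \<Rightarrow> (nat \<Rightarrow> real) set" where
  "std_simplex k = {t. (\<forall>i<k. 0 \<le> t i) \<and> (\<Sum>i<k. t i) \<le> 1}"

definition chart :: "'a::real_vector list \<Rightarrow> (nat \<Rightarrow> real) \<Rightarrow> 'a" where
  "chart ps t = ps ! 0 + (\<Sum>i<length ps - 1. t i *\<^sub>R (ps ! Suc i - ps ! 0))"

lemma integral_simplex_alt:
  "integral_simplex ps u =
    (LINT t:std_simplex (length ps - 1)|Pi\<^sub>M {..<length ps - 1} (\<lambda>_. lborel). u (chart ps t) (edges ps))"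
  by (simp add: integral_simplex_def std_simplex_def chart_def Let_def)

lemma std_simplex_sets: "std_simplex k \<inter> space (Pi\<^sub>M {..<k} (\<lambda>_. lborel)) \<in> sets (Pi\<^sub>M {..<k} (\<lambda>_. lborel))"
proof -
  have "{t \<in> space (Pi\<^sub>M {..<k} (\<lambda>_. lborel :: real measure)). (\<forall>i\<in>{..<k}. 0 \<le> t i) \<and> (\<Sum>i<k. t i) \<le> 1}
      \<in> sets (Pi\<^sub>M {..<k} (\<lambda>_. lborel))"
    by measurable
  then show ?thesis by (simp add: std_simplex_def Int_def conj_commute)
qed

lemma measurable_indicator_std_simplex [measurable]:
  "(indicator (std_simplex k) :: _ \<Rightarrow> real) \<in> borel_measurable (Pi\<^sub>M {..<k} (\<lambda>_. lborel))"
  using std_simplex_sets[of k] borel_measurable_indicator_iff by blast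

lemma std_simplex_bounds:
  assumes "t \<in> std_simplex k" "i < k" shows "\<bar>t i\<bar> \<le> 1"
proof -
  have "t i \<le> (\<Sum>i<k. t i)" using assms by (intro member_le_sum) (auto simp: std_simplex_def)
  then show ?thesis using assms by (auto simp: std_simplex_def)
qed

lemma chart_measurable [measurable]:
  fixes ps :: "'a::euclidean_space list"
  assumes "k = length ps - 1"
  shows "chart ps \<in> measurable (Pi\<^sub>M {..<k} (\<lambda>_. lborel)) borel"
  unfolding chart_def[abs_def] assms by measurable

text \<open>
  Otherwise the cube of side \<open>1 / k\<close> would be a null set.
\<close>

lemma std_simplex_box:
  assumes "0 < (k::nat)" shows "\<not> (AE t in Pi\<^sub>M {..<k} (\<lambda>_. lborel :: real measure). \<not> ((\<forall>i<k. 0 < t i) \<and> (\<Sum>i<k. t i) < 1))"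
proof
  let ?P = "Pi\<^sub>M {..<k} (\<lambda>_. lborel :: real measure)"
  let ?B = "Pi\<^sub>E {..<k} (\<lambda>_. {0<..<1 / real k})"
  assume ae: "AE t in ?P. \<not> ((\<forall>i<k. 0 < t i) \<and> (\<Sum>i<k. t i) < 1)"
  have B: "?B \<in> sets ?P" by (rule sets_PiM_I_finite) auto
  have lt: "(\<Sum>i<k. t i) < 1" if "t \<in> ?B" for t
  proof -
    have "(\<Sum>i<k. t i) < (\<Sum>i<k. 1 / real k)" using that assms by (intro sum_strict_mono) (auto simp: PiE_iff)
    then show ?thesis using assms by simp
  qed
  have "AE t in ?P. t \<notin> ?B"
    using ae
  proof eventually_elim
    case (elim t)
    then show ?case using lt[of t] by (auto simp: PiE_iff)
  qed
  then have "emeasure ?P ?B = 0" using AE_iff_measurable[OF B, of "\<lambda>t. t \<notin> ?B"] sets.sets_into_space[OF B] by auto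
  moreover have "emeasure ?P ?B = (\<Prod>i<k. emeasure lborel {0<..<1 / real k})"
    by (rule lborel_product.emeasure_PiM) auto
  ultimately show False using assms by simp
qed

lemma integral_std_simplex_pos:
  fixes f :: "(nat \<Rightarrow> real) \<Rightarrow> real"
  assumes k: "0 < k" and int: "set_integrable (Pi\<^sub>M {..<k} (\<lambda>_. lborel)) (std_simplex k) f"
    and nonneg: "\<And>t. t \<in> std_simplex k \<Longrightarrow> 0 \<le> f t"
    and pos: "\<And>t. (\<forall>i<k. 0 < t i) \<Longrightarrow> (\<Sum>i<k. t i) < 1 \<Longrightarrow> 0 < f t"
  shows "0 < (LINT t:std_simplex k|Pi\<^sub>M {..<k} (\<lambda>_. lborel). f t)"
proof -
  let ?P = "Pi\<^sub>M {..<k} (\<lambda>_. lborel :: real measure)" and ?g = "\<lambda>t. indicator (std_simplex k) t *\<^sub>R f t"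
  have g0: "0 \<le> ?g t" for t using nonneg[of t] by (auto simp: indicator_def)
  have "integral\<^sup>L ?P ?g \<noteq> 0"
  proof
    assume "integral\<^sup>L ?P ?g = 0"
    then have "AE t in ?P. ?g t = 0"
      using integral_nonneg_eq_0_iff_AE[OF int[unfolded set_integrable_def]] g0 by simp
    then have "AE t in ?P. \<not> ((\<forall>i<k. 0 < t i) \<and> (\<Sum>i<k. t i) < 1)"
    proof eventually_elim
      case (elim t)
      show ?case
      proof
        assume t: "(\<forall>i<k. 0 < t i) \<and> (\<Sum>i<k. t i) < 1"
        then have "t \<in> std_simplex k" by (auto simp: std_simplex_def intro: less_imp_le)
        then show False using elim pos[of t] t by simp
      qed
    qed
    then show False using std_simplex_box[OF k] by blast
  qed
  moreover have "0 \<le> integral\<^sup>L ?P ?g" using g0 by (intro Bochner_Integration.integral_nonneg) simp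
  ultimately show ?thesis by (simp add: set_lebesgue_integral_def)
qed

context full_simplex
begin

lemma chart_in_hull:
  assumes ps: "ps \<noteq> []" "set ps \<subseteq> S" and t: "t \<in> std_simplex (length ps - 1)"
  shows "chart ps t \<in> convex hull S"
proof -
  let ?k = "length ps - 1"
  have mem: "ps ! i \<in> convex hull S" if "i \<le> ?k" for i
    using that ps nth_mem[of i ps] by (intro hull_inc) (cases ps; auto)
  have "chart ps t = (1 - (\<Sum>i<?k. t i)) *\<^sub>R ps ! 0 + (\<Sum>i<?k. t i *\<^sub>R ps ! Suc i)"
    by (simp add: chart_def scaleR_diff_right sum_subtractf scaleR_diff_left scaleR_sum_left)
  also have "\<dots> = (\<Sum>i<Suc ?k. (case i of 0 \<Rightarrow> 1 - (\<Sum>i<?k. t i) | Suc i \<Rightarrow> t i) *\<^sub>R ps ! i)"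
    by (simp only: sum.lessThan_Suc_shift) simp
  also have "\<dots> \<in> convex hull S"
  proof (rule convex_sum)
    show "(\<Sum>i<Suc ?k. (case i of 0 \<Rightarrow> 1 - (\<Sum>i<?k. t i) | Suc i \<Rightarrow> t i)) = 1"
      by (simp only: sum.lessThan_Suc_shift) simp
    show "0 \<le> (case i of 0 \<Rightarrow> 1 - (\<Sum>i<?k. t i) | Suc i \<Rightarrow> t i)" if "i \<in> {..<Suc ?k}" for i
      using that t by (cases i) (auto simp: std_simplex_def)
    show "ps ! i \<in> convex hull S" if "i \<in> {..<Suc ?k}" for i
      using that by (intro mem) simp
  qed auto
  finally show ?thesis .
qed

lemma measurable_on_hull:
  fixes f :: "'a \<Rightarrow> real"
  assumes "continuous_on (convex hull S) f"
  shows "(\<lambda>x. if x \<in> convex hull S then f x else 0) \<in> borel_measurable borel"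
  using assms compact_hull
  by (intro borel_measurable_continuous_on_if) (auto intro: borel_compact continuous_on_const)

lemma bounded_on_hull:
  fixes f :: "'a \<Rightarrow> real"
  assumes "continuous_on (convex hull S) f"
  obtains C where "\<And>x. x \<in> convex hull S \<Longrightarrow> \<bar>f x\<bar> \<le> C"
proof -
  obtain C where "\<forall>y\<in>f ` (convex hull S). norm y \<le> C"
    using compact_imp_bounded[OF compact_continuous_image[OF assms compact_hull]]
    unfolding bounded_iff by blast
  then show thesis by (intro that) auto
qed

lemma set_integrable_chart:
  fixes f :: "'a \<Rightarrow> real"
  assumes ps: "ps \<noteq> []" "set ps \<subseteq> S" and f: "continuous_on (convex hull S) f" and k: "k = length ps - 1"
  shows "set_integrable (Pi\<^sub>M {..<k} (\<lambda>_. lborel)) (std_simplex k) (\<lambda>t. f (chart ps t))"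
proof -
  obtain C where C: "\<And>x. x \<in> convex hull S \<Longrightarrow> \<bar>f x\<bar> \<le> C" using bounded_on_hull[OF f] by blast
  let ?g = "\<lambda>x. if x \<in> convex hull S then f x else 0"
  have [measurable]: "?g \<in> borel_measurable borel" by (rule measurable_on_hull[OF f])
  have [measurable]: "chart ps \<in> measurable (Pi\<^sub>M {..<k} (\<lambda>_. lborel)) borel" by (rule chart_measurable[OF k])
  have "(\<lambda>t. indicator (std_simplex k) t * ?g (chart ps t)) \<in> borel_measurable (Pi\<^sub>M {..<k} (\<lambda>_. lborel))"
    by measurable
  also have "(\<lambda>t. indicator (std_simplex k) t * ?g (chart ps t)) = (\<lambda>t. indicator (std_simplex k) t *\<^sub>R f (chart ps t))"
    using chart_in_hull[OF ps] k by (auto simp: indicator_def fun_eq_iff)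
  finally have meas: "(\<lambda>t. indicator (std_simplex k) t *\<^sub>R f (chart ps t)) \<in> borel_measurable (Pi\<^sub>M {..<k} (\<lambda>_. lborel))" .
  show ?thesis
    unfolding set_integrable_def
  proof (rule integrable_PiM_bounded_support[OF meas])
    show "\<bar>indicator (std_simplex k) t *\<^sub>R f (chart ps t)\<bar> \<le> max 0 C" for t
      using C[OF chart_in_hull[OF ps]] k by (auto simp: indicator_def le_max_iff_disj)
    show "\<bar>t i\<bar> \<le> 1" if "indicator (std_simplex k) t *\<^sub>R f (chart ps t) \<noteq> 0" "i < k" for t i
      using that std_simplex_bounds by (auto simp: indicator_def split: if_splits)
  qed
qed

lemma integral_simplex_combine:
  assumes ps: "ps \<noteq> []" "set ps \<subseteq> S" and u: "u \<in> C0_forms k S" and v: "v \<in> C0_forms k S"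
  shows "integral_simplex ps (a *\<^sub>R u + b *\<^sub>R v) = a * integral_simplex ps u + b * integral_simplex ps v"
proof -
  note int = set_integrable_chart[OF ps C0_formsD(3)[OF u] refl, of "edges ps"]
    set_integrable_chart[OF ps C0_formsD(3)[OF v] refl, of "edges ps"]
  have "integral_simplex ps (a *\<^sub>R u + b *\<^sub>R v)
      = (LINT t:std_simplex (length ps - 1)|Pi\<^sub>M {..<length ps - 1} (\<lambda>_. lborel).
          a * u (chart ps t) (edges ps) + b * v (chart ps t) (edges ps))"
    by (simp add: integral_simplex_alt scaleR_fun_def)
  also have "\<dots> = a * integral_simplex ps u + b * integral_simplex ps v"
    unfolding integral_simplex_alt using int by (subst set_integral_add(2)) simp_all
  finally show ?thesis .
qed

lemma bary_chart:
  assumes ps: "distinct ps" "set ps = S"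
  shows "i < n \<Longrightarrow> bary (ps ! Suc i) (chart ps t) = t i" "bary (ps ! 0) (chart ps t) = 1 - (\<Sum>i<n. t i)"
proof -
  note d = edges_dual[OF ps]
  have e: "edges ps ! j = ps ! Suc j - ps ! 0" if "j < n" for j
    using that d(1) by (simp add: nth_tl)
  have inj: "ps ! i = ps ! j \<longleftrightarrow> i = j" if "i \<le> n" "j \<le> n" for i j
    using that d(1) ps(1) by (simp add: nth_eq_iff_index_eq)
  have c: "chart ps t = ps ! 0 + (\<Sum>i<n. t i *\<^sub>R edges ps ! i)"
    unfolding chart_def using d(1) by (intro arg_cong2[where f = "(+)"] sum.cong) (auto simp: nth_tl)
  have expand: "bary v (chart ps t) = bary v (ps ! 0) + (\<Sum>j<n. t j * grad v (edges ps ! j))" if "v \<in> S" for v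
    unfolding c using that by (simp add: bary_add linear_sum[OF linear_grad] linear_scale[OF linear_grad])
  show "bary (ps ! Suc i) (chart ps t) = t i" if "i < n"
    using that d(5)[of "Suc i"] d(5)[of 0] inj[of 0 "Suc i"]
    by (subst expand) (auto simp: bary_vertex d(3) mult_delta_right)
  have "grad (ps ! 0) (edges ps ! j) = - 1" if "j < n" for j
    using that d(5)[of "Suc j"] d(5)[of 0] inj[of 0 "Suc j"] by (simp add: e grad_diff bary_vertex)
  then show "bary (ps ! 0) (chart ps t) = 1 - (\<Sum>i<n. t i)"
    using d(5)[of 0] by (subst expand) (auto simp: bary_vertex sum_negf)
qed

lemma facet_list:
  assumes v: "v \<in> S" and ps: "distinct ps" "set ps = S - {v}"
  shows "length ps = n" "ps \<noteq> []" "distinct (ps @ [v])" "set (ps @ [v]) = S" "set ps \<subseteq> S"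
proof -
  show "length ps = n" using distinct_card[OF ps(1)] ps(2) card_S v by simp
  then show "ps \<noteq> []" using n2 by auto
qed (use assms in auto)

lemma chart_facet:
  assumes v: "v \<in> S" and ps: "distinct ps" "set ps = S - {v}"
  shows "chart ps t = chart (ps @ [v]) (t(n - 1 := 0))"
proof -
  note fls = facet_list[OF assms]
  have "n = Suc (n - 1)" using n2 by simp
  then have split: "(\<Sum>i<n. f i) = (\<Sum>i<n - 1. f i) + f (n - 1)" for f :: "nat \<Rightarrow> 'a"
    by (metis sum.lessThan_Suc)
  have "(\<Sum>i<n. (t(n - 1 := 0)) i *\<^sub>R ((ps @ [v]) ! Suc i - (ps @ [v]) ! 0))
      = (\<Sum>i<n - 1. (t(n - 1 := 0)) i *\<^sub>R ((ps @ [v]) ! Suc i - (ps @ [v]) ! 0))"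
    unfolding split by simp
  also have "\<dots> = (\<Sum>i<n - 1. t i *\<^sub>R (ps ! Suc i - ps ! 0))"
    using fls(1,2) by (intro sum.cong) (auto simp: nth_append)
  finally show ?thesis using fls n2 by (simp add: chart_def nth_append)
qed

lemma bary_chart_facet:
  assumes v: "v \<in> S" and ps: "distinct ps" "set ps = S - {v}"
  shows "bary v (chart ps t) = 0"
    "i < n - 1 \<Longrightarrow> bary (ps ! Suc i) (chart ps t) = t i"
    "bary (ps ! 0) (chart ps t) = 1 - (\<Sum>i<n - 1. t i)"
proof -
  note fls = facet_list[OF assms] and b = bary_chart[OF facet_list(3,4)[OF assms]]
  have n1: "n = Suc (n - 1)" using n2 by simp
  show "bary v (chart ps t) = 0"
    using b(1)[of "n - 1" "t(n - 1 := 0)"] fls(1) n1 by (simp add: chart_facet[OF assms] nth_append)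
  show "bary (ps ! Suc i) (chart ps t) = t i" if "i < n - 1"
  proof -
    have "i < n" "Suc i < n" using that by simp_all
    then show ?thesis
      using b(1)[of i "t(n - 1 := 0)"] fls(1) that by (simp add: chart_facet[OF assms] nth_append)
  qed
  have "(\<Sum>i<n. (t(n - 1 := 0)) i) = (\<Sum>i<n - 1. (t(n - 1 := 0)) i) + (t(n - 1 := 0)) (n - 1)"
    using sum.lessThan_Suc[of "t(n - 1 := 0)" "n - 1"] n1 by simp
  also have "\<dots> = (\<Sum>i<n - 1. t i)" by simp
  finally show "bary (ps ! 0) (chart ps t) = 1 - (\<Sum>i<n - 1. t i)"
    using b(2)[of "t(n - 1 := 0)"] fls(2) by (simp add: chart_facet[OF assms] nth_append)
qed

lemma chart_facet_positive:
  assumes v: "v \<in> S" and ps: "distinct ps" "set ps = S - {v}"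
    and t: "\<forall>i<n - 1. 0 < t i" "(\<Sum>i<n - 1. t i) < 1" and k: "k \<in> S" "k \<noteq> v"
  shows "0 < bary k (chart ps t)"
proof -
  obtain m where m: "m < length ps" "k = ps ! m"
    using k ps(2) by (metis Diff_iff in_set_conv_nth singletonD)
  then show ?thesis
    using bary_chart_facet(2)[OF v ps, of _ t] bary_chart_facet(3)[OF v ps, of t] t facet_list(1)[OF v ps]
    by (cases m) auto
qed

abbreviation facet_vertices :: "'a \<Rightarrow> 'a list" where "facet_vertices v \<equiv> ori (S - {v})"

lemma ori_facet: "distinct (facet_vertices v)" "set (facet_vertices v) = S - {v}"
  using ori_face[of "S - {v}"] facet_ne[of v] by auto

definition kappa :: "'a \<Rightarrow> real" where
  "kappa v = (SOME \<kappa>. \<kappa> \<noteq> 0 \<and> (\<forall>f\<in>Alt (n - 1). f (edges (facet_vertices v)) = \<kappa> * grad v (proxy f)))"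

lemma kappa: "v \<in> S \<Longrightarrow> kappa v \<noteq> 0"
  "v \<in> S \<Longrightarrow> f \<in> Alt (n - 1) \<Longrightarrow> f (edges (facet_vertices v)) = kappa v * grad v (proxy f)"
  using someI_ex[OF facet_form[OF _ ori_facet]] unfolding kappa_def[symmetric] by blast+

abbreviation facet_integral :: "((nat \<Rightarrow> real) \<Rightarrow> real) \<Rightarrow> real" where
  "facet_integral f \<equiv> (LINT t:std_simplex (n - 1)|Pi\<^sub>M {..<n - 1} (\<lambda>_. lborel). f t)"

lemma flux_eq:
  assumes v: "v \<in> S" and u: "u \<in> C0_forms (n - 1) S"
  shows "integral_simplex (facet_vertices v) u = kappa v * facet_integral (\<lambda>t. grad v (proxy (u (chart (facet_vertices v) t))))"
  using facet_list(1)[OF v ori_facet]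
  by (simp add: integral_simplex_alt kappa(2)[OF v C0_formsD(1)[OF u]])

text \<open>
  On the facet opposite \<open>v\<close> only \<open>lamF v\<close> and the vertex functions differ from \<open>0\<close>. So, given \<open>P\<close>, the flux
  depends on \<open>grad v (Q v)\<close> alone, with a factor that is positive by \<open>facet_weight_pos\<close>.
\<close>

lemma flux_nodal_form:
  assumes v: "v \<in> S"
  shows "integral_simplex (facet_vertices v) (nodal_form P Q A)
    = kappa v * (facet_integral (\<lambda>t. lamF v (chart (facet_vertices v) t)) * grad v (Q v)
       + (\<Sum>k\<in>S. facet_integral (\<lambda>t. lamV k (chart (facet_vertices v) t)) * grad v (P k)))"
proof -
  note fls = facet_list[OF v ori_facet]
  let ?P = "Pi\<^sub>M {..<n - 1} (\<lambda>_. lborel :: real measure)" and ?D = "std_simplex (n - 1)"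
  have int: "set_integrable ?P ?D (\<lambda>t. f (chart (facet_vertices v) t))" if "continuous_on (convex hull S) f" for f :: "'a \<Rightarrow> real"
    using set_integrable_chart[OF fls(2,5) that] fls(1) by simp
  have i1: "set_integrable ?P ?D (\<lambda>t. lamF v (chart (facet_vertices v) t) * grad v (Q v))"
    using int[OF continuous_nodal(2)[OF v]] by simp
  have i2: "set_integrable ?P ?D (\<lambda>t. lamV k (chart (facet_vertices v) t) * grad v (P k))" if "k \<in> S" for k
    using int[OF continuous_nodal(3)[OF that]] by simp
  have "grad v (proxy (nodal_form P Q A (chart (facet_vertices v) t)))
      = lamF v (chart (facet_vertices v) t) * grad v (Q v) + (\<Sum>k\<in>S. lamV k (chart (facet_vertices v) t) * grad v (P k))"
    if t: "t \<in> ?D" for t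
  proof -
    let ?x = "chart (facet_vertices v) t"
    have x: "?x \<in> convex hull S" using chart_in_hull[OF fls(2,5)] t fls(1) by simp
    note nod = nodal_on_facet[OF v x bary_chart_facet(1)[OF v ori_facet]]
    have "(\<Sum>i\<in>S. lamF i ?x * grad v (Q i)) = (\<Sum>i\<in>S. if i = v then lamF v ?x * grad v (Q v) else 0)"
      using nod(2) by (intro sum.cong) auto
    then show ?thesis using x v nod(1)
      by (simp add: proxy_nodal_form nodal_field_def linear_add[OF linear_grad[OF v]] linear_sum[OF linear_grad[OF v]]
          linear_scale[OF linear_grad[OF v]])
  qed
  then have "facet_integral (\<lambda>t. grad v (proxy (nodal_form P Q A (chart (facet_vertices v) t))))
      = facet_integral (\<lambda>t. lamF v (chart (facet_vertices v) t) * grad v (Q v) + (\<Sum>k\<in>S. lamV k (chart (facet_vertices v) t) * grad v (P k)))"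
    unfolding set_lebesgue_integral_def
    by (intro Bochner_Integration.integral_cong refl) (simp add: indicator_def)
  also have "\<dots> = facet_integral (\<lambda>t. lamF v (chart (facet_vertices v) t) * grad v (Q v))
      + facet_integral (\<lambda>t. \<Sum>k\<in>S. lamV k (chart (facet_vertices v) t) * grad v (P k))"
  proof (rule set_integral_add(2)[OF i1])
    show "set_integrable ?P ?D (\<lambda>t. \<Sum>k\<in>S. lamV k (chart (facet_vertices v) t) * grad v (P k))"
      using i2 unfolding set_integrable_def scaleR_sum_right by (intro Bochner_Integration.integrable_sum) auto
  qed
  also have "facet_integral (\<lambda>t. \<Sum>k\<in>S. lamV k (chart (facet_vertices v) t) * grad v (P k))
      = (\<Sum>k\<in>S. facet_integral (\<lambda>t. lamV k (chart (facet_vertices v) t) * grad v (P k)))"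
    using i2 unfolding set_integrable_def set_lebesgue_integral_def scaleR_sum_right
    by (intro Bochner_Integration.integral_sum) auto
  finally show ?thesis by (simp add: flux_eq[OF v nodal_form_C0])
qed

lemma facet_weight_pos:
  assumes v: "v \<in> S" shows "0 < facet_integral (\<lambda>t. lamF v (chart (facet_vertices v) t))"
proof (rule integral_std_simplex_pos)
  note fls = facet_list[OF v ori_facet]
  show "0 < n - 1" using n2 by simp
  show "set_integrable (Pi\<^sub>M {..<n - 1} (\<lambda>_. lborel)) (std_simplex (n - 1)) (\<lambda>t. lamF v (chart (facet_vertices v) t))"
    using set_integrable_chart[OF fls(2,5) continuous_nodal(2)[OF v]] fls(1) by simp
  have hull: "chart (facet_vertices v) t \<in> convex hull S" if "t \<in> std_simplex (n - 1)" for t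
    using chart_in_hull[OF fls(2,5)] that fls(1) by simp
  note b0 = bary_chart_facet(1)[OF v ori_facet]
  show "0 \<le> lamF v (chart (facet_vertices v) t)" if "t \<in> std_simplex (n - 1)" for t
    by (rule nodal_on_facet(3)[OF v hull[OF that] b0])
  show "0 < lamF v (chart (facet_vertices v) t)" if t: "\<forall>i<n - 1. 0 < t i" "(\<Sum>i<n - 1. t i) < 1" for t
  proof (rule nodal_on_facet(4)[OF v _ b0])
    show "chart (facet_vertices v) t \<in> convex hull S"
      using t by (intro hull) (auto simp: std_simplex_def intro: less_imp_le)
  qed (rule chart_facet_positive[OF v ori_facet t])
qed


section \<open>Unisolvence\<close>

lemma cdiv_alt:
  assumes "i \<in> S" "j \<in> S" "i \<noteq> j"
  shows "cdiv P Q A i j = grad i A / wS i + grad j (Q i) / wF i j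
    + ((\<Sum>k\<in>S. gV i j k (P k)) - wS j * grad i (Q i) / (wS i * wF i j))"
  by (simp add: cdiv_def gS_def gF_def diff_divide_distrib)

text \<open>
  Once \<open>P\<close> and \<open>b\<close> are fixed, \<open>h\<close> is known. The values of \<open>s\<close> and \<open>d\<close> are those for which the components of
  \<open>Q i\<close> and of \<open>A\<close> add up to \<open>0\<close>; then vectors with these components exist.
\<close>

lemma solve_const_div:
  "\<exists>Q A d. const_div P Q A d \<and> (\<forall>i\<in>S. grad i (Q i) = b i)"
proof -
  define h where "h i j = (\<Sum>k\<in>S. gV i j k (P k)) - wS j * b i / (wS i * wF i j)" for i j
  define s where "s i = (\<Sum>j\<in>S - {i}. wF i j * h i j) - b i" for i
  define d where "d = (\<Sum>i\<in>S. wS i * s i)"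
  define A where "A = (\<Sum>i\<in>S. (wS i * (d - s i)) *\<^sub>R i)"
  define c where "c i j = (if j = i then b i else wF i j * (s i - h i j))" for i j
  define Q where "Q i = (\<Sum>j\<in>S. c i j *\<^sub>R j)" for i
  have "(\<Sum>i\<in>S. wS i * (d - s i)) = (\<Sum>i\<in>S. wS i * d) - (\<Sum>i\<in>S. wS i * s i)"
    by (simp only: right_diff_distrib sum_subtractf)
  also have "(\<Sum>i\<in>S. wS i * d) = d" by (simp only: sum_distrib_right[symmetric] sum_wS mult_1)
  finally have "(\<Sum>i\<in>S. wS i * (d - s i)) = 0" by (simp only: d_def[symmetric] diff_self)
  then have A: "grad i A = wS i * (d - s i)" if "i \<in> S" for i
    unfolding A_def by (rule grad_of_combination[OF _ that])
  have Q: "grad j (Q i) = c i j" if i: "i \<in> S" and j: "j \<in> S" for i j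
    unfolding Q_def
  proof (rule grad_of_combination[OF _ j])
    have "(\<Sum>j\<in>S. c i j) = b i + (\<Sum>j\<in>S - {i}. c i j)"
      unfolding sum.remove[OF finite_S i, of "c i"] by (simp add: c_def)
    also have "(\<Sum>j\<in>S - {i}. c i j) = (\<Sum>j\<in>S - {i}. wF i j * s i) - (\<Sum>j\<in>S - {i}. wF i j * h i j)"
      unfolding sum_subtractf[symmetric] by (intro sum.cong) (auto simp: c_def algebra_simps)
    also have "(\<Sum>j\<in>S - {i}. wF i j * s i) = s i"
    proof -
      have "(\<Sum>j\<in>S - {i}. wF i j) = 1"
        using sum.remove[OF finite_S i, of "wF i"] sum_wF[of i] wF_0[OF i] by linarith
      then show ?thesis by (simp only: sum_distrib_right[symmetric] mult_1)
    qed
    finally have "sum (c i) S = b i + (s i - (\<Sum>j\<in>S - {i}. wF i j * h i j))" .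
    then show "sum (c i) S = 0" unfolding s_def by linarith
  qed
  have "cdiv P Q A i j = d" if ij: "i \<in> S" "j \<in> S" "i \<noteq> j" for i j
  proof -
    have "cdiv P Q A i j = (d - s i) + (s i - h i j) + h i j"
    proof -
      have t1: "wS i * (d - s i) / wS i = d - s i" using wS_pos[OF ij(1)] by simp
      have t2: "c i j / wF i j = s i - h i j" using wF_pos[OF ij(1,2)] ij by (simp add: c_def)
      have t3: "(\<Sum>k\<in>S. gV i j k (P k)) - wS j * c i i / (wS i * wF i j) = h i j"
        unfolding h_def c_def by simp
      show ?thesis
        unfolding cdiv_alt[OF ij] A[OF ij(1)] Q[OF ij(1,2)] Q[OF ij(1,1)] t1 t2 t3 ..
    qed
    then show ?thesis by simp
  qed
  moreover have "grad i (Q i) = b i" if "i \<in> S" for i using Q[OF that that] by (simp add: c_def)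
  ultimately show ?thesis by (intro exI[of _ Q] exI[of _ A] exI[of _ d]) simp
qed

text \<open>
  The same elimination for the homogeneous system: the components of \<open>Q i\<close> are proportional to the positive
  numbers \<open>wF i j\<close> and add up to \<open>0\<close>; then the same happens for \<open>A\<close> and \<open>wS\<close>.
\<close>

lemma const_div_unique:
  assumes div: "const_div P Q A d" and P: "\<And>k. k \<in> S \<Longrightarrow> P k = 0"
    and Q0: "\<And>i. i \<in> S \<Longrightarrow> grad i (Q i) = 0"
  shows "nodal_form P Q A = 0"
proof -
  have eq: "grad j (Q i) = wF i j * (d - grad i A / wS i)" if ij: "i \<in> S" "j \<in> S" for i j
  proof (cases "i = j")
    case False
    have "(\<Sum>k\<in>S. gV i j k (P k)) = 0"
      using P linear_0[OF linear_cell_grad(3)[OF ij]] by simp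
    then have "d = grad i A / wS i + grad j (Q i) / wF i j"
      using div ij False Q0[OF ij(1)] cdiv_alt[OF ij False, of P Q A] by simp
    then show ?thesis using wF_pos[OF ij] False by (simp add: field_simps)
  qed (use Q0 wF_0 ij in auto)
  have r: "d - grad i A / wS i = 0" if i: "i \<in> S" for i
  proof -
    have "0 = (\<Sum>j\<in>S. grad j (Q i))" by (simp add: sum_grad)
    also have "\<dots> = (\<Sum>j\<in>S. wF i j * (d - grad i A / wS i))"
      by (rule sum.cong[OF refl eq[OF i]])
    also have "\<dots> = (\<Sum>j\<in>S. wF i j) * (d - grad i A / wS i)" by (simp only: sum_distrib_right)
    finally show ?thesis by (simp add: sum_wF)
  qed
  have gA: "grad i A = wS i * d" if "i \<in> S" for i using r[OF that] wS_pos[OF that] by (simp add: field_simps)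
  have "0 = (\<Sum>i\<in>S. grad i A)" by (simp add: sum_grad)
  also have "\<dots> = (\<Sum>i\<in>S. wS i) * d" unfolding sum_distrib_right by (rule sum.cong[OF refl gA])
  finally have d: "d = 0" by (simp add: sum_wS)
  have "A = 0" using gA d by (intro grad_eq_0) simp
  moreover have "Q i = 0" if "i \<in> S" for i using eq[OF that] r[OF that] by (intro grad_eq_0) simp
  ultimately have "nodal_field P Q A x = 0" for x using P by (simp add: nodal_field_def)
  then show ?thesis using linear_0[OF contract_linear] by (auto simp: nodal_form_def fun_eq_iff)
qed

lemma nodal_form_vertex: "k \<in> S \<Longrightarrow> nodal_form P Q A k = contract (P k)"
proof -
  assume k: "k \<in> S"
  have "(\<Sum>l\<in>S. lamV l k *\<^sub>R P l) = (\<Sum>l\<in>S. if l = k then P k else 0)"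
    using nodal_at_vertex(3)[OF k] by (intro sum.cong) auto
  then have "nodal_field P Q A k = P k" using k by (simp add: nodal_field_def nodal_at_vertex[OF k])
  then show ?thesis using k by (simp add: nodal_form_def hull_inc)
qed

lemma facets_eq: "facets n S = (\<lambda>v. S - {v}) ` S"
proof
  show "(\<lambda>v. S - {v}) ` S \<subseteq> facets n S"
    using card_S facet_ne by (auto simp: facets_def faces_def)
  show "facets n S \<subseteq> (\<lambda>v. S - {v}) ` S"
  proof
    fix T assume "T \<in> facets n S"
    then have T: "T \<subseteq> S" "card T = n" by (auto simp: facets_def faces_def)
    then have "card (S - T) = 1" using card_S by (simp add: card_Diff_subset finite_subset)
    then obtain v where "S - T = {v}" by (rule card_1_singletonE)
    then have "T = S - {v}" "v \<in> S" using T by auto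
    then show "T \<in> (\<lambda>v. S - {v}) ` S" by blast
  qed
qed

lemma A_vec_C0: "u \<in> A_vec n S W \<Longrightarrow> u \<in> C0_forms (n - 1) S"
  unfolding A_vec_iff using nodal_form_C0 by blast

lemma A_vec_combine:
  assumes "u \<in> A_vec n S W" "v \<in> A_vec n S W" shows "a *\<^sub>R u + b *\<^sub>R v \<in> A_vec n S W"
proof -
  obtain P Q A d P' Q' A' d' where *: "u = nodal_form P Q A" "const_div P Q A d"
    "v = nodal_form P' Q' A'" "const_div P' Q' A' d'"
    using assms unfolding A_vec_iff by blast
  have "const_div (\<lambda>k. a *\<^sub>R P k + b *\<^sub>R P' k) (\<lambda>k. a *\<^sub>R Q k + b *\<^sub>R Q' k) (a *\<^sub>R A + b *\<^sub>R A') (a * d + b * d')"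
    using *(2,4) by (auto simp: cdiv_combine)
  then show ?thesis unfolding A_vec_iff *(1,3) nodal_form_combine[symmetric] by blast
qed

lemma subspace_A_vec: "subspace (A_vec n S W)"
proof -
  have "0 \<in> A_vec n S W"
  proof -
    have "nodal_field (\<lambda>_. 0) (\<lambda>_. 0) 0 x = 0" for x by (simp add: nodal_field_def)
    then have "nodal_form (\<lambda>_. 0) (\<lambda>_. 0) 0 = 0"
      using linear_0[OF contract_linear] by (auto simp: nodal_form_def fun_eq_iff)
    moreover have "const_div (\<lambda>_. 0) (\<lambda>_. 0) 0 0"
      using linear_0[OF linear_cell_grad(1)] linear_0[OF linear_cell_grad(2)] linear_0[OF linear_cell_grad(3)]
      by (auto simp: cdiv_def)
    ultimately show ?thesis unfolding A_vec_iff by metis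
  qed
  then show ?thesis
    using A_vec_combine[of _ _ 1 1] A_vec_combine[of _ _ _ 0] by (auto simp: subspace_def)
qed

lemma A_vec_eq_0:
  assumes u: "u \<in> A_vec n S W" and 0: "\<And>x. x \<in> S \<Longrightarrow> u x = 0" "\<And>v. v \<in> S \<Longrightarrow> integral_simplex (facet_vertices v) u = 0"
  shows "u = 0"
proof -
  obtain P Q A d where *: "u = nodal_form P Q A" "const_div P Q A d" using u unfolding A_vec_iff by blast
  have P: "P k = 0" if "k \<in> S" for k
    using 0(1)[OF that] nodal_form_vertex[OF that, of P Q A] proxy_contract[of "P k"]
    unfolding *(1) by (simp add: proxy_def)
  have "grad i (Q i) = 0" if i: "i \<in> S" for i
  proof -
    have "(\<Sum>k\<in>S. facet_integral (\<lambda>t. lamV k (chart (facet_vertices i) t)) * grad i (P k)) = 0"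
      using P linear_0[OF linear_grad[OF i]] by simp
    then show ?thesis
      using 0(2)[OF i] flux_nodal_form[OF i, of P Q A] kappa(1)[OF i] facet_weight_pos[OF i] unfolding *(1) by simp
  qed
  with const_div_unique[OF *(2) P] show ?thesis unfolding *(1) by simp
qed

lemma unisolvent_vec:
  assumes c: "\<forall>x\<in>S. c x \<in> Alt (n - 1)"
  shows "\<exists>!u. u \<in> A_vec n S W \<and> has_dofs_vec n S ori u c r"
proof (rule ex_ex1I)
  define P where "P k = proxy (c k)" for k
  define a where "a v = facet_integral (\<lambda>t. lamF v (chart (facet_vertices v) t))" for v
  define H where "H v = (\<Sum>k\<in>S. facet_integral (\<lambda>t. lamV k (chart (facet_vertices v) t)) * grad v (P k))" for v
  obtain Q A d where Q: "const_div P Q A d" "\<And>v. v \<in> S \<Longrightarrow> grad v (Q v) = (r (S - {v}) / kappa v - H v) / a v"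
    using solve_const_div[of P "\<lambda>v. (r (S - {v}) / kappa v - H v) / a v"] by blast
  have "nodal_form P Q A \<in> A_vec n S W" unfolding A_vec_iff using Q(1) by blast
  moreover have "has_dofs_vec n S ori (nodal_form P Q A) c r"
    unfolding has_dofs_vec_def facets_eq
  proof (intro conjI ballI)
    fix x assume x: "x \<in> S"
    show "nodal_form P Q A x = c x"
      unfolding nodal_form_vertex[OF x] P_def using c x by (intro contract_proxy) blast
  next
    fix T assume "T \<in> (\<lambda>v. S - {v}) ` S"
    then obtain v where v: "v \<in> S" "T = S - {v}" by blast
    have "integral_simplex (facet_vertices v) (nodal_form P Q A) = kappa v * (a v * ((r (S - {v}) / kappa v - H v) / a v) + H v)"
      unfolding flux_nodal_form[OF v(1)] Q(2)[OF v(1)] a_def[symmetric] H_def[symmetric] ..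
    also have "\<dots> = r (S - {v})"
    proof -
      have "a v \<noteq> 0" unfolding a_def using facet_weight_pos[OF v(1)] by (rule less_imp_neq[symmetric])
      then have "a v * ((r (S - {v}) / kappa v - H v) / a v) = r (S - {v}) / kappa v - H v" by simp
      then show ?thesis using kappa(1)[OF v(1)] by (simp only: diff_add_cancel) simp
    qed
    finally show "integral_simplex (ori T) (nodal_form P Q A) = r T" using v by simp
  qed
  ultimately show "\<exists>u. u \<in> A_vec n S W \<and> has_dofs_vec n S ori u c r" by blast
next
  fix u v assume *: "u \<in> A_vec n S W \<and> has_dofs_vec n S ori u c r" "v \<in> A_vec n S W \<and> has_dofs_vec n S ori v c r"
  have "1 *\<^sub>R u + (- 1) *\<^sub>R v = 0"
  proof (rule A_vec_eq_0)
    show "1 *\<^sub>R u + (- 1) *\<^sub>R v \<in> A_vec n S W" using * by (intro A_vec_combine) auto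
    show "(1 *\<^sub>R u + (- 1) *\<^sub>R v) x = 0" if "x \<in> S" for x
      using * that by (simp add: has_dofs_vec_def)
    have C0: "u \<in> C0_forms (n - 1) S" "v \<in> C0_forms (n - 1) S" using * A_vec_C0 by blast+
    show "integral_simplex (facet_vertices x) (1 *\<^sub>R u + (- 1) *\<^sub>R v) = 0" if x: "x \<in> S" for x
      using * x unfolding integral_simplex_combine[OF facet_list(2,5)[OF x ori_facet] C0]
      by (simp add: has_dofs_vec_def facets_eq)
  qed
  then show "u = v" by simp
qed

text \<open>
  The coordinates are indexed by pairs of vertices. Off the diagonal, \<open>(k, j)\<close> is component \<open>j\<close> of the vector
  at the vertex \<open>k\<close>, whose component \<open>k\<close> is minus the sum of the others; this leaves the diagonal for
  the facet integrals.
\<close>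

lemma dim_A_vec: "dim (A_vec n S W) = (n + 1)\<^sup>2"
proof -
  let ?\<Psi> = "\<lambda>u x. if snd x = fst x then integral_simplex (facet_vertices (fst x)) u else grad (snd x) (proxy (u (fst x)))"
  have comb: "?\<Psi> (a *\<^sub>R u + b *\<^sub>R v) x = a * ?\<Psi> u x + b * ?\<Psi> v x"
    if uv: "u \<in> A_vec n S W" "v \<in> A_vec n S W" and x: "x \<in> S \<times> S" for u v a b x
  proof -
    obtain k j where kj: "x = (k, j)" "k \<in> S" "j \<in> S" using x by blast
    have "proxy ((a *\<^sub>R u + b *\<^sub>R v) k) = a *\<^sub>R proxy (u k) + b *\<^sub>R proxy (v k)"
      using proxy_add[of "a *\<^sub>R u k" "b *\<^sub>R v k"] by (simp add: scaleR_fun_def[of _ u] scaleR_fun_def[of _ v] proxy_scale)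
    then show ?thesis
      using kj integral_simplex_combine[OF facet_list(2,5)[OF kj(2) ori_facet] A_vec_C0 A_vec_C0, OF uv]
      by (simp add: linear_add[OF linear_grad] linear_scale[OF linear_grad])
  qed
  have "dim (A_vec n S W) = card (S \<times> S)"
  proof (rule dim_eq_card_coordinates[where \<Psi> = ?\<Psi>])
    show "?\<Psi> (u + v) x = ?\<Psi> u x + ?\<Psi> v x" if "u \<in> A_vec n S W" "v \<in> A_vec n S W" "x \<in> S \<times> S" for u v x
      using comb[OF that, of 1 1] unfolding scaleR_one mult_1 .
    show "?\<Psi> (a *\<^sub>R u) x = a * ?\<Psi> u x" if "u \<in> A_vec n S W" "x \<in> S \<times> S" for a u x
      using comb[OF that(1,1,2), of a 0] unfolding scaleR_zero_left add_0_right mult_zero_left .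
    fix g :: "'a \<times> 'a \<Rightarrow> real"
    define p where "p k j = (if j = k then - (\<Sum>j\<in>S - {k}. g (k, j)) else g (k, j))" for k j
    define P where "P k = (\<Sum>j\<in>S. p k j *\<^sub>R j)" for k
    \<comment> \<open>the element of \<open>S - T\<close> is the vertex opposite the facet \<open>T\<close>\<close>
    obtain u where u: "u \<in> A_vec n S W" "has_dofs_vec n S ori u (\<lambda>k. contract (P k)) (\<lambda>T. g (the_elem (S - T), the_elem (S - T)))"
      using unisolvent_vec[of "\<lambda>k. contract (P k)" "\<lambda>T. g (the_elem (S - T), the_elem (S - T))"] contract_Alt by blast
    have "?\<Psi> u (k, j) = g (k, j)" if kj: "k \<in> S" "j \<in> S" for k j
    proof (cases "j = k")
      case True
      have "S - (S - {k}) = {k}" using kj by blast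
      then have "integral_simplex (facet_vertices k) u = g (k, k)" using u(2) kj by (simp add: has_dofs_vec_def facets_eq)
      then show ?thesis using True by simp
    next
      case False
      have "(\<Sum>j\<in>S. p k j) = p k k + (\<Sum>j\<in>S - {k}. p k j)" using kj by (intro sum.remove) auto
      also have "(\<Sum>j\<in>S - {k}. p k j) = (\<Sum>j\<in>S - {k}. g (k, j))" by (intro sum.cong) (auto simp: p_def)
      finally have "sum (p k) S = 0" by (simp add: p_def)
      then have "grad j (P k) = g (k, j)" using grad_of_combination[OF _ kj(2), of "p k"] False by (simp add: P_def p_def)
      moreover have "proxy (u k) = P k" using u(2) kj by (simp add: has_dofs_vec_def proxy_contract)
      ultimately show ?thesis using False by simp
    qed
    then show "\<exists>u\<in>A_vec n S W. \<forall>x\<in>S \<times> S. ?\<Psi> u x = g x" using u(1) by (intro bexI[of _ u]) auto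
  next
    fix u assume u: "u \<in> A_vec n S W" and 0: "\<And>x. x \<in> S \<times> S \<Longrightarrow> ?\<Psi> u x = 0"
    show "u = 0"
    proof (rule A_vec_eq_0[OF u])
      show "integral_simplex (facet_vertices v) u = 0" if "v \<in> S" for v using 0[of "(v, v)"] that by simp
      show "u k = 0" if k: "k \<in> S" for k
      proof (rule proxy_inject[OF C0_formsD(1)[OF A_vec_C0[OF u]]])
        have off: "grad j (proxy (u k)) = 0" if "j \<in> S" "j \<noteq> k" for j using 0[of "(k, j)"] that k by simp
        moreover have "grad k (proxy (u k)) = 0"
          using sum_grad[of "proxy (u k)"] off sum.remove[OF finite_S k, of "\<lambda>j. grad j (proxy (u k))"] by simp
        ultimately show "proxy (u k) = 0" by (intro grad_eq_0) metis
      qed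
    qed
  qed (auto simp: subspace_A_vec)
  then show ?thesis by (simp add: card_cartesian_product card_S power2_eq_square)
qed

lemma A_top_eq: "A_top n S = range vol_form"
proof
  show "A_top n S \<subseteq> range vol_form"
  proof
    fix w assume "w \<in> A_top n S"
    then obtain a where a: "a \<in> Alt n" "w = (\<lambda>x. if x \<in> convex hull S then a else 0)"
      by (auto simp: A_top_def const_forms_def)
    have "a = a frame *\<^sub>R vol"
      by (rule ext) (subst Alt_n_multiple[OF a(1)], simp add: scaleR_fun_def)
    then have "w = vol_form (a frame)" unfolding a(2) by auto
    then show "w \<in> range vol_form" by blast
  qed
  show "range vol_form \<subseteq> A_top n S"
    using subspace_scale[OF subspace_Alt vol_Alt] by (auto simp: A_top_def const_forms_def)
qed

definition simplex_measure :: real where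
  "simplex_measure = (LINT t:std_simplex n|Pi\<^sub>M {..<n} (\<lambda>_. lborel). 1)"

lemma ori_S_length: "length (ori S) = Suc n" and ori_S_ne: "ori S \<noteq> []" "set (ori S) \<subseteq> S"
  using edges_dual(1)[OF ori_S] ori_S by auto

lemma simplex_measure_pos: "0 < simplex_measure"
  unfolding simplex_measure_def
proof (rule integral_std_simplex_pos)
  show "set_integrable (Pi\<^sub>M {..<n} (\<lambda>_. lborel :: real measure)) (std_simplex n) (\<lambda>t. 1::real)"
    using set_integrable_chart[OF ori_S_ne, of "\<lambda>_. 1" n] ori_S_length by simp
qed (use n2 in auto)

lemma integral_vol_form: "integral_simplex (ori S) (vol_form d) = d * simplex_measure"
proof -
  let ?P = "Pi\<^sub>M {..<n} (\<lambda>_. lborel :: real measure)"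
  have "integral_simplex (ori S) (vol_form d) = (LINT t:std_simplex n|?P. vol_form d (chart (ori S) t) frame)"
    using ori_S_length by (simp add: integral_simplex_alt frame_def)
  also have "\<dots> = (LINT t:std_simplex n|?P. d * 1)"
    unfolding set_lebesgue_integral_def
  proof (rule Bochner_Integration.integral_cong[OF refl])
    fix t
    show "indicator (std_simplex n) t *\<^sub>R vol_form d (chart (ori S) t) frame = indicator (std_simplex n) t *\<^sub>R (d * 1)"
      using chart_in_hull[OF ori_S_ne, of t] ori_S_length
      by (auto simp: indicator_def scaleR_fun_def vol_frame)
  qed
  finally show ?thesis unfolding simplex_measure_def by (simp only: set_integral_mult_right)
qed

lemma unisolvent_top: "\<exists>!w. w \<in> A_top n S \<and> integral_simplex (ori S) w = r"
proof (rule ex1I)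
  show "vol_form (r / simplex_measure) \<in> A_top n S \<and> integral_simplex (ori S) (vol_form (r / simplex_measure)) = r"
    unfolding A_top_eq integral_vol_form using simplex_measure_pos by simp
  fix w assume "w \<in> A_top n S \<and> integral_simplex (ori S) w = r"
  then obtain d where "w = vol_form d" "d * simplex_measure = r"
    unfolding A_top_eq using integral_vol_form by auto
  then show "w = vol_form (r / simplex_measure)" using simplex_measure_pos by auto
qed

lemma dim_A_top: "dim (A_top n S) = 1"
proof -
  have comb: "a *\<^sub>R vol_form d + b *\<^sub>R vol_form e = vol_form (a * d + b * e)" for a b d e
    by (auto simp: fun_eq_iff scaleR_fun_def algebra_simps)
  have sub: "subspace (A_top n S)"
    unfolding subspace_def A_top_eq
  proof (intro conjI ballI allI)
    have "vol_form 0 = 0" by (auto simp: fun_eq_iff)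
    then show "0 \<in> range vol_form" by (rule range_eqI[OF sym])
    fix x y assume "x \<in> range vol_form" "y \<in> range vol_form"
    then obtain d e where xy: "x = vol_form d" "y = vol_form e" by (elim rangeE)
    have "x + y = vol_form (1 * d + 1 * e)"
      using comb[of 1 d 1 e] unfolding xy scaleR_one .
    then show "x + y \<in> range vol_form" by (rule range_eqI)
  next
    fix x c assume "x \<in> range vol_form"
    then obtain d where x: "x = vol_form d" by (elim rangeE)
    have "c *\<^sub>R x = vol_form (c * d + 0 * d)"
      using comb[of c d 0 d] unfolding x scaleR_zero_left add_0_right .
    then show "c *\<^sub>R x \<in> range vol_form" by (rule range_eqI)
  qed
  have "dim (A_top n S) = card {()}"
  proof (rule dim_eq_card_coordinates[where \<Psi> = "\<lambda>w _. integral_simplex (ori S) w"])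
    show "\<exists>w\<in>A_top n S. \<forall>i\<in>{()}. integral_simplex (ori S) w = g i" for g
      using ex1_implies_ex[OF unisolvent_top[of "g ()"]] by auto
    show "w = 0" if "w \<in> A_top n S" "\<And>i. i \<in> {()} \<Longrightarrow> integral_simplex (ori S) w = 0" for w
    proof -
      obtain d where d: "w = vol_form d" using \<open>w \<in> A_top n S\<close> by (auto simp: A_top_eq)
      then have "d * simplex_measure = 0" using that(2) integral_vol_form[of d] by simp
      then have "d = 0" using simplex_measure_pos by simp
      then show ?thesis unfolding d by (auto simp: fun_eq_iff)
    qed
    show "integral_simplex (ori S) (v + w) = integral_simplex (ori S) v + integral_simplex (ori S) w"
      if "v \<in> A_top n S" "w \<in> A_top n S" for v w
    proof -
      have "v \<in> C0_forms n S" "w \<in> C0_forms n S" using that vol_form_C0 unfolding A_top_eq by blast+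
      from integral_simplex_combine[OF ori_S_ne this, of 1 1] show ?thesis unfolding scaleR_one mult_1 .
    qed
    show "integral_simplex (ori S) (a *\<^sub>R w) = a * integral_simplex (ori S) w" if "w \<in> A_top n S" for a w
    proof -
      have "w \<in> C0_forms n S" using that vol_form_C0 unfolding A_top_eq by blast
      from integral_simplex_combine[OF ori_S_ne this this, of a 0] show ?thesis
        unfolding scaleR_zero_left add_0_right mult_zero_left .
    qed
  qed (auto simp: sub)
  then show ?thesis by simp
qed

end

section \<open>Stokes' theorem for continuous forms with continuous exterior derivative\<close>

lemma integral_PiM_scale_coordinate:
  fixes F :: "(nat \<Rightarrow> real) \<Rightarrow> real"
  assumes e: "0 < e"
    and int: "integrable (Pi\<^sub>M {..<Suc k} (\<lambda>_. lborel)) F"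
    and int': "integrable (Pi\<^sub>M {..<Suc k} (\<lambda>_. lborel)) (\<lambda>t. F (t(k := e * t k)))"
  shows "(LINT t|Pi\<^sub>M {..<Suc k} (\<lambda>_. lborel). F t)
    = e * (LINT t|Pi\<^sub>M {..<Suc k} (\<lambda>_. lborel). F (t(k := e * t k)))"
proof -
  let ?P = "Pi\<^sub>M {..<k} (\<lambda>_. lborel :: real measure)"
  note ins = lessThan_Suc[of k]
  have "(LINT t|Pi\<^sub>M {..<Suc k} (\<lambda>_. lborel). F t) = (LINT t|?P. LINT y|lborel. F (t(k := y)))"
    unfolding ins by (rule lborel_product.product_integral_insert) (use int in \<open>auto simp: ins\<close>)
  also have "\<dots> = (LINT t|?P. e * (LINT y|lborel. F (t(k := e * y))))"
    using e by (subst lborel_integral_real_affine[where c = e and t = 0]) auto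
  also have "\<dots> = e * (LINT t|?P. LINT y|lborel. F (t(k := e * y)))" by simp
  also have "(LINT t|?P. LINT y|lborel. F (t(k := e * y)))
      = (LINT t|Pi\<^sub>M {..<Suc k} (\<lambda>_. lborel). F (t(k := e * t k)))"
    unfolding ins by (subst lborel_product.product_integral_insert) (use int' in \<open>auto simp: ins\<close>)
  finally show ?thesis .
qed

lemma AE_std_simplex_boundary:
  "AE t in Pi\<^sub>M {..<k} (\<lambda>_. lborel :: real measure). t \<in> std_simplex k \<longleftrightarrow> (\<forall>i<k. 0 < t i) \<and> (\<Sum>i<k. t i) < 1"
proof (cases "k = 0")
  case False
  have "AE t in Pi\<^sub>M {..<k} (\<lambda>_. lborel :: real measure). \<forall>i\<in>{..<k}. t i \<noteq> 0"
  proof (rule AE_finite_allI)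
    fix i assume i: "i \<in> {..<k}"
    have "AE t in Pi\<^sub>M {..<k} (\<lambda>_. lborel :: real measure). (\<Sum>j<k. (if j = i then 1 else 0) * t j) \<noteq> 0"
      using i by (intro AE_PiM_not_hyperplane[of i]) auto
    then show "AE t in Pi\<^sub>M {..<k} (\<lambda>_. lborel :: real measure). t i \<noteq> 0"
      using i by (simp add: mult_delta_left)
  qed simp
  moreover have "AE t in Pi\<^sub>M {..<k} (\<lambda>_. lborel :: real measure). (\<Sum>j<k. 1 * t j) \<noteq> 1"
    using False by (intro AE_PiM_not_hyperplane[of 0]) auto
  ultimately show ?thesis
    by eventually_elim (auto simp: std_simplex_def less_le intro: less_imp_le)
qed (simp add: std_simplex_def)

lemma cutoff'_bounded: obtains B where "\<And>s. \<bar>cutoff' s\<bar> \<le> B" "0 \<le> B"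
proof -
  have "\<exists>C\<ge>0. \<forall>x. \<bar>cutoff' x\<bar> \<le> C"
    by (rule continuous_compact_support(2)[OF continuous_cutoff', of "{1..2}"]) (auto intro: cutoff'_0)
  then obtain C where "0 \<le> C" "\<forall>x. \<bar>cutoff' x\<bar> \<le> C" by (elim exE conjE)
  then show thesis by (intro that[of C]) simp_all
qed

lemma borel_cutoff [measurable]: "cutoff \<in> borel_measurable borel" "cutoff' \<in> borel_measurable borel"
  by (auto intro: borel_measurable_continuous_onI continuous_cutoff continuous_cutoff')

context full_simplex
begin

lemma chart_integral:
  assumes ps: "distinct ps" "set ps = S"
  obtains c where "c > 0" "\<And>f :: 'a \<Rightarrow> real. f \<in> borel_measurable borel \<Longrightarrow>
    (LINT t|Pi\<^sub>M {..<n} (\<lambda>_. lborel). f (chart ps t)) = c * (LINT x|lborel. f x)"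
proof -
  note d = edges_dual[OF ps]
  have eq: "chart ps t = ps ! 0 + (\<Sum>i<n. t i *\<^sub>R edges ps ! i)" for t
    unfolding chart_def using d(1) by (intro arg_cong2[where f = "(+)"] sum.cong) (auto simp: nth_tl)
  have "\<exists>c>0. \<forall>f\<in>borel_measurable borel.
    (LINT t|Pi\<^sub>M {..<n} (\<lambda>_. lborel). f (ps ! 0 + (\<Sum>i<n. t i *\<^sub>R edges ps ! i))) = c * (LINT x|lborel. f x :: real)"
  proof (rule integral_affine_chart)
    show "linear (grad (ps ! Suc i))" if "i < n" for i using that by (intro linear_grad d(5)) simp
  qed (rule d(3,4), assumption?, assumption?)+
  then obtain c where c: "c > 0" "\<forall>f\<in>borel_measurable borel.
    (LINT t|Pi\<^sub>M {..<n} (\<lambda>_. lborel). f (chart ps t)) = c * (LINT x|lborel. f x :: real)"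
    unfolding eq[symmetric] by (elim exE conjE)
  show thesis by (rule that[OF c(1)]) (rule c(2)[rule_format])
qed

lemma borel_bary [measurable]: "v \<in> S \<Longrightarrow> bary v \<in> borel_measurable borel"
  using continuous_bary[of v UNIV "\<lambda>x. x"] by (intro borel_measurable_continuous_onI) simp

text \<open>
  Up to a factor \<open>1 / e\<close>, the coefficient of \<open>grad v\<close> in the derivative of the product of all
  \<open>cutoff (bary l x / e)\<close>. It lives in the layer \<open>e \<le> bary v x \<le> 2 * e\<close> along one facet.
\<close>

definition layer :: "'a \<Rightarrow> real \<Rightarrow> 'a \<Rightarrow> real" where
  "layer v e x = cutoff' (bary v x / e) * (\<Prod>l\<in>S - {v}. cutoff (bary l x / e))"

lemma layer_outside:
  assumes e: "0 < e" and v: "v \<in> S" and x: "x \<notin> interior (convex hull S)" shows "layer v e x = 0"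
proof -
  obtain l where l: "l \<in> S" "bary l x \<le> 0" using x unfolding interior_iff by force
  then have le: "bary l x / e \<le> 1" using e by (simp add: pos_divide_le_eq)
  show ?thesis
  proof (cases "l = v")
    case True
    then show ?thesis using le by (simp add: layer_def cutoff'_0)
  next
    case False
    then have "(\<Prod>l\<in>S - {v}. cutoff (bary l x / e)) = 0"
      using l le by (intro prod_zero) (auto intro!: bexI[of _ l] cutoff_0)
    then show ?thesis by (simp add: layer_def)
  qed
qed

lemma prod_cutoff_bounds: "0 \<le> (\<Prod>l\<in>I. cutoff (g l))" "(\<Prod>l\<in>I. cutoff (g l)) \<le> 1"
  by (auto intro!: prod_nonneg prod_le_1 cutoff_bounds)

text \<open>
  In the chart that extends the coordinates of the facet by \<open>bary v\<close>, rescaling this last coordinate by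
  \<open>e\<close> gives the layer a fixed width. The integrand then converges pointwise: the other cutoffs tend to the
  indicator function of the open facet, and \<open>f\<close> tends to its values on the facet.
\<close>

lemma layer_limit:
  assumes v: "v \<in> S"
  shows "\<exists>C. \<forall>f. continuous_on (convex hull S) f \<longrightarrow>
    (\<lambda>m. LINT x:interior (convex hull S)|lborel. layer v (1 / Suc m) x / (1 / Suc m) * f x)
      \<longlonglongrightarrow> C * facet_integral (\<lambda>t. f (chart (facet_vertices v) t))"
proof -
  define qs where "qs = facet_vertices v @ [v]"
  note fls = facet_list[OF v ori_facet, folded qs_def]
  define k where "k = n - 1"
  have nk: "n = Suc k" using n2 by (simp add: k_def)
  let ?Pn = "Pi\<^sub>M {..<n} (\<lambda>_. lborel :: real measure)" and ?Pk = "Pi\<^sub>M {..<k} (\<lambda>_. lborel :: real measure)"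
  obtain c where c: "c > 0" "\<And>f :: 'a \<Rightarrow> real. f \<in> borel_measurable borel \<Longrightarrow>
      (LINT t|?Pn. f (chart qs t)) = c * (LINT x|lborel. f x)"
    using chart_integral[OF fls(3,4)] by blast
  have bv: "bary v (chart qs t) = t k" for t
    using bary_chart(1)[OF fls(3,4), of k t] fls(1) nk by (simp add: qs_def nth_append)
  have bi: "bary (qs ! Suc i) (chart qs t) = t i" if "i < k" for i t
    using bary_chart(1)[OF fls(3,4), of i t] that nk by simp
  have b0: "bary (qs ! 0) (chart qs t) = 1 - (\<Sum>i<k. t i) - t k" for t
    using bary_chart(2)[OF fls(3,4), of t] nk by simp
  have q_other: "qs ! Suc i \<in> S - {v}" if "i < k" for i
    using that fls(1,2,4) nk nth_mem[of "Suc i" "facet_vertices v"] ori_facet(2)[of v] by (auto simp: qs_def nth_append)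
  have q0: "qs ! 0 \<in> S - {v}"
    using fls(1,2) nth_mem[of 0 "facet_vertices v"] ori_facet(2)[of v] by (auto simp: qs_def nth_append)
  have len: "length qs - 1 = n" using fls(1) by (simp add: qs_def)
  have facet: "chart (facet_vertices v) t = chart qs (t(k := 0))" for t
    using chart_facet[OF v ori_facet] by (simp add: qs_def k_def)
  let ?O = "\<lambda>t. (\<forall>i<k. 0 < t i) \<and> (\<Sum>i<k. t i) < (1::real)"
  obtain B where B: "\<And>s. \<bar>cutoff' s\<bar> \<le> B" "0 \<le> B" using cutoff'_bounded by blast
  have [measurable]: "chart qs \<in> measurable ?Pn borel" by (rule chart_measurable[OF len[symmetric]])
  show ?thesis
  proof (intro exI allI impI)
    fix f :: "'a \<Rightarrow> real" assume f: "continuous_on (convex hull S) f"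
    define f0 where "f0 x = (if x \<in> convex hull S then f x else 0)" for x
    have f0 [measurable]: "f0 \<in> borel_measurable borel" unfolding f0_def by (rule measurable_on_hull[OF f])
    obtain M where M: "\<And>x. \<bar>f0 x\<bar> \<le> M" "0 \<le> M"
    proof -
      obtain M where "\<And>x. x \<in> convex hull S \<Longrightarrow> \<bar>f x\<bar> \<le> M" using bounded_on_hull[OF f] by blast
      then have "\<bar>f0 x\<bar> \<le> max 0 M" for x by (auto simp: f0_def le_max_iff_disj)
      then show thesis by (rule that) simp
    qed
    have bound: "\<bar>layer v e x * f0 x\<bar> \<le> B * M" for e x
    proof -
      have "\<bar>layer v e x\<bar> \<le> B * 1"
        unfolding layer_def abs_mult
        using prod_cutoff_bounds[where I = "S - {v}" and g = "\<lambda>l. bary l x / e"] B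
        by (intro mult_mono) auto
      then have "\<bar>layer v e x\<bar> * \<bar>f0 x\<bar> \<le> B * M" using M B by (intro mult_mono) auto
      then show ?thesis by (simp add: abs_mult)
    qed
    have layer_meas [measurable]: "(\<lambda>x. layer v e x * f0 x) \<in> borel_measurable borel" for e
      unfolding layer_def[abs_def] using v by measurable
    define H where "H e t = layer v e (chart qs t) * f0 (chart qs t)" for e t
    have H_meas [measurable]: "H e \<in> borel_measurable ?Pn" for e
      unfolding H_def[abs_def] by measurable
    have up [measurable]: "(\<lambda>t. t(k := e * t k)) \<in> measurable ?Pn ?Pn" for e
    proof (rule measurable_fun_upd)
      show "{..<n} = {..<n} \<union> {k}" using nk by auto
      have "k \<in> {..<n}" using nk by simp
      then show "(\<lambda>t. e * t k) \<in> measurable ?Pn lborel" by measurable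
    qed measurable
    have H_supp: "0 < t k / e \<and> t k / e < 2 \<and> (\<forall>i<k. 0 < t i \<and> t i < 1)"
      if "H e t \<noteq> 0" "0 < e" for e t
    proof -
      have l: "layer v e (chart qs t) \<noteq> 0" using that by (simp add: H_def)
      then have "chart qs t \<in> interior (convex hull S)" using layer_outside[OF that(2) v] by blast
      then have inn: "0 < bary l (chart qs t)" if "l \<in> S" for l using that by (simp add: interior_iff)
      have pos: "0 < t k" "0 < 1 - (\<Sum>i<k. t i) - t k"
        using inn[OF v] inn[of "qs ! 0"] q0 by (simp_all add: bv b0)
      have pos_i: "0 < t i" if "i < k" for i
        using inn[of "qs ! Suc i"] q_other[OF that] bi[OF that, of t] by simp
      have "cutoff' (t k / e) \<noteq> 0" using l by (auto simp: layer_def bv)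
      then have "t k / e < 2" using cutoff'_0[of "t k / e"] by force
      moreover have "t i < 1" if "i < k" for i
        using member_le_sum[of i "{..<k}" t] that pos pos_i by (force intro: less_imp_le)
      ultimately show ?thesis using pos pos_i that(2) by simp
    qed
    have int_H: "integrable ?Pn (H e)" if e: "0 < e" for e
    proof (rule integrable_PiM_bounded_support[where C = "B * M" and M = "max 1 (2 * e)"])
      show "\<bar>H e t\<bar> \<le> B * M" for t unfolding H_def by (rule bound)
      show "\<bar>t i\<bar> \<le> max 1 (2 * e)" if "H e t \<noteq> 0" "i < n" for t i
        using H_supp[OF that(1) e] that(2) e nk by (cases "i = k") (auto simp: field_simps le_max_iff_disj less_Suc_eq)
    qed (rule H_meas)
    \<comment> \<open>the integrand after the rescaling; its factor \<open>e\<close> cancels the denominator in the layer\<close>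
    define G where "G e t = H e (t(k := e * t k))" for e t
    have G_supp: "\<bar>t i\<bar> \<le> 2" if "G e t \<noteq> 0" "0 < e" "i < n" for e t i
    proof -
      have *: "0 < e * t k / e" "e * t k / e < 2" "\<And>i. i < k \<Longrightarrow> 0 < t i \<and> t i < 1"
        using H_supp[of e "t(k := e * t k)"] that by (auto simp: G_def)
      show ?thesis
      proof (cases "i = k")
        case True
        then show ?thesis using *(1,2) that(2) by simp
      next
        case False
        then have "i < k" using that nk by simp
        from *(3)[OF this] show ?thesis by simp
      qed
    qed
    have G_bound: "\<bar>G e t\<bar> \<le> B * M" for e t unfolding G_def H_def by (rule bound)
    have G_meas [measurable]: "G e \<in> borel_measurable ?Pn" for e
      unfolding G_def[abs_def] by measurable
    have int_G: "integrable ?Pn (G e)" if e: "0 < e" for e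
    proof (rule integrable_PiM_bounded_support[where C = "B * M" and M = 2])
      show "\<bar>t i\<bar> \<le> 2" if "G e t \<noteq> 0" "i < n" for t i by (rule G_supp[OF that(1) e that(2)])
    qed (rule G_meas G_bound)+
    have J: "(LINT x:interior (convex hull S)|lborel. layer v e x / e * f x) = (LINT t|?Pn. G e t) / c"
      if e: "0 < e" for e
    proof -
      have "(LINT x:interior (convex hull S)|lborel. layer v e x / e * f x) = (LINT x|lborel. (layer v e x * f0 x) / e)"
        unfolding set_lebesgue_integral_def
      proof (rule Bochner_Integration.integral_cong[OF refl])
        fix x
        show "indicator (interior (convex hull S)) x *\<^sub>R (layer v e x / e * f x) = layer v e x * f0 x / e"
          using layer_outside[OF e v, of x] interior_subset[of "convex hull S"]
          by (auto simp: indicator_def f0_def)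
      qed
      also have "\<dots> = (LINT x|lborel. layer v e x * f0 x) / e" by simp
      also have "(LINT x|lborel. layer v e x * f0 x) = (LINT t|?Pn. H e t) / c"
        using c(2)[OF layer_meas[of e]] c(1) by (simp add: H_def)
      also have "(LINT t|?Pn. H e t) = e * (LINT t|?Pn. G e t)"
        using integral_PiM_scale_coordinate[OF e, of k "H e"] int_H[OF e] int_G[OF e]
        by (simp add: G_def[abs_def] nk)
      finally show ?thesis using e by simp
    qed
    define g where "g t = (if ?O t then f0 (chart (facet_vertices v) t) else 0)" for t
    have meas_lim: "(\<lambda>t. cutoff' (t k) * g t) \<in> borel_measurable ?Pn"
    proof -
      have "(\<lambda>t. chart qs (t(k := 0 * t k))) \<in> measurable ?Pn borel" by measurable
      then have [measurable]: "chart (facet_vertices v) \<in> measurable ?Pn borel"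
        unfolding facet[abs_def] mult_zero_left .
      have "{t \<in> space ?Pn. ?O t} \<in> sets ?Pn"
      proof -
        have [measurable]: "(\<lambda>t. t i) \<in> borel_measurable ?Pn" if "i \<in> {..<k}" for i
          using that nk measurable_component_singleton[of i "{..<n}" "\<lambda>_. lborel :: real measure"] by simp
        have "{t \<in> space ?Pn. (\<forall>i\<in>{..<k}. 0 < t i) \<and> (\<Sum>i<k. t i) < 1} \<in> sets ?Pn" by measurable
        then show ?thesis by simp
      qed
      moreover have "(\<lambda>t. f0 (chart (facet_vertices v) t)) \<in> borel_measurable ?Pn" by measurable
      ultimately have "g \<in> borel_measurable ?Pn"
        unfolding g_def[abs_def] by (intro measurable_If borel_measurable_const)
      moreover have "(\<lambda>t. t k) \<in> borel_measurable ?Pn"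
        using nk measurable_component_singleton[of k "{..<n}" "\<lambda>_. lborel :: real measure"] by simp
      then have "(\<lambda>t. cutoff' (t k)) \<in> borel_measurable ?Pn"
        by (rule measurable_compose) (rule borel_cutoff)
      ultimately show ?thesis by (intro borel_measurable_times)
    qed
    have "(\<lambda>m. LINT t|?Pn. G (1 / Suc m) t) \<longlonglongrightarrow> (LINT t|?Pn. cutoff' (t k) * g t)"
    proof (rule integral_dominated_convergence[where w = "\<lambda>t. B * M * indicator {t. \<forall>i\<in>{..<n}. \<bar>t i\<bar> \<le> 2} t"])
      have "{t \<in> space ?Pn. \<forall>i\<in>{..<n}. \<bar>t i\<bar> \<le> 2} \<in> sets ?Pn" by measurable
      then have "(indicator {t. \<forall>i\<in>{..<n}. \<bar>t i\<bar> \<le> 2} :: _ \<Rightarrow> real) \<in> borel_measurable ?Pn"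
        by (subst borel_measurable_indicator_iff) (simp add: Int_def conj_commute)
      then have wm: "(\<lambda>t. B * M * indicator {t. \<forall>i\<in>{..<n}. \<bar>t i\<bar> \<le> 2} t) \<in> borel_measurable ?Pn"
        by measurable
      show "integrable ?Pn (\<lambda>t. B * M * indicator {t. \<forall>i\<in>{..<n}. \<bar>t i\<bar> \<le> 2} t)"
        by (rule integrable_PiM_bounded_support[OF wm, where C = "B * M" and M = 2])
          (use B M in \<open>auto simp: indicator_def split: if_splits\<close>)
      show "AE t in ?Pn. norm (G (1 / Suc m) t) \<le> B * M * indicator {t. \<forall>i\<in>{..<n}. \<bar>t i\<bar> \<le> 2} t" for m
      proof (rule AE_I2)
        fix t
        show "norm (G (1 / Suc m) t) \<le> B * M * indicator {t. \<forall>i\<in>{..<n}. \<bar>t i\<bar> \<le> 2} t"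
        proof (cases "G (1 / Suc m) t = 0")
          case False
          then have "t \<in> {t. \<forall>i\<in>{..<n}. \<bar>t i\<bar> \<le> 2}" using G_supp[OF False] by auto
          then show ?thesis using G_bound[of "1 / Suc m" t] by simp
        qed (use B M in simp)
      qed
      show "AE t in ?Pn. (\<lambda>m. G (1 / Suc m) t) \<longlonglongrightarrow> cutoff' (t k) * g t"
      proof (rule AE_I2)
        fix t :: "nat \<Rightarrow> real"
        define e where "e m = 1 / real (Suc m)" for m
        have e: "0 < e m" for m by (simp add: e_def)
        have e0: "e \<longlonglongrightarrow> 0" using LIMSEQ_inverse_real_of_nat by (simp add: inverse_eq_divide e_def[abs_def])
        define x where "x m = chart qs (t(k := e m * t k))" for m
        define x0 where "x0 = chart qs (t(k := 0))"
        have G: "G (e m) t = cutoff' (t k) * ((\<Prod>l\<in>S - {v}. cutoff (bary l (x m) / e m)) * f0 (x m))" for m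
          using e[of m] by (simp add: G_def H_def layer_def bv x_def)
        have "(\<lambda>m. G (e m) t) \<longlonglongrightarrow> cutoff' (t k) * g t"
        proof (cases "cutoff' (t k) = 0")
          case True
          then show ?thesis by (simp add: G)
        next
          case False
          then have tk: "1 < t k" using cutoff'_0[of "t k"] by force
          have xi: "bary (qs ! Suc i) (x m) = t i" if "i < k" for i m using bi[OF that] that by (simp add: x_def)
          have xv: "bary v (x m) = e m * t k" for m by (simp add: bv x_def)
          have x0': "bary (qs ! 0) (x m) = 1 - (\<Sum>i<k. t i) - e m * t k" for m by (simp add: b0 x_def)
          show ?thesis
          \<comment> \<open>off the open facet one of the cutoffs vanishes for every \<open>m\<close>\<close>
          proof (cases "?O t")
            case True
            have pos: "\<exists>b>0. \<forall>\<^sub>F m in sequentially. b \<le> bary l (x m)" if l: "l \<in> S - {v}" for l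
            proof -
              have "l \<in> set qs" using l fls(4) by simp
              then obtain i where i: "i < length qs" "l = qs ! i" by (metis in_set_conv_nth)
              have "i \<noteq> n" using l i fls(1) by (auto simp: qs_def nth_append)
              then have "i < n" using i(1) fls(1) by (simp add: qs_def)
              show ?thesis
              proof (cases i)
                case 0
                let ?b = "(1 - (\<Sum>i<k. t i)) / 2"
                have "(\<lambda>m. e m * t k) \<longlonglongrightarrow> 0 * t k" by (intro tendsto_intros e0)
                moreover have b: "0 < ?b" using True by simp
                ultimately have "\<forall>\<^sub>F m in sequentially. e m * t k < ?b" by (intro order_tendstoD(2)[of _ "0 * t k"]) auto
                then have "\<forall>\<^sub>F m in sequentially. ?b \<le> bary l (x m)"
                  by (rule eventually_mono) (simp add: i 0 x0' field_simps)
                then show ?thesis using b by blast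
              next
                case (Suc j)
                then have j: "j < k" using \<open>i < n\<close> nk by simp
                then show ?thesis using True i Suc xi[OF j] by (intro exI[of _ "t j"]) simp
              qed
            qed
            have one: "\<forall>\<^sub>F m in sequentially. cutoff (bary l (x m) / e m) = 1 \<and> 0 < bary l (x m)" if l: "l \<in> S - {v}" for l
            proof -
              obtain b where b: "b > 0" "\<forall>\<^sub>F m in sequentially. b \<le> bary l (x m)" using pos[OF l] by blast
              have "\<forall>\<^sub>F m in sequentially. e m < b / 2" using e0 b(1) by (intro order_tendstoD(2)[OF e0]) simp
              with b(2) show ?thesis
              proof eventually_elim
                case (elim m)
                then have "2 * e m \<le> bary l (x m)" by simp
                then have "2 \<le> bary l (x m) / e m" using e[of m] by (simp add: pos_le_divide_eq)
                then show ?case using elim b(1) by (simp add: cutoff_1)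
              qed
            qed
            have ev: "\<forall>\<^sub>F m in sequentially. \<forall>l\<in>S - {v}. cutoff (bary l (x m) / e m) = 1 \<and> 0 < bary l (x m)"
              using one by (intro eventually_ball_finite) auto
            have x_eq: "x m = x0 + (e m * t k) *\<^sub>R (v - qs ! 0)" for m
            proof -
              have "(\<Sum>i<k. (t(k := r)) i *\<^sub>R (qs ! Suc i - qs ! 0)) = (\<Sum>i<k. t i *\<^sub>R (qs ! Suc i - qs ! 0))" for r
                by (intro sum.cong) auto
              moreover have "qs ! Suc k = v" using fls(1) nk by (simp add: qs_def nth_append)
              ultimately show ?thesis unfolding x_def x0_def chart_def len nk by simp
            qed
            have lim: "x \<longlonglongrightarrow> x0"
            proof -
              have "(\<lambda>m. x0 + (e m * t k) *\<^sub>R (v - qs ! 0)) \<longlonglongrightarrow> x0 + (0 * t k) *\<^sub>R (v - qs ! 0)"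
                by (intro tendsto_intros e0)
              then show ?thesis by (simp add: x_eq[abs_def])
            qed
            have hull: "\<forall>\<^sub>F m in sequentially. x m \<in> convex hull S"
              using ev
            proof eventually_elim
              case (elim m)
              have "0 \<le> bary l (x m)" if "l \<in> S" for l
                using elim that xv[of m] e[of m] tk by (cases "l = v") (auto intro: less_imp_le)
              then show ?case by (simp add: hull_iff)
            qed
            have x0_hull: "x0 \<in> convex hull S"
              using Lim_in_closed_set[OF compact_imp_closed[OF compact_hull] hull _ lim] by simp
            have "(\<lambda>m. f (x m)) \<longlonglongrightarrow> f x0"
              by (rule continuous_on_tendsto_compose[OF f lim x0_hull hull])
            moreover have "\<forall>\<^sub>F m in sequentially. f (x m) = (\<Prod>l\<in>S - {v}. cutoff (bary l (x m) / e m)) * f0 (x m)"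
              using ev hull by eventually_elim (simp add: f0_def)
            ultimately have "(\<lambda>m. (\<Prod>l\<in>S - {v}. cutoff (bary l (x m) / e m)) * f0 (x m)) \<longlonglongrightarrow> f x0"
              by (rule Lim_transform_eventually)
            moreover have "g t = f x0" using True x0_hull by (simp add: g_def f0_def facet x0_def)
            ultimately show ?thesis unfolding G by (intro tendsto_mult_left) simp
          next
            case F: False
            then consider i where "i < k" "t i \<le> 0" | "1 \<le> (\<Sum>i<k. t i)" by force
            then have z: "(\<Prod>l\<in>S - {v}. cutoff (bary l (x m) / e m)) = 0" for m
            proof cases
              case 1
              then have "cutoff (bary (qs ! Suc i) (x m) / e m) = 0"
                using xi[OF 1(1)] e[of m] by (intro cutoff_0) (simp add: pos_divide_le_eq)
              then show ?thesis using q_other[OF 1(1)] by (intro prod_zero) auto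
            next
              case 2
              have "0 \<le> e m * t k" using e[of m] tk by simp
              then have "bary (qs ! 0) (x m) \<le> 0" using 2 by (simp add: x0')
              then have "cutoff (bary (qs ! 0) (x m) / e m) = 0"
                using e[of m] by (intro cutoff_0) (simp add: pos_divide_le_eq)
              then show ?thesis using q0 by (intro prod_zero) auto
            qed
            have g0: "g t = 0" using F unfolding g_def by (rule if_not_P)
            show ?thesis unfolding G z g0 mult_zero_left mult_zero_right by (rule tendsto_const)
          qed
        qed
        then show "(\<lambda>m. G (1 / Suc m) t) \<longlonglongrightarrow> cutoff' (t k) * g t" by (simp add: e_def)
      qed
    qed (rule meas_lim G_meas)+
    also have "(LINT t|?Pn. cutoff' (t k) * g t) = (LINT s|lborel. cutoff' s) * facet_integral (\<lambda>t. f (chart (facet_vertices v) t))"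
    proof -
      have g_k: "g (x(k := y)) = g x" for x y
      proof -
        have "length (facet_vertices v) - 1 = k" using fls(1) by (simp add: k_def)
        then have "chart (facet_vertices v) (x(k := y)) = chart (facet_vertices v) x"
          unfolding chart_def by (intro arg_cong2[where f = "(+)"] sum.cong) auto
        moreover have "(\<Sum>i<k. (x(k := y)) i) = (\<Sum>i<k. x i)" by (intro sum.cong) auto
        moreover have "(\<forall>i<k. 0 < (x(k := y)) i) \<longleftrightarrow> (\<forall>i<k. 0 < x i)" by auto
        ultimately show ?thesis unfolding g_def by (simp only:)
      qed
      have int: "integrable ?Pn (\<lambda>t. cutoff' (t k) * g t)"
      proof (rule integrable_PiM_bounded_support[where C = "B * M" and M = 2])
        show "\<bar>cutoff' (t k) * g t\<bar> \<le> B * M" for t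
          unfolding abs_mult using B M by (intro mult_mono) (auto simp: g_def)
        show "\<bar>t i\<bar> \<le> 2" if nz: "cutoff' (t k) * g t \<noteq> 0" and i: "i < n" for t i
        proof (cases "i = k")
          case True
          have "cutoff' (t k) \<noteq> 0" using nz by auto
          then show ?thesis using True cutoff'_0[of "t k"] by force
        next
          case False
          then have ik: "i < k" using i nk by simp
          have O: "?O t" using nz by (auto simp: g_def split: if_splits)
          then have "t i \<le> (\<Sum>i<k. t i)" using ik by (intro member_le_sum) (auto intro: less_imp_le)
          then show ?thesis using O ik by force
        qed
      qed (rule meas_lim)
      have "(LINT t|?Pn. cutoff' (t k) * g t) = (LINT t|?Pk. LINT y|lborel. cutoff' ((t(k := y)) k) * g (t(k := y)))"
        unfolding nk lessThan_Suc
        by (rule lborel_product.product_integral_insert) (use int in \<open>auto simp: nk lessThan_Suc\<close>)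
      also have "\<dots> = (LINT t|?Pk. (LINT y|lborel. cutoff' y) * g t)" by (simp add: g_k)
      also have "\<dots> = (LINT y|lborel. cutoff' y) * (LINT t|?Pk. g t)" by simp
      also have "(LINT t|?Pk. g t) = (LINT t|?Pk. indicator (std_simplex k) t *\<^sub>R f (chart (facet_vertices v) t))"
      proof (rule integral_cong_AE)
        show "AE t in ?Pk. g t = indicator (std_simplex k) t *\<^sub>R f (chart (facet_vertices v) t)"
          using AE_std_simplex_boundary
        proof eventually_elim
          case (elim t)
          have "chart (facet_vertices v) t \<in> convex hull S" if "t \<in> std_simplex k"
            using chart_in_hull[OF facet_list(2,5)[OF v ori_facet]] that facet_list(1)[OF v ori_facet]
            by (simp add: k_def)
          then show ?case using elim by (auto simp: g_def f0_def indicator_def)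
        qed
        have [measurable]: "chart (facet_vertices v) \<in> measurable ?Pk borel"
          by (rule chart_measurable) (use facet_list(1)[OF v ori_facet] in \<open>simp add: k_def\<close>)
        have "{t \<in> space ?Pk. (\<forall>i\<in>{..<k}. 0 < t i) \<and> (\<Sum>i<k. t i) < 1} \<in> sets ?Pk" by measurable
        then have [measurable]: "Measurable.pred ?Pk ?O" by (simp add: pred_def)
        show "g \<in> borel_measurable ?Pk" unfolding g_def[abs_def] by measurable
        have "set_integrable ?Pk (std_simplex k) (\<lambda>t. f (chart (facet_vertices v) t))"
          using facet_list(1)[OF v ori_facet]
          by (intro set_integrable_chart[OF facet_list(2,5)[OF v ori_facet] f]) (simp add: k_def)
        then show "(\<lambda>t. indicator (std_simplex k) t *\<^sub>R f (chart (facet_vertices v) t)) \<in> borel_measurable ?Pk"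
          unfolding set_integrable_def by (rule borel_measurable_integrable)
      qed
      finally show ?thesis by (simp add: set_lebesgue_integral_def k_def)
    qed
    finally have "(\<lambda>m. (LINT t|?Pn. G (1 / Suc m) t) / c)
        \<longlonglongrightarrow> (LINT s|lborel. cutoff' s) * facet_integral (\<lambda>t. f (chart (facet_vertices v) t)) / c"
      using c(1) by (intro tendsto_divide tendsto_const) auto
    moreover have "(LINT x:interior (convex hull S)|lborel. layer v (1 / Suc m) x / (1 / Suc m) * f x)
        = (LINT t|?Pn. G (1 / Suc m) t) / c" for m
      by (rule J) simp
    ultimately show "(\<lambda>m. LINT x:interior (convex hull S)|lborel. layer v (1 / Suc m) x / (1 / Suc m) * f x)
      \<longlonglongrightarrow> ((LINT s|lborel. cutoff' s) / c) * facet_integral (\<lambda>t. f (chart (facet_vertices v) t))"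
      by (simp only: times_divide_eq_left)
  qed
qed

end

context full_simplex
begin

lemma cutoff_product_test_function:
  assumes e: "0 < e"
  shows "test_function (interior (convex hull S)) (\<lambda>x. \<Prod>v\<in>S. cutoff (bary v x / e))
    (\<lambda>x h. \<Sum>v\<in>S. layer v e x / e * grad v h)"
  unfolding test_function_def
proof (intro conjI allI)
  fix x
  have D: "((\<lambda>x. cutoff (bary v x / e)) has_derivative (\<lambda>h. cutoff' (bary v x / e) * (grad v h / e))) (at x)"
    if v: "v \<in> S" for v
  proof -
    have "(grad v has_derivative grad v) (at x)"
      by (intro bounded_linear_imp_has_derivative linear_conv_bounded_linear[THEN iffD1] linear_grad v)
    then have "((\<lambda>x. (bary v 0 + grad v x) / e) has_derivative (\<lambda>h. grad v h / e)) (at x)"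
      using e by (auto intro!: derivative_eq_intros)
    then have "((\<lambda>x. bary v x / e) has_derivative (\<lambda>h. grad v h / e)) (at x)"
      by (simp add: grad_def)
    moreover have "(cutoff has_derivative (*) (cutoff' s)) (at s)" for s
      using DERIV_cutoff[of s] by (simp add: has_field_derivative_def)
    ultimately show ?thesis by (rule has_derivative_compose)
  qed
  have "((\<lambda>x. \<Prod>v\<in>S. cutoff (bary v x / e)) has_derivative
      (\<lambda>h. \<Sum>v\<in>S. cutoff' (bary v x / e) * (grad v h / e) * (\<Prod>l\<in>S - {v}. cutoff (bary l x / e)))) (at x)"
    by (rule has_derivative_prod[OF D])
  also have "(\<lambda>h. \<Sum>v\<in>S. cutoff' (bary v x / e) * (grad v h / e) * (\<Prod>l\<in>S - {v}. cutoff (bary l x / e)))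
      = (\<lambda>h. \<Sum>v\<in>S. layer v e x / e * grad v h)"
    by (simp add: layer_def mult_ac)
  finally show "((\<lambda>x. \<Prod>v\<in>S. cutoff (bary v x / e)) has_derivative (\<lambda>h. \<Sum>v\<in>S. layer v e x / e * grad v h)) (at x)" .
next
  fix h
  show "continuous_on UNIV (\<lambda>x. \<Sum>v\<in>S. layer v e x / e * grad v h)"
    unfolding layer_def using e
    by (intro continuous_intros continuous_on_compose2[OF continuous_cutoff] continuous_on_compose2[OF continuous_cutoff'])
      auto
next
  let ?K = "{x. \<forall>v\<in>S. e \<le> bary v x}"
  have "closed (\<Inter>v\<in>S. {x. e \<le> bary v x})"
    by (intro closed_INT ballI closed_Collect_le continuous_intros)
  also have "(\<Inter>v\<in>S. {x. e \<le> bary v x}) = ?K" by auto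
  finally have "closed ?K" .
  moreover have "?K \<subseteq> convex hull S"
  proof
    fix x assume "x \<in> ?K"
    then have x: "\<forall>v\<in>S. e \<le> bary v x" by simp
    have "0 \<le> bary v x" if "v \<in> S" for v using bspec[OF x that] e by linarith
    then show "x \<in> convex hull S" by (simp add: hull_iff)
  qed
  ultimately have "compact ?K" using compact_Int_closed[OF compact_hull, of ?K] by (simp add: Int_absorb1)
  moreover have "?K \<subseteq> interior (convex hull S)"
  proof
    fix x assume "x \<in> ?K"
    then have x: "\<forall>v\<in>S. e \<le> bary v x" by simp
    have "0 < bary v x" if "v \<in> S" for v using bspec[OF x that] e by linarith
    then show "x \<in> interior (convex hull S)" by (simp add: interior_iff)
  qed
  moreover have "(\<Prod>v\<in>S. cutoff (bary v x / e)) = 0" if x: "x \<notin> ?K" for x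
  proof -
    obtain v where v: "v \<in> S" "bary v x < e" using x by force
    then have "cutoff (bary v x / e) = 0" using e by (intro cutoff_0) (simp add: pos_divide_le_eq)
    then show ?thesis using v(1) by (intro prod_zero) auto
  qed
  ultimately show "\<exists>K\<subseteq>interior (convex hull S). compact K \<and> (\<forall>x. x \<notin> K \<longrightarrow> (\<Prod>v\<in>S. cutoff (bary v x / e)) = 0)"
    by (intro exI[of _ ?K]) simp
qed

lemma continuous_proxy_component:
  assumes u: "u \<in> C0_forms (n - 1) S" and l: "linear l"
  shows "continuous_on (convex hull S) (\<lambda>x. l (proxy (u x)) :: real)"
proof -
  have "l (proxy (u x)) = (\<Sum>i<n. ((- 1) ^ i * u x (del i frame)) * l (frame ! i))" for x
    by (simp add: proxy_def linear_sum[OF l] linear_scale[OF l])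
  then show ?thesis by (simp only:) (intro continuous_intros C0_formsD(3)[OF u])
qed

text \<open>
  The products of cutoffs tend to the indicator function of the interior, and their derivatives split into
  one layer along each facet. The factors \<open>K\<close> collect orientations and the factors of the charts. That
  they are independent of \<open>u\<close> is what allows to compare forms with equal facet integrals.
\<close>

lemma stokes:
  "\<exists>K. \<forall>u w. u \<in> C0_forms (n - 1) S \<longrightarrow> w \<in> C0_forms n S \<longrightarrow> has_ext_deriv (n - 1) S u w \<longrightarrow>
    (LINT x:interior (convex hull S)|lborel. w x frame) = (\<Sum>v\<in>S. K v * integral_simplex (facet_vertices v) u)"
proof -
  let ?U = "interior (convex hull S)"
  let ?J = "\<lambda>v m f. LINT x:?U|lborel. layer v (1 / Suc m) x / (1 / Suc m) * f x"
  obtain C where C: "\<And>v f. v \<in> S \<Longrightarrow> continuous_on (convex hull S) f \<Longrightarrow>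
    (\<lambda>m. ?J v m f) \<longlonglongrightarrow> C v * facet_integral (\<lambda>t. f (chart (facet_vertices v) t))"
    using bchoice[of S "\<lambda>v C. \<forall>f. continuous_on (convex hull S) f \<longrightarrow>
      (\<lambda>m. ?J v m f) \<longlonglongrightarrow> C * facet_integral (\<lambda>t. f (chart (facet_vertices v) t))"] layer_limit by blast
  show ?thesis
  proof (intro exI allI impI)
    fix u w assume u: "u \<in> C0_forms (n - 1) S" and w: "w \<in> C0_forms n S" and du: "has_ext_deriv (n - 1) S u w"
    let ?\<phi> = "\<lambda>m x. \<Prod>v\<in>S. cutoff (bary v x / (1 / Suc m))"
    let ?g = "\<lambda>v x. grad v (proxy (u x))"
    have contg: "continuous_on (convex hull S) (?g v)" if "v \<in> S" for v
      by (rule continuous_proxy_component[OF u linear_grad[OF that]])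
    have contw: "continuous_on (convex hull S) (\<lambda>x. w x frame)" by (rule C0_formsD(3)[OF w])
    have eq: "(LINT x:?U|lborel. w x frame * ?\<phi> m x) = (\<Sum>v\<in>S. - ?J v m (?g v))" for m
    proof -
      have e: "0 < 1 / real (Suc m)" by simp
      note t = cutoff_product_test_function[OF e]
      have int: "set_integrable lborel ?U (\<lambda>x. layer v (1 / Suc m) x / (1 / Suc m) * ?g v x)" if v: "v \<in> S" for v
      proof (rule interior_integrable)
        have "continuous_on (convex hull S) (layer v (1 / Suc m))"
          unfolding layer_def using v
          by (intro continuous_intros continuous_on_compose2[OF continuous_cutoff] continuous_on_compose2[OF continuous_cutoff']) auto
        then show "continuous_on (convex hull S) (\<lambda>x. layer v (1 / Suc m) x / (1 / Suc m) * ?g v x)"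
          using v by (intro continuous_on_mult continuous_on_divide continuous_on_const contg) auto
      qed
      have "(LINT x:?U|lborel. w x frame * ?\<phi> m x)
          = - (LINT x:?U|lborel. \<Sum>v\<in>S. layer v (1 / Suc m) x / (1 / Suc m) * ?g v x)"
        using du t unfolding has_ext_deriv_iff[OF u w] by (elim allE impE) 
      also have "(LINT x:?U|lborel. \<Sum>v\<in>S. layer v (1 / Suc m) x / (1 / Suc m) * ?g v x) = (\<Sum>v\<in>S. ?J v m (?g v))"
        using int unfolding set_integrable_def set_lebesgue_integral_def scaleR_sum_right
        by (intro Bochner_Integration.integral_sum)
      finally show ?thesis by (simp only: sum_negf)
    qed
    have "(\<lambda>m. \<Sum>v\<in>S. - ?J v m (?g v)) \<longlonglongrightarrow> (\<Sum>v\<in>S. - (C v * facet_integral (\<lambda>t. ?g v (chart (facet_vertices v) t))))"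
      by (intro tendsto_sum tendsto_minus C contg)
    moreover have "(\<lambda>m. LINT x:?U|lborel. w x frame * ?\<phi> m x) \<longlonglongrightarrow> (LINT x:?U|lborel. w x frame)"
      unfolding set_lebesgue_integral_def
    proof (rule integral_dominated_convergence[where w = "\<lambda>x. norm (indicator ?U x *\<^sub>R w x frame)"])
      have iw: "integrable lborel (\<lambda>x. indicator ?U x *\<^sub>R w x frame)"
        using interior_integrable[OF contw] by (simp add: set_integrable_def)
      then show "integrable lborel (\<lambda>x. norm (indicator ?U x *\<^sub>R w x frame))" by (rule integrable_norm)
      show "(\<lambda>x. indicator ?U x *\<^sub>R w x frame) \<in> borel_measurable lborel" using iw by (rule borel_measurable_integrable)
      have "(\<lambda>x. cutoff (bary v x / (1 / Suc m))) \<in> borel_measurable lborel" if "v \<in> S" for v m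
        using that by measurable
      then have "(\<lambda>x. (indicator ?U x *\<^sub>R w x frame) * ?\<phi> m x) \<in> borel_measurable lborel" for m
        by (intro borel_measurable_times borel_measurable_integrable[OF iw] borel_measurable_prod)
      then show "(\<lambda>x. indicator ?U x *\<^sub>R (w x frame * ?\<phi> m x)) \<in> borel_measurable lborel" for m
        by (simp only: real_scaleR_def mult.assoc)
      show "AE x in lborel. norm (indicator ?U x *\<^sub>R (w x frame * ?\<phi> m x)) \<le> norm (indicator ?U x *\<^sub>R w x frame)" for m
      proof (rule AE_I2)
        fix x
        have "\<bar>?\<phi> m x\<bar> \<le> 1"
          using prod_cutoff_bounds[where I = S and g = "\<lambda>v. bary v x / (1 / Suc m)"] by simp
        then have "\<bar>w x frame\<bar> * \<bar>?\<phi> m x\<bar> \<le> \<bar>w x frame\<bar> * 1" by (intro mult_left_mono) auto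
        then have "\<bar>indicator ?U x :: real\<bar> * (\<bar>w x frame\<bar> * \<bar>?\<phi> m x\<bar>) \<le> \<bar>indicator ?U x\<bar> * (\<bar>w x frame\<bar> * 1)"
          by (rule mult_left_mono) simp
        then show "norm (indicator ?U x *\<^sub>R (w x frame * ?\<phi> m x)) \<le> norm (indicator ?U x *\<^sub>R w x frame)"
          by (simp only: real_norm_def real_scaleR_def abs_mult mult_1_right)
      qed
      show "AE x in lborel. (\<lambda>m. indicator ?U x *\<^sub>R (w x frame * ?\<phi> m x)) \<longlonglongrightarrow> indicator ?U x *\<^sub>R w x frame"
      proof (rule AE_I2)
        fix x
        show "(\<lambda>m. indicator ?U x *\<^sub>R (w x frame * ?\<phi> m x)) \<longlonglongrightarrow> indicator ?U x *\<^sub>R w x frame"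
        proof (cases "x \<in> ?U")
          case True
          have "\<forall>\<^sub>F m in sequentially. cutoff (bary v x / (1 / Suc m)) = 1" if v: "v \<in> S" for v
          proof -
            have b: "0 < bary v x" using True v by (simp add: interior_iff)
            obtain N :: nat where N: "2 / bary v x < N" using reals_Archimedean2 by blast
            have "cutoff (bary v x / (1 / Suc m)) = 1" if "N \<le> m" for m
            proof (rule cutoff_1)
              have "2 < N * bary v x" using N b by (simp add: pos_divide_less_eq)
              also have "\<dots> \<le> Suc m * bary v x" using that b by (intro mult_right_mono) auto
              finally show "2 \<le> bary v x / (1 / Suc m)" by (simp add: mult.commute)
            qed
            then show ?thesis by (rule eventually_sequentiallyI)
          qed
          then have "\<forall>\<^sub>F m in sequentially. \<forall>v\<in>S. cutoff (bary v x / (1 / Suc m)) = 1"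
            by (intro eventually_ball_finite) auto
          then have "\<forall>\<^sub>F m in sequentially. indicator ?U x *\<^sub>R (w x frame * ?\<phi> m x) = indicator ?U x *\<^sub>R w x frame"
            by (rule eventually_mono) simp
          then show ?thesis by (rule tendsto_eventually)
        qed simp
      qed
    qed
    ultimately have "(LINT x:?U|lborel. w x frame) = (\<Sum>v\<in>S. - (C v * facet_integral (\<lambda>t. ?g v (chart (facet_vertices v) t))))"
      unfolding eq by (intro LIMSEQ_unique)
    also have "\<dots> = (\<Sum>v\<in>S. (- C v / kappa v) * integral_simplex (facet_vertices v) u)"
      using kappa(1) by (intro sum.cong) (auto simp: flux_eq[OF _ u])
    finally show "(LINT x:?U|lborel. w x frame) = (\<Sum>v\<in>S. (- C v / kappa v) * integral_simplex (facet_vertices v) u)" .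
  qed
qed

lemma integral_simplex_top:
  "\<exists>c. \<forall>w\<in>C0_forms n S. integral_simplex (ori S) w = c * (LINT x:interior (convex hull S)|lborel. w x frame)"
proof -
  let ?U = "interior (convex hull S)" and ?P = "Pi\<^sub>M {..<n} (\<lambda>_. lborel :: real measure)"
  obtain c where c: "\<And>f :: 'a \<Rightarrow> real. f \<in> borel_measurable borel \<Longrightarrow>
      (LINT t|?P. f (chart (ori S) t)) = c * (LINT x|lborel. f x)"
    using chart_integral[OF ori_S] by blast
  have "integral_simplex (ori S) w = c * (LINT x:?U|lborel. w x frame)" if w: "w \<in> C0_forms n S" for w
  proof -
    note contw = C0_formsD(3)[OF w, of frame]
    have fm: "(\<lambda>x. indicator ?U x *\<^sub>R w x frame) \<in> borel_measurable borel"
      using interior_integrable[OF contw] unfolding set_integrable_def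
      by (auto dest: borel_measurable_integrable)
    have U: "chart (ori S) t \<in> ?U \<longleftrightarrow> (\<forall>i<n. 0 < t i) \<and> (\<Sum>i<n. t i) < 1" for t
    proof -
      have "chart (ori S) t \<in> ?U \<longleftrightarrow> (\<forall>i<Suc n. 0 < bary (ori S ! i) (chart (ori S) t))"
        unfolding interior_iff using ori_S(2) ori_S_length by (metis in_set_conv_nth)
      also have "\<dots> \<longleftrightarrow> 0 < bary (ori S ! 0) (chart (ori S) t) \<and> (\<forall>i<n. 0 < bary (ori S ! Suc i) (chart (ori S) t))"
        by (rule All_less_Suc2)
      finally show ?thesis by (auto simp: bary_chart[OF ori_S])
    qed
    have "integral_simplex (ori S) w = (LINT t|?P. indicator (std_simplex n) t *\<^sub>R w (chart (ori S) t) frame)"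
      using ori_S_length by (simp add: integral_simplex_alt frame_def set_lebesgue_integral_def)
    also have "\<dots> = (LINT t|?P. indicator ?U (chart (ori S) t) *\<^sub>R w (chart (ori S) t) frame)"
    proof (rule integral_cong_AE)
      show "(\<lambda>t. indicator (std_simplex n) t *\<^sub>R w (chart (ori S) t) frame) \<in> borel_measurable ?P"
        using set_integrable_chart[OF ori_S_ne contw, of n] ori_S_length unfolding set_integrable_def
        by (auto dest: borel_measurable_integrable)
      have "chart (ori S) \<in> measurable ?P borel" by (rule chart_measurable) (simp add: ori_S_length)
      from measurable_compose[OF this fm]
      show "(\<lambda>t. indicator ?U (chart (ori S) t) *\<^sub>R w (chart (ori S) t) frame) \<in> borel_measurable ?P" .
      show "AE t in ?P. indicator (std_simplex n) t *\<^sub>R w (chart (ori S) t) frame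
          = indicator ?U (chart (ori S) t) *\<^sub>R w (chart (ori S) t) frame"
        using AE_std_simplex_boundary
      proof eventually_elim
        case (elim t)
        then show ?case using U[of t] by (simp add: indicator_def)
      qed
    qed
    also have "\<dots> = c * (LINT x:?U|lborel. w x frame)"
      unfolding set_lebesgue_integral_def by (rule c[OF fm])
    finally show ?thesis .
  qed
  then show ?thesis by blast
qed

text \<open>
  The interpolant of \<open>u\<close> has the same facet integrals as \<open>u\<close>, so its constant exterior derivative has
  the same integral over \<open>S\<close> as \<open>w\<close>, and a constant \<open>n\<close>-form is determined by its integral.
\<close>

lemma interpolators_commute:
  assumes u: "u \<in> C0_forms (n - 1) S" and w: "w \<in> C0_forms n S" and du: "has_ext_deriv (n - 1) S u w"
  shows "has_ext_deriv (n - 1) S (I_vec n S W ori u) (I_top n S ori w)"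
proof -
  let ?v = "I_vec n S W ori u"
  have "\<forall>x\<in>S. u x \<in> Alt (n - 1)" using C0_formsD(1)[OF u] by blast
  then have "?v \<in> A_vec n S W \<and> has_dofs_vec n S ori ?v u (\<lambda>T. integral_simplex (ori T) u)"
    unfolding I_vec_def by (rule theI'[OF unisolvent_vec])
  then have v: "?v \<in> A_vec n S W" and dofs: "has_dofs_vec n S ori ?v u (\<lambda>T. integral_simplex (ori T) u)"
    by (rule conjunct1, rule conjunct2)
  have flux: "integral_simplex (facet_vertices s) ?v = integral_simplex (facet_vertices s) u" if "s \<in> S" for s
    using dofs that unfolding has_dofs_vec_def facets_eq by blast
  obtain P Q A d where *: "?v = nodal_form P Q A" "const_div P Q A d"
    using v unfolding A_vec_iff by (elim exE conjE)
  have dv: "has_ext_deriv (n - 1) S ?v (vol_form d)"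
    unfolding *(1) by (rule const_div_ext_deriv[OF *(2)])
  let ?int = "\<lambda>w. LINT x:interior (convex hull S)|lborel. w x frame"
  obtain K where "\<forall>u w. u \<in> C0_forms (n - 1) S \<longrightarrow> w \<in> C0_forms n S \<longrightarrow> has_ext_deriv (n - 1) S u w \<longrightarrow>
      ?int w = (\<Sum>v\<in>S. K v * integral_simplex (facet_vertices v) u)"
    using stokes by (elim exE)
  note K = this[rule_format]
  have "?int w = (\<Sum>s\<in>S. K s * integral_simplex (facet_vertices s) u)" by (rule K[OF u w du])
  also have "\<dots> = (\<Sum>s\<in>S. K s * integral_simplex (facet_vertices s) ?v)" by (rule sum.cong) (simp_all add: flux)
  also have "\<dots> = ?int (vol_form d)" by (rule K[OF A_vec_C0[OF v] vol_form_C0 dv, symmetric])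
  finally have "?int w = ?int (vol_form d)" .
  moreover obtain c where "\<forall>w\<in>C0_forms n S. integral_simplex (ori S) w = c * ?int w"
    using integral_simplex_top by (elim exE)
  ultimately have "integral_simplex (ori S) (vol_form d) = integral_simplex (ori S) w"
    using w vol_form_C0[of d] by (simp del: split_paired_All)
  moreover have "vol_form d \<in> A_top n S" unfolding A_top_eq by (rule rangeI)
  ultimately have "I_top n S ori w = vol_form d"
    unfolding I_top_def by (intro the1_equality unisolvent_top conjI)
  then show ?thesis using dv by simp
qed

end

theorem proposition7p15:
  fixes n :: nat
    and S :: "'a::euclidean_space set"
    and W :: "'a set \<Rightarrow> 'a"
    and ori :: "'a set \<Rightarrow> 'a list"
  assumes "n \<ge> 2" and "DIM('a) = n"
    and "card S = n + 1" and "\<not> affine_dependent S"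
    and "inpoints S W"
    and "orientations S ori"
  shows
    "(\<comment> \<open>(a) unisolvence and dimensions\<close>
      (\<forall>c r. (\<forall>x\<in>S. c x \<in> Alt (n - 1)) \<longrightarrow>
        (\<exists>!u. u \<in> A_vec n S W \<and> has_dofs_vec n S ori u c r)) \<and>
      (\<forall>r. \<exists>!w. w \<in> A_top n S \<and> integral_simplex (ori S) w = r) \<and>
      dim (A_vec n S W) = (n + 1)\<^sup>2 \<and>
      dim (A_top n S) = 1) \<and>
     (\<comment> \<open>(b) commuting interpolators\<close>
      \<forall>u w. u \<in> C0_forms (n - 1) S \<longrightarrow> w \<in> C0_forms n S \<longrightarrow> has_ext_deriv (n - 1) S u w \<longrightarrow>
        has_ext_deriv (n - 1) S (I_vec n S W ori u) (I_top n S ori w)) \<and>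
     (\<comment> \<open>(c) minimality\<close>
      dim (A_vec n S W) = (n + 1) * dim (Alt (n - 1) :: 'a form set) + (n + 1) \<and>
      dim (A_top n S) = 1)"
proof -
  interpret full_simplex n S W ori by (rule full_simplex.intro) fact+
  have "dim (A_vec n S W) = (n + 1) * dim (Alt (n - 1) :: 'a form set) + (n + 1)"
    unfolding dim_A_vec dim_Alt_vectors by (simp add: power2_eq_square)
  then show ?thesis
    by (intro conjI allI impI unisolvent_vec unisolvent_top dim_A_vec dim_A_top interpolators_commute)
qed

end
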